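(* Let $\varphi$ be a non-periodic proper primitive substitution over a finite alphabet $A$. Then the Schützenberger group $G(\varphi)$ admits, as a profinite group, the presentation $$\langle A\mid \varphi_{\mathsf G}^{\,\omega}(a)=a\ (a\in A)\rangle_{\mathsf G}.$$
   Context: Profinite notions. $\mathsf S$ (resp. $\mathsf G$) is the pseudovariety of all finite semigroups (resp. finite groups). $\overline\Omega_A\mathsf S$ is the free profinite semigroup and $\overline\Omega_A\mathsf G$ the free profinite group on the finite set $A$. The subsemigroup of $\overline\Omega_A\mathsf S$ generated by $A$ is identified with the free semigroup $A^+$. For a finitely generated profinite semigroup $S$, the monoid $\mathrm{End}\,S$ of continuous endomorphisms is profinite for pointwise convergence; $\Phi^\omega=\lim_n\Phi^{n!}$ is the idempotent power of $\Phi\in\mathrm{End}\,S$. The presentation $\langle A\mid R\rangle_{\mathsf G}$, with $R\subseteq\overline\Omega_A\mathsf G\times\overline\Omega_A\mathsf G$, defines the quotient of $\overline\Omega_A\mathsf G$ by the closed congruence generated by $R$; a profinite group admits the presentation if it is isomorphic (as a topological group) to this quotient. Substitutions. A substitution over a finite alphabet $A$ is an endomorphism $\varphi$ of $A^+$; its unique extension to a continuous endomorphism of $\overline\Omega_A\mathsf S$ is also denoted $\varphi$, and $\varphi_{\mathsf G}$ is the unique continuous endomorphism of $\overline\Omega_A\mathsf G$ mapping each $a\in A$ to the word $\varphi(a)$ viewed in $\overline\Omega_A\mathsf G$. $\varphi$ is primitive if there is $n\ge1$ such that every letter $a$ occurs in $\varphi^n(b)$ for all $a,b\in A$, and $\lim_n|\varphi^n(b)|=\infty$.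 $\varphi$ is proper if there are letters $a,b\in A$ such that for every $d\in A$ the word $\varphi(d)$ starts with $a$ and ends with $b$. A subshift of $A^{\mathbb Z}$ is a nonempty closed subset invariant under the shift and its inverse; $L(\mathcal X)$ is the set of finite blocks (nonempty finite factors) of elements of $\mathcal X$. It is minimal if it contains no proper subshift; a minimal subshift is periodic if it is finite (generated by a periodic biinfinite word). A primitive $\varphi$ defines a minimal subshift $\mathcal X_\varphi\subseteq A^{\mathbb Z}$, where a word is in $L(\mathcal X_\varphi)$ iff it is a factor of $\varphi^k(a)$ for all $a\in A$ and all sufficiently large $k$. $\varphi$ is periodic if $\mathcal X_\varphi$ is. Schützenberger group. For a minimal subshift $\mathcal X$, the closure of $L(\mathcal X)$ in $\overline\Omega_A\mathsf S$ is the disjoint union of $L(\mathcal X)$ and a regular $\mathcal J$-class $J(\mathcal X)$. Put $J(\varphi)=J(\mathcal X_\varphi)$. $G(\varphi)$ is the profinite group isomorphic to the maximal subgroups of $J(\varphi)$ (which are all isomorphic). *)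

theory Defs
  imports "HOL-Analysis.Analysis" "HOL-Algebra.Coset" "HOL-Library.Sublist"
begin

section \<open>Semigroups and groups\<close>

text \<open>
  Semigroups are represented by HOL-Algebra records of type \<^typ>\<open>'a monoid\<close> of which only the
  fields \<^term>\<open>carrier\<close> and \<^term>\<open>mult\<close> are meaningful; the field \<^term>\<open>one\<close> is never
  used, except in \<open>is_group\<close>, where it is overwritten by an identity element. Homomorphisms and
  isomorphisms are \<^const>\<open>hom\<close> and \<^const>\<open>iso\<close>, neither of which refers to \<^term>\<open>one\<close>.
\<close>

definition is_semigroup :: "'a monoid \<Rightarrow> bool" where
  "is_semigroup S \<longleftrightarrow>
     (\<forall>x\<in>carrier S. \<forall>y\<in>carrier S. x \<otimes>\<^bsub>S\<^esub> y \<in> carrier S) \<and>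
     (\<forall>x\<in>carrier S. \<forall>y\<in>carrier S. \<forall>z\<in>carrier S.
        (x \<otimes>\<^bsub>S\<^esub> y) \<otimes>\<^bsub>S\<^esub> z = x \<otimes>\<^bsub>S\<^esub> (y \<otimes>\<^bsub>S\<^esub> z))"

definition is_group :: "'a monoid \<Rightarrow> bool" where
  "is_group S \<longleftrightarrow> (\<exists>e. group (S\<lparr>one := e\<rparr>))"

definition is_congruence :: "'a monoid \<Rightarrow> ('a \<times> 'a) set \<Rightarrow> bool" where
  "is_congruence S \<theta> \<longleftrightarrow> equiv (carrier S) \<theta> \<and>
     (\<forall>(x, x')\<in>\<theta>. \<forall>(y, y')\<in>\<theta>. (x \<otimes>\<^bsub>S\<^esub> y, x' \<otimes>\<^bsub>S\<^esub> y') \<in> \<theta>)"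

definition quotient_semigroup :: "'a monoid \<Rightarrow> ('a \<times> 'a) set \<Rightarrow> 'a set monoid" where
  "quotient_semigroup S \<theta> =
     \<lparr>carrier = carrier S // \<theta>, mult = (\<lambda>X Y. \<theta> `` (X <#>\<^bsub>S\<^esub> Y)), one = undefined\<rparr>"

text \<open>A subgroup of a semigroup need not contain an identity element of the whole semigroup.\<close>

definition semigroup_subgroup :: "'a monoid \<Rightarrow> 'a set \<Rightarrow> bool" where
  "semigroup_subgroup S H \<longleftrightarrow> H \<subseteq> carrier S \<and> is_group (S\<lparr>carrier := H\<rparr>)"

definition maximal_subgroup :: "'a monoid \<Rightarrow> 'a set \<Rightarrow> bool" where
  "maximal_subgroup S H \<longleftrightarrow> semigroup_subgroup S H \<and>
     (\<forall>K. semigroup_subgroup S K \<and> H \<subseteq> K \<longrightarrow> K = H)"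

definition fin_semigroup :: "'a monoid \<Rightarrow> bool" where
  "fin_semigroup S \<longleftrightarrow> finite (carrier S) \<and> is_semigroup S"

definition fin_group :: "'a monoid \<Rightarrow> bool" where
  "fin_group S \<longleftrightarrow> finite (carrier S) \<and> is_group S"


section \<open>Topological semigroups\<close>

text \<open>Continuous endomorphisms, as functions that are \<^const>\<open>undefined\<close> outside the carrier.\<close>

definition End :: "'a monoid \<Rightarrow> 'a topology \<Rightarrow> ('a \<Rightarrow> 'a) set" where
  "End S T = {f \<in> hom S S. f \<in> extensional (carrier S) \<and> continuous_map T T f}"

definition End_topology :: "'a monoid \<Rightarrow> 'a topology \<Rightarrow> ('a \<Rightarrow> 'a) topology" where
  "End_topology S T = subtopology (product_topology (\<lambda>_. T) (carrier S)) (End S T)"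

definition omega_power :: "'a monoid \<Rightarrow> 'a topology \<Rightarrow> ('a \<Rightarrow> 'a) \<Rightarrow> ('a \<Rightarrow> 'a)" where
  "omega_power S T \<Phi> =
     (THE \<Psi>. limitin (End_topology S T) (\<lambda>n. restrict (\<Phi> ^^ fact n) (carrier S)) \<Psi> sequentially)"

definition quotient_topology :: "'a topology \<Rightarrow> ('a \<times> 'a) set \<Rightarrow> 'a set topology" where
  "quotient_topology T \<theta> =
     topology (\<lambda>U. U \<subseteq> topspace T // \<theta> \<and> openin T {x \<in> topspace T. \<theta> `` {x} \<in> U})"

lemma openin_quotient_topology:
  "openin (quotient_topology T \<theta>) U \<longleftrightarrow>
     U \<subseteq> topspace T // \<theta> \<and> openin T {x \<in> topspace T. \<theta> `` {x} \<in> U}"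
proof -
  have "istopology (\<lambda>U. U \<subseteq> topspace T // \<theta> \<and> openin T {x \<in> topspace T. \<theta> `` {x} \<in> U})"
    unfolding istopology_def
  proof (intro conjI allI impI)
    fix U V
    assume "U \<subseteq> topspace T // \<theta> \<and> openin T {x \<in> topspace T. \<theta> `` {x} \<in> U}"
      and "V \<subseteq> topspace T // \<theta> \<and> openin T {x \<in> topspace T. \<theta> `` {x} \<in> V}"
    moreover have "{x \<in> topspace T. \<theta> `` {x} \<in> U \<inter> V} =
        {x \<in> topspace T. \<theta> `` {x} \<in> U} \<inter> {x \<in> topspace T. \<theta> `` {x} \<in> V}" by auto
    ultimately show "U \<inter> V \<subseteq> topspace T // \<theta>"
      and "openin T {x \<in> topspace T. \<theta> `` {x} \<in> U \<inter> V}" by auto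
  next
    fix \<K>
    assume *: "\<forall>K\<in>\<K>. K \<subseteq> topspace T // \<theta> \<and> openin T {x \<in> topspace T. \<theta> `` {x} \<in> K}"
    then show "\<Union> \<K> \<subseteq> topspace T // \<theta>" by auto
    have "{x \<in> topspace T. \<theta> `` {x} \<in> \<Union> \<K>} =
        (\<Union>K\<in>\<K>. {x \<in> topspace T. \<theta> `` {x} \<in> K})" by auto
    then show "openin T {x \<in> topspace T. \<theta> `` {x} \<in> \<Union> \<K>}"
      using * by auto
  qed
  then show ?thesis
    unfolding quotient_topology_def by (simp add: topology_inverse')
qed

definition closed_congruence_generated ::
    "'a monoid \<Rightarrow> 'a topology \<Rightarrow> ('a \<times> 'a) set \<Rightarrow> ('a \<times> 'a) set" where
  "closed_congruence_generated S T R =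
     \<Inter> {\<theta>. is_congruence S \<theta> \<and> closedin (prod_topology T T) \<theta> \<and> R \<subseteq> \<theta>}"

definition topologically_isomorphic ::
    "'a monoid \<Rightarrow> 'a topology \<Rightarrow> 'b monoid \<Rightarrow> 'b topology \<Rightarrow> bool" where
  "topologically_isomorphic S T S' T' \<longleftrightarrow> (\<exists>h. h \<in> iso S S' \<and> homeomorphic_map T T' h)"


section \<open>Free profinite semigroups and groups\<close>

definition free_semigroup :: "'a set \<Rightarrow> 'a list monoid" where
  "free_semigroup A = \<lparr>carrier = lists A - {[]}, mult = (@), one = undefined\<rparr>"

text \<open>
  For a pseudovariety \<open>V\<close>, the free pro-\<open>V\<close> semigroup on a finite set \<open>A\<close> is the inverse limit of
  all \<open>A\<close>-generated members of \<open>V\<close>, that is, of the quotients in \<open>V\<close> of the free semigroup on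
  \<open>A\<close>. An element of the inverse limit is a family \<open>x\<close> of congruence classes \<open>x \<theta>\<close>; for
  \<open>\<theta> \<subseteq> \<rho>\<close> the connecting map sends a \<open>\<theta>\<close>-class to the \<open>\<rho>\<close>-class that includes it.
  The case \<open>V = fin_group\<close> yields the free profinite group, since every element of a finite group
  generated by \<open>A\<close> is a product of elements of \<open>A\<close>, without the use of inverses.
\<close>

type_synonym 'a pro = "('a list \<times> 'a list) set \<Rightarrow> 'a list set"

definition pro_congruences ::
    "('a list set monoid \<Rightarrow> bool) \<Rightarrow> 'a set \<Rightarrow> ('a list \<times> 'a list) set set" where
  "pro_congruences V A =
     {\<theta>. is_congruence (free_semigroup A) \<theta> \<and> V (quotient_semigroup (free_semigroup A) \<theta>)}"

definition free_pro :: "('a list set monoid \<Rightarrow> bool) \<Rightarrow> 'a set \<Rightarrow> 'a pro monoid" where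
  "free_pro V A =
     \<lparr>carrier = {x \<in> \<Pi>\<^sub>E \<theta>\<in>pro_congruences V A. carrier (free_semigroup A) // \<theta>.
                  \<forall>\<theta>\<in>pro_congruences V A. \<forall>\<rho>\<in>pro_congruences V A. \<theta> \<subseteq> \<rho> \<longrightarrow> x \<theta> \<subseteq> x \<rho>},
      mult = (\<lambda>x y. \<lambda>\<theta>\<in>pro_congruences V A.
                x \<theta> \<otimes>\<^bsub>quotient_semigroup (free_semigroup A) \<theta>\<^esub> y \<theta>),
      one = undefined\<rparr>"

definition free_pro_topology :: "('a list set monoid \<Rightarrow> bool) \<Rightarrow> 'a set \<Rightarrow> 'a pro topology" where
  "free_pro_topology V A =
     subtopology
       (product_topology (\<lambda>\<theta>. discrete_topology (carrier (free_semigroup A) // \<theta>))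
         (pro_congruences V A))
       (carrier (free_pro V A))"

text \<open>The image of a word in the free pro-\<open>V\<close> semigroup.\<close>

definition pro_word :: "('a list set monoid \<Rightarrow> bool) \<Rightarrow> 'a set \<Rightarrow> 'a list \<Rightarrow> 'a pro" where
  "pro_word V A w = (\<lambda>\<theta>\<in>pro_congruences V A. \<theta> `` {w})"

abbreviation "\<Omega>S \<equiv> free_pro fin_semigroup"
abbreviation "\<Omega>S_topology \<equiv> free_pro_topology fin_semigroup"
abbreviation "\<Omega>G \<equiv> free_pro fin_group"
abbreviation "\<Omega>G_topology \<equiv> free_pro_topology fin_group"

definition admits_group_presentation ::
    "'b monoid \<Rightarrow> 'b topology \<Rightarrow> 'a set \<Rightarrow> ('a pro \<times> 'a pro) set \<Rightarrow> bool" where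
  "admits_group_presentation G T A R \<longleftrightarrow>
     (let \<theta> = closed_congruence_generated (\<Omega>G A) (\<Omega>G_topology A) R
      in topologically_isomorphic G T
           (quotient_semigroup (\<Omega>G A) \<theta>) (quotient_topology (\<Omega>G_topology A) \<theta>))"


section \<open>Subshifts\<close>

definition shift :: "(int \<Rightarrow> 'a) \<Rightarrow> (int \<Rightarrow> 'a)" where
  "shift x = (\<lambda>i. x (i + 1))"

definition subshift :: "'a set \<Rightarrow> (int \<Rightarrow> 'a) set \<Rightarrow> bool" where
  "subshift A X \<longleftrightarrow> X \<noteq> {} \<and> closedin (product_topology (\<lambda>_. discrete_topology A) UNIV) X \<and>
     shift ` X = X"

definition blocks :: "(int \<Rightarrow> 'a) set \<Rightarrow> 'a list set" where
  "blocks X = {map (\<lambda>k. x (i + int k)) [0..<n] | x i n. x \<in> X \<and> n \<ge> 1}"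

definition minimal_subshift :: "'a set \<Rightarrow> (int \<Rightarrow> 'a) set \<Rightarrow> bool" where
  "minimal_subshift A X \<longleftrightarrow> subshift A X \<and> (\<forall>Y. subshift A Y \<and> Y \<subseteq> X \<longrightarrow> Y = X)"

definition periodic_subshift :: "'a set \<Rightarrow> (int \<Rightarrow> 'a) set \<Rightarrow> bool" where
  "periodic_subshift A X \<longleftrightarrow> minimal_subshift A X \<and> finite X"


section \<open>Substitutions\<close>

definition substitution :: "'a set \<Rightarrow> ('a list \<Rightarrow> 'a list) \<Rightarrow> bool" where
  "substitution A \<phi> \<longleftrightarrow> \<phi> \<in> hom (free_semigroup A) (free_semigroup A)"

definition primitive :: "'a set \<Rightarrow> ('a list \<Rightarrow> 'a list) \<Rightarrow> bool" where
  "primitive A \<phi> \<longleftrightarrow>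
     (\<exists>n\<ge>1. \<forall>a\<in>A. \<forall>b\<in>A. a \<in> set ((\<phi> ^^ n) [b])) \<and>
     (\<forall>b\<in>A. filterlim (\<lambda>n. length ((\<phi> ^^ n) [b])) at_top sequentially)"

definition proper :: "'a set \<Rightarrow> ('a list \<Rightarrow> 'a list) \<Rightarrow> bool" where
  "proper A \<phi> \<longleftrightarrow> (\<exists>a\<in>A. \<exists>b\<in>A. \<forall>d\<in>A. hd (\<phi> [d]) = a \<and> last (\<phi> [d]) = b)"

definition substitution_language :: "'a set \<Rightarrow> ('a list \<Rightarrow> 'a list) \<Rightarrow> 'a list set" where
  "substitution_language A \<phi> =
     {w. w \<noteq> [] \<and> (\<forall>a\<in>A. \<forall>\<^sub>F k in sequentially. sublist w ((\<phi> ^^ k) [a]))}"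

text \<open>
  The minimal subshift defined by a primitive substitution is the one whose set of blocks is
  \<^const>\<open>substitution_language\<close>. As a subshift is determined by its blocks, it consists of
  the following biinfinite words.
\<close>

definition substitution_subshift :: "'a set \<Rightarrow> ('a list \<Rightarrow> 'a list) \<Rightarrow> (int \<Rightarrow> 'a) set" where
  "substitution_subshift A \<phi> = {x. range x \<subseteq> A \<and> blocks {x} \<subseteq> substitution_language A \<phi>}"

definition periodic_substitution :: "'a set \<Rightarrow> ('a list \<Rightarrow> 'a list) \<Rightarrow> bool" where
  "periodic_substitution A \<phi> \<longleftrightarrow> periodic_subshift A (substitution_subshift A \<phi>)"

text \<open>The unique continuous endomorphism of the free profinite group that extends \<open>\<phi>\<close>.\<close>

definition group_extension :: "'a set \<Rightarrow> ('a list \<Rightarrow> 'a list) \<Rightarrow> ('a pro \<Rightarrow> 'a pro)" where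
  "group_extension A \<phi> =
     (THE f. f \<in> End (\<Omega>G A) (\<Omega>G_topology A) \<and>
        (\<forall>a\<in>A. f (pro_word fin_group A [a]) = pro_word fin_group A (\<phi> [a])))"


section \<open>The Schuetzenberger group\<close>

text \<open>
  For a minimal subshift \<open>X\<close>, the closure of the language of \<open>X\<close> is the disjoint union of
  that language and the regular J-class associated with \<open>X\<close>.
\<close>

definition J_class :: "'a set \<Rightarrow> (int \<Rightarrow> 'a) set \<Rightarrow> 'a pro set" where
  "J_class A X =
     (\<Omega>S_topology A closure_of (pro_word fin_semigroup A ` blocks X)) -
     pro_word fin_semigroup A ` blocks X"

text \<open>
  The maximal subgroups of a regular J-class are isomorphic profinite groups; an arbitrary one is
  chosen as the Schuetzenberger group. Its topology is the subspace topology.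
\<close>

definition schutzenberger_carrier :: "'a set \<Rightarrow> ('a list \<Rightarrow> 'a list) \<Rightarrow> 'a pro set" where
  "schutzenberger_carrier A \<phi> =
     (SOME H. maximal_subgroup (\<Omega>S A) H \<and> H \<subseteq> J_class A (substitution_subshift A \<phi>))"

definition schutzenberger_group :: "'a set \<Rightarrow> ('a list \<Rightarrow> 'a list) \<Rightarrow> 'a pro monoid" where
  "schutzenberger_group A \<phi> = (\<Omega>S A)\<lparr>carrier := schutzenberger_carrier A \<phi>\<rparr>"

definition schutzenberger_topology :: "'a set \<Rightarrow> ('a list \<Rightarrow> 'a list) \<Rightarrow> 'a pro topology" where
  "schutzenberger_topology A \<phi> = subtopology (\<Omega>S_topology A) (schutzenberger_carrier A \<phi>)"

end

theory Submission
  imports Defs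
begin

text \<open>
  Let \<open>M\<close> be the image of the idempotent endomorphism \<open>\<phi>\<^sup>\<omega>\<close> of the free profinite semigroup.
  As \<open>\<phi>\<close> is proper and primitive, the elements \<open>\<phi>\<^sup>\<omega>(a)\<close> with \<open>a \<in> A\<close> are all R-equivalent and
  L-equivalent in \<open>M\<close>, by stability of compact semigroups, so \<open>M\<close> is a group, and it lies in \<open>J(\<phi>)\<close>.

  Non-periodicity enters through recognizability. The language contains no arbitrarily high powers,
  so the number of occurrences of \<open>\<phi>\<^sup>p(a)\<close> in words \<open>\<phi>\<^sup>p(v)\<close> with \<open>v\<close> of bounded length is bounded
  independently of \<open>p\<close>. If for each \<open>p\<close> one of these occurrences did not start at the boundary of the
  \<open>\<phi>\<^sup>k\<close>-image of a letter, then applying powers of \<open>\<phi>\<close> to them would yield too many occurrences at one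
  level. Hence words of the language between two occurrences of a long \<open>\<phi>\<^sup>p(a)\<close> can be desubstituted.
  Since multiplication is open, every \<open>x\<close> in the maximal subgroup that includes \<open>M\<close> is a limit of such
  words, so it belongs to \<open>M\<close>. Thus \<open>M\<close> is a maximal subgroup of \<open>J(\<phi>)\<close>.

  Finally, \<open>\<phi>\<^sup>\<omega>\<close> takes its values in a profinite group, so it factors through the free profinite group.
  Therefore the projection to the latter maps \<open>M\<close> injectively onto the image of \<open>\<phi>\<^sub>G\<^sup>\<omega>\<close>, and the closed
  congruence generated by the relations is the kernel of the idempotent \<open>\<phi>\<^sub>G\<^sup>\<omega>\<close>.
\<close>

section \<open>Iterated substitutions\<close>

text \<open>That M is a group in J gives an inclusion into a maximal subgroup only, and closing this
  gap is the hard part. For A = {a} and \<phi>(a) = aa the maximal subgroup is the profinite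
  completion of the integers, whereas M is its image under the limit of the multiplications by
  2^(n!), which kills the 2-adic component; so the maximality of M truly rests on non-periodicity.
  Recognizability is needed for the starts of occurrences of a single word \<phi>^p(a), where a is
  the common first letter of all images. A word between two such starts is then a \<phi>^k-image.
  Here k = n! is dictated by the finite quotient in which the idempotent power is computed, and p
  depends on k. Elements of the free profinite semigroup are families of classes. Endomorphisms are
  computed on representing words, one coordinate at a time, and an equation is solved in every
  finite quotient and then globally by compactness. The Schuetzenberger group is an arbitrary
  maximal subgroup in J, so it is finally carried to M by conjugation with elements s, t whose
  products s t and t s are the two identities.\<close>

text \<open>Agrees with \<open>\<phi>\<close> on nonempty words, but also fixes the empty word, on which a substitution is unspecified.\<close>

definition letterwise :: "('a list \<Rightarrow> 'a list) \<Rightarrow> 'a list \<Rightarrow> 'a list" where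
  "letterwise \<phi> w = concat (map (\<lambda>c. \<phi> [c]) w)"

lemma letterwise_append: "letterwise \<phi> (u @ v) = letterwise \<phi> u @ letterwise \<phi> v"
  by (simp add: letterwise_def)

text \<open>Two overlapping occurrences of \<open>W\<close> at distance \<open>length y\<close> give
  \<open>W\<close> the period \<open>length y\<close>; each induction step gains one more copy of
  \<open>y\<close> by comparing the two factorizations.\<close>

lemma power_prefix:
  assumes "W @ s = y @ W @ s'" "M * length y \<le> length W"
  shows "prefix (concat (replicate M y)) W"
  using assms(2)
proof (induction M)
  case (Suc M)
  then obtain t where "W = concat (replicate M y) @ t" by (auto simp: prefix_def)
  then have "W @ s = concat (replicate (Suc M) y) @ t @ s'" using assms(1) by simp
  then have "prefix (concat (replicate (Suc M) y)) (W @ s)" by (rule prefixI)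
  moreover have "length (concat (replicate (Suc M) y)) \<le> length W"
    using Suc.prems by (simp add: length_concat sum_list_replicate)
  ultimately show ?case
    by (intro prefix_length_prefix[of _ "W @ s" W]) auto
qed simp

lemma nth_power:
  "i < M * length r \<Longrightarrow> concat (replicate M r) ! i = r ! (i mod length r)"
proof (induction M arbitrary: i)
  case (Suc M)
  show ?case
  proof (cases "i < length r")
    case False
    then have "concat (replicate M r) ! (i - length r) = r ! ((i - length r) mod length r)"
      using Suc.prems by (intro Suc.IH) auto
    then show ?thesis using False by (simp add: nth_append le_mod_geq)
  qed (simp add: nth_append)
qed simp

locale nonerasing_substitution =
  fixes A :: "'a set" and \<phi> :: "'a list \<Rightarrow> 'a list"
  assumes finite_alphabet: "finite A" and substitution: "substitution A \<phi>"
begin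

abbreviation \<Phi> :: "nat \<Rightarrow> 'a list \<Rightarrow> 'a list" where "\<Phi> n \<equiv> letterwise \<phi> ^^ n"

lemma iter_append [simp]: "\<Phi> n (u @ v) = \<Phi> n u @ \<Phi> n v"
  by (induction n) (simp_all add: letterwise_append)

lemma iter_Nil [simp]: "\<Phi> n [] = []"
  by (induction n) (simp_all add: letterwise_def)

lemma iter_Cons: "\<Phi> n (c # w) = \<Phi> n [c] @ \<Phi> n w"
  using iter_append[of n "[c]" w] by simp

lemma iter_add: "\<Phi> (m + n) w = \<Phi> m (\<Phi> n w)"
  by (simp add: funpow_add)

lemma subst_in: "w \<in> lists A \<Longrightarrow> w \<noteq> [] \<Longrightarrow> \<phi> w \<in> lists A \<and> \<phi> w \<noteq> []"
  using substitution by (auto simp: substitution_def hom_def free_semigroup_def)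

lemma subst_append:
  "u \<in> lists A - {[]} \<Longrightarrow> v \<in> lists A - {[]} \<Longrightarrow> \<phi> (u @ v) = \<phi> u @ \<phi> v"
  using substitution by (simp add: substitution_def hom_def free_semigroup_def)

lemma letterwise_eq:
  assumes "w \<noteq> []" "w \<in> lists A"
  shows "letterwise \<phi> w = \<phi> w"
  using assms
proof (induction w rule: list_nonempty_induct)
  case (cons x xs)
  then have "\<phi> ([x] @ xs) = \<phi> [x] @ \<phi> xs"
    by (intro subst_append) auto
  then show ?case using cons by (simp add: letterwise_def)
qed (simp add: letterwise_def)

lemma letterwise_in: "w \<in> lists A \<Longrightarrow> letterwise \<phi> w \<in> lists A"
  using letterwise_eq[of w] subst_in[of w] by (cases "w = []") (auto simp: letterwise_def)

lemma iter_in: "w \<in> lists A \<Longrightarrow> \<Phi> n w \<in> lists A"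
  by (induction n) (simp_all add: letterwise_in)

lemma iter_nonempty: "w \<in> lists A \<Longrightarrow> w \<noteq> [] \<Longrightarrow> \<Phi> n w \<noteq> []"
proof (induction n)
  case (Suc n)
  then show ?case using letterwise_eq[of "\<Phi> n w"] subst_in[of "\<Phi> n w"] iter_in[of w n] by simp
qed simp

lemma iter_eq: "w \<in> lists A \<Longrightarrow> w \<noteq> [] \<Longrightarrow> \<Phi> n w = (\<phi> ^^ n) w"
proof (induction n)
  case (Suc n)
  then show ?case using letterwise_eq[of "\<Phi> n w"] iter_in[of w n] iter_nonempty[of w n] by simp
qed simp

lemma length_iter_letter: "c \<in> A \<Longrightarrow> 1 \<le> length (\<Phi> n [c])"
  using iter_nonempty[of "[c]" n] by (cases "\<Phi> n [c]") auto

lemma length_iter_le: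
  "w \<in> lists A \<Longrightarrow> (\<And>c. c \<in> A \<Longrightarrow> length (\<Phi> n [c]) \<le> D) \<Longrightarrow> length (\<Phi> n w) \<le> length w * D"
proof (induction w)
  case (Cons c w)
  then show ?case by (subst iter_Cons) (auto intro: add_mono)
qed simp

text \<open>The factor \<open>C\<close> stands on the right, instead of a quotient on the left, so
  that the constant of \<open>balance\<close> can be used within the naturals.\<close>

lemma length_iter_ge:
  "w \<in> lists A \<Longrightarrow> (\<And>c. c \<in> A \<Longrightarrow> D \<le> C * length (\<Phi> n [c])) \<Longrightarrow>
    length w * D \<le> C * length (\<Phi> n w)"
proof (induction w)
  case (Cons c w)
  then show ?case
    by (subst iter_Cons) (auto intro!: add_mono simp: distrib_left)
qed simp

lemma iter_sublist_mono:
  assumes "sublist u v"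
  shows "sublist (\<Phi> n u) (\<Phi> n v)"
proof -
  obtain x y where "v = x @ u @ y" using assms by (auto simp: sublist_def)
  then have "\<Phi> n v = \<Phi> n x @ \<Phi> n u @ \<Phi> n y" by simp
  then show ?thesis unfolding sublist_def by blast
qed

text \<open>No letter is erased, so the image length grows strictly along the prefixes of
  \<open>w\<close>. Hence a cut point of \<open>\<Phi> n w\<close> determines the prefix of
  \<open>w\<close> from which it comes.\<close>

lemma iter_prefix_reflect:
  assumes "prefix u w" "prefix v w" "w \<in> lists A" "length (\<Phi> n u) \<le> length (\<Phi> n v)"
  shows "prefix u v"
proof (rule ccontr)
  assume "\<not> prefix u v"
  then have "prefix v u" "u \<noteq> v" using assms prefix_same_cases by blast+
  then obtain t where t: "u = v @ t" "t \<noteq> []" by (auto simp: prefix_def)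
  moreover have "t \<in> lists A" using assms t by (auto simp: prefix_def)
  ultimately show False using assms(4) iter_nonempty[of t n] by simp
qed

lemma iter_prefix_inj:
  assumes "prefix u w" "prefix v w" "w \<in> lists A" "length (\<Phi> n u) = length (\<Phi> n v)"
  shows "u = v"
  using iter_prefix_reflect[of u w v n] iter_prefix_reflect[of v w u n] assms
  by (auto intro: prefix_order.antisym)

text \<open>Letters are removed from either end of \<open>v\<close> as long as their images lie
  outside the occurrence of \<open>w\<close>. The strict inequalities record that this has stopped:
  the occurrence meets the images of both end letters.\<close>

lemma cover:
  assumes "\<Phi> k v = x @ w @ y" "w \<noteq> []"
  shows "\<exists>g v' h x' y'. v = g @ v' @ h \<and> v' \<noteq> [] \<and> x = \<Phi> k g @ x' \<and> y = y' @ \<Phi> k h \<and>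
    \<Phi> k v' = x' @ w @ y' \<and> length x' < length (\<Phi> k [hd v']) \<and> length y' < length (\<Phi> k [last v'])"
  using assms(1)
proof (induction "length v" arbitrary: v x y rule: less_induct)
  case less
  have ne: "v \<noteq> []" using less.prems assms(2) by auto
  then obtain c t where ct: "v = c # t" by (cases v) auto
  obtain b d where bd: "v = b @ [d]" using ne by (cases v rule: rev_cases) auto
  have 1: "\<Phi> k [c] @ \<Phi> k t = x @ w @ y" using less.prems ct iter_Cons[of k c t] by simp
  have 2: "\<Phi> k b @ \<Phi> k [d] = x @ w @ y" using less.prems bd by simp
  consider "length (\<Phi> k [c]) \<le> length x" | "length (\<Phi> k [d]) \<le> length y"
    | "length x < length (\<Phi> k [c])" "length y < length (\<Phi> k [d])" by linarith
  then show ?case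
  proof cases
    case 1
    have "prefix (\<Phi> k [c]) (x @ w @ y)" "prefix x (x @ w @ y)"
      using \<open>\<Phi> k [c] @ \<Phi> k t = x @ w @ y\<close> by (metis prefixI)+
    then have "prefix (\<Phi> k [c]) x" using 1 prefix_length_prefix by blast
    then obtain x1 where x1: "x = \<Phi> k [c] @ x1" by (auto simp: prefix_def)
    then have "\<Phi> k t = x1 @ w @ y" using \<open>\<Phi> k [c] @ \<Phi> k t = x @ w @ y\<close> by simp
    from less.hyps[OF _ this] ct obtain g v' h x' y' where
      "t = g @ v' @ h" "v' \<noteq> []" "x1 = \<Phi> k g @ x'" "y = y' @ \<Phi> k h" "\<Phi> k v' = x' @ w @ y'"
      "length x' < length (\<Phi> k [hd v'])" "length y' < length (\<Phi> k [last v'])" by auto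
    then show ?thesis using x1 ct
      by (intro exI[of _ "c # g"] exI[of _ v'] exI[of _ h] exI[of _ x'] exI[of _ y'])
        (simp add: iter_Cons[of k c g])
  next
    case 2
    have "suffix (\<Phi> k [d]) (x @ w @ y)" using \<open>\<Phi> k b @ \<Phi> k [d] = x @ w @ y\<close>
      by (metis suffix_def)
    moreover have "suffix y (x @ w @ y)" by (simp add: suffix_def)
    ultimately have "suffix (\<Phi> k [d]) y" using 2 suffix_length_suffix by blast
    then obtain y1 where y1: "y = y1 @ \<Phi> k [d]" by (auto simp: suffix_def)
    then have "\<Phi> k b = x @ w @ y1" using \<open>\<Phi> k b @ \<Phi> k [d] = x @ w @ y\<close> by simp
    from less.hyps[OF _ this] bd obtain g v' h x' y' where
      "b = g @ v' @ h" "v' \<noteq> []" "x = \<Phi> k g @ x'" "y1 = y' @ \<Phi> k h" "\<Phi> k v' = x' @ w @ y'"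
      "length x' < length (\<Phi> k [hd v'])" "length y' < length (\<Phi> k [last v'])" by auto
    then show ?thesis using y1 bd
      by (intro exI[of _ "g"] exI[of _ v'] exI[of _ "h @ [d]"] exI[of _ x'] exI[of _ y']) simp
  next
    case 3
    have "hd v = c" using ct by simp
    moreover have "last v = d" using bd by simp
    ultimately show ?thesis using 3 less.prems ne
      by (intro exI[of _ "[]"] exI[of _ v] exI[of _ "[]"] exI[of _ x] exI[of _ y]) simp
  qed
qed

text \<open>After trimming, the images of all letters but the first and the last lie inside
  \<open>w\<close>, and \<open>w\<close> sticks out on both sides. The bounds on the length of a
  cover below come from this.\<close>

lemma cover_interior:
  assumes "\<Phi> k (c # m @ [d]) = x @ w @ y" "length x < length (\<Phi> k [c])" "length y < length (\<Phi> k [d])"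
  shows "\<exists>x' y'. x' \<noteq> [] \<and> y' \<noteq> [] \<and> w = x' @ \<Phi> k m @ y'"
proof -
  have eq: "\<Phi> k [c] @ \<Phi> k m @ \<Phi> k [d] = x @ w @ y"
    using assms(1) iter_Cons[of k c "m @ [d]"] by simp
  have "prefix x (x @ w @ y)" "prefix (\<Phi> k [c]) (x @ w @ y)"
    by (rule prefixI[OF refl], rule prefixI[OF eq[symmetric]])
  then have "prefix x (\<Phi> k [c])"
    using assms(2) prefix_length_prefix[of x "x @ w @ y" "\<Phi> k [c]"] by linarith
  then obtain x' where x': "\<Phi> k [c] = x @ x'" by (auto simp: prefix_def)
  have "suffix y ((x @ w) @ y)" by (rule suffixI[OF refl])
  moreover have "suffix (\<Phi> k [d]) ((x @ w) @ y)"
    using eq by (intro suffixI[of _ "\<Phi> k [c] @ \<Phi> k m"]) simp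
  ultimately have "suffix y (\<Phi> k [d])"
    using assms(3) suffix_length_suffix[of y "(x @ w) @ y" "\<Phi> k [d]"] by linarith
  then obtain y' where y': "\<Phi> k [d] = y' @ y" by (auto simp: suffix_def)
  have "w = x' @ \<Phi> k m @ y'" using eq x' y' by simp
  moreover have "x' \<noteq> []" "y' \<noteq> []" using assms(2,3) x' y' by auto
  ultimately show ?thesis by blast
qed

end

section \<open>Primitive substitutions\<close>

locale primitive_substitution = nonerasing_substitution +
  assumes primitive: "primitive A \<phi>" and nonempty_alphabet: "A \<noteq> {}"
begin

abbreviation L :: "'a list set" where "L \<equiv> substitution_language A \<phi>"

lemma language_iff:
  "w \<in> L \<longleftrightarrow> w \<noteq> [] \<and> (\<forall>a\<in>A. \<exists>N. \<forall>k\<ge>N. sublist w (\<Phi> k [a]))"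
  by (simp add: substitution_language_def eventually_sequentially iter_eq)

text \<open>From one good exponent \<open>n\<close> to all larger ones: \<open>\<Phi> m [d]\<close>
  contains the \<open>\<Phi> n\<close>-image of the first letter of
  \<open>\<Phi> (m - n) [d]\<close>.\<close>

lemma letters_occur: "\<exists>n. \<forall>m\<ge>n. \<forall>c\<in>A. \<forall>d\<in>A. c \<in> set (\<Phi> m [d])"
proof -
  obtain n where n: "\<forall>a\<in>A. \<forall>b\<in>A. a \<in> set (\<Phi> n [b])"
    using primitive by (auto simp: primitive_def iter_eq)
  have "c \<in> set (\<Phi> m [d])" if m: "m \<ge> n" and c: "c \<in> A" and d: "d \<in> A" for m c d
  proof -
    have "\<Phi> (m - n) [d] \<noteq> []" "\<Phi> (m - n) [d] \<in> lists A"
      using d iter_nonempty[of "[d]" "m - n"] iter_in[of "[d]" "m - n"] by auto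
    then obtain e t where e: "\<Phi> (m - n) [d] = e # t" "e \<in> A" by (cases "\<Phi> (m - n) [d]") auto
    have "\<Phi> m [d] = \<Phi> n [e] @ \<Phi> n t"
      using m e iter_add[of n "m - n" "[d]"] iter_Cons[of n e t] by simp
    then show ?thesis using n e c by simp
  qed
  then show ?thesis by blast
qed

lemma growth: "\<exists>k. \<forall>j\<ge>k. \<forall>c\<in>A. N \<le> length (\<Phi> j [c])"
proof -
  have "\<forall>c\<in>A. \<forall>\<^sub>F j in sequentially. N \<le> length (\<Phi> j [c])"
    using primitive by (auto simp: primitive_def iter_eq filterlim_at_top)
  then have "\<forall>\<^sub>F j in sequentially. \<forall>c\<in>A. N \<le> length (\<Phi> j [c])"
    by (rule eventually_ball_finite[OF finite_alphabet])
  then show ?thesis by (simp only: eventually_sequentially)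
qed

text \<open>For \<open>k = j + n\<close>, primitivity puts every \<open>\<Phi> j [e]\<close> inside
  \<open>\<Phi> k [d]\<close>, while \<open>\<Phi> k [c]\<close> is a product of at most
  \<open>C\<close> such blocks. The maximum \<open>C\<close> runs over all exponents up to
  \<open>n\<close>, which settles small \<open>k\<close> as well.\<close>

lemma balance: "\<exists>C\<ge>1. \<forall>k. \<forall>c\<in>A. \<forall>d\<in>A. length (\<Phi> k [c]) \<le> C * length (\<Phi> k [d])"
proof -
  obtain n where n: "\<forall>m\<ge>n. \<forall>c\<in>A. \<forall>d\<in>A. c \<in> set (\<Phi> m [d])" using letters_occur by blast
  let ?S = "(\<lambda>(k, c). length (\<Phi> k [c])) ` ({..n} \<times> A)"
  define C where "C = Max ?S"
  have fin: "finite ?S" using finite_alphabet by simp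
  have C: "length (\<Phi> k [c]) \<le> C" if "k \<le> n" "c \<in> A" for k c
  proof -
    have "length (\<Phi> k [c]) \<in> ?S" using that by force
    then show ?thesis unfolding C_def using fin by (rule Max_ge[rotated])
  qed
  have main: "length (\<Phi> k [c]) \<le> C * length (\<Phi> k [d])" if c: "c \<in> A" and d: "d \<in> A" for k c d
  proof (cases "k \<le> n")
    case True
    then have "length (\<Phi> k [c]) \<le> C * 1" using C c by simp
    also have "\<dots> \<le> C * length (\<Phi> k [d])" using length_iter_letter[OF d] by (intro mult_left_mono) auto
    finally show ?thesis .
  next
    case False
    then have "\<exists>j. k = j + n" by (intro exI[of _ "k - n"]) simp
    then obtain j where k: "k = j + n" by blast
    have "length (\<Phi> j [e]) \<le> length (\<Phi> k [d])" if e: "e \<in> A" for e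
    proof -
      have "e \<in> set (\<Phi> n [d])" using n e d by blast
      then obtain x y where "\<Phi> n [d] = x @ e # y" by (blast dest: split_list)
      then have "\<Phi> n [d] = x @ [e] @ y" by simp
      then have "\<Phi> k [d] = \<Phi> j x @ \<Phi> j [e] @ \<Phi> j y" by (simp only: k iter_add iter_append)
      then show ?thesis by simp
    qed
    then have "length (\<Phi> j (\<Phi> n [c])) \<le> length (\<Phi> n [c]) * length (\<Phi> k [d])"
      using c by (intro length_iter_le iter_in) auto
    also have "\<dots> \<le> C * length (\<Phi> k [d])" using C[of n c] c by simp
    finally show ?thesis unfolding k iter_add .
  qed
  obtain c where c: "c \<in> A" using nonempty_alphabet by blast
  have "1 \<le> C" using C[of 0 c] c by simp
  then show ?thesis using main by blast
qed

lemma language_nonempty: "w \<in> L \<Longrightarrow> w \<noteq> []"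
  by (simp add: language_iff)

lemma language_in: "w \<in> L \<Longrightarrow> w \<in> lists A"
proof -
  assume w: "w \<in> L"
  obtain c where c: "c \<in> A" using nonempty_alphabet by blast
  then obtain N where "sublist w (\<Phi> N [c])" using w by (auto simp: language_iff)
  then show ?thesis using iter_in[of "[c]" N] c set_mono_sublist by fastforce
qed

lemma language_factor: "w \<in> L \<Longrightarrow> sublist u w \<Longrightarrow> u \<noteq> [] \<Longrightarrow> u \<in> L"
  unfolding language_iff using sublist_order.order.trans by blast

lemma letter_in_language: "c \<in> A \<Longrightarrow> [c] \<in> L"
proof -
  assume c: "c \<in> A"
  obtain n where n: "\<forall>m\<ge>n. \<forall>c\<in>A. \<forall>d\<in>A. c \<in> set (\<Phi> m [d])" using letters_occur by blast
  have "sublist [c] (\<Phi> k [a])" if "k \<ge> n" "a \<in> A" for k a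
  proof -
    have "c \<in> set (\<Phi> k [a])" using n that c by blast
    then obtain x y where "\<Phi> k [a] = x @ c # y" by (blast dest: split_list)
    then have "\<Phi> k [a] = x @ [c] @ y" by simp
    then show ?thesis unfolding sublist_def by blast
  qed
  then show ?thesis unfolding language_iff by blast
qed

lemma iter_in_language: "w \<in> L \<Longrightarrow> \<Phi> k w \<in> L"
proof -
  assume w: "w \<in> L"
  have "\<exists>N. \<forall>j\<ge>N. sublist (\<Phi> k w) (\<Phi> j [a])" if a: "a \<in> A" for a
  proof -
    obtain N where N: "\<forall>j\<ge>N. sublist w (\<Phi> j [a])" using w a by (auto simp: language_iff)
    have "sublist (\<Phi> k w) (\<Phi> j [a])" if j: "j \<ge> N + k" for j
    proof -
      have "sublist (\<Phi> k w) (\<Phi> k (\<Phi> (j - k) [a]))" using N j by (intro iter_sublist_mono) auto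
      then show ?thesis using j iter_add[of k "j - k" "[a]"] by simp
    qed
    then show ?thesis by blast
  qed
  moreover have "\<Phi> k w \<noteq> []" using w iter_nonempty language_in language_nonempty by blast
  ultimately show ?thesis unfolding language_iff by blast
qed

lemma language_desubst: "w \<in> L \<Longrightarrow> \<exists>v\<in>L. sublist w (\<Phi> k v)"
proof -
  assume w: "w \<in> L"
  obtain c where c: "c \<in> A" using nonempty_alphabet by blast
  obtain N where N: "\<forall>j\<ge>N. sublist w (\<Phi> j [c])" using w c by (auto simp: language_iff)
  then have "sublist w (\<Phi> (k + N) [c])" by simp
  then show ?thesis
    unfolding iter_add using iter_in_language[OF letter_in_language[OF c]] by blast
qed

lemma finite_language_occurs:
  assumes "finite F" "F \<subseteq> L"
  shows "\<exists>N. \<forall>k\<ge>N. \<forall>u\<in>F. \<forall>c\<in>A. sublist u (\<Phi> k [c])"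
proof -
  have "\<forall>u\<in>F. \<forall>c\<in>A. \<forall>\<^sub>F k in sequentially. sublist u (\<Phi> k [c])"
    using assms by (auto simp: language_iff eventually_sequentially)
  then have "\<forall>\<^sub>F k in sequentially. \<forall>u\<in>F. \<forall>c\<in>A. sublist u (\<Phi> k [c])"
    using assms finite_alphabet by (auto simp: eventually_ball_finite_distrib)
  then show ?thesis by (simp add: eventually_sequentially)
qed

lemma language_cover:
  assumes "w \<in> L"
  shows "\<exists>v\<in>L. \<exists>x y. \<Phi> k v = x @ w @ y \<and> length x < length (\<Phi> k [hd v]) \<and> length y < length (\<Phi> k [last v])"
proof -
  obtain v x y where v: "v \<in> L" "\<Phi> k v = x @ w @ y"
    using language_desubst[OF assms, of k] by (auto simp: sublist_def)
  obtain g v' h x' y' where g: "v = g @ v' @ h" "v' \<noteq> []" "\<Phi> k v' = x' @ w @ y'"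
      "length x' < length (\<Phi> k [hd v'])" "length y' < length (\<Phi> k [last v'])"
    using cover[OF v(2) language_nonempty[OF assms]] by metis
  have "sublist v' v" using g(1) by (simp add: sublist_appendI)
  then have "v' \<in> L" using v(1) g(2) language_factor by blast
  then show ?thesis using g by blast
qed

text \<open>Two letter images are too short to cover \<open>w\<close>, so a trimmed cover has an
  inner letter, whose image lies in \<open>w\<close> away from both ends.\<close>

lemma contains_block:
  assumes "w \<in> L" and E: "\<And>c. c \<in> A \<Longrightarrow> length (\<Phi> k [c]) \<le> E" and "2 * E < length w"
  shows "\<exists>c\<in>A. \<exists>x y. x \<noteq> [] \<and> y \<noteq> [] \<and> w = x @ \<Phi> k [c] @ y"
proof -
  obtain v x y where v: "v \<in> L" "\<Phi> k v = x @ w @ y" "length x < length (\<Phi> k [hd v])"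
      "length y < length (\<Phi> k [last v])"
    using language_cover[OF assms(1), of k] by blast
  have vA: "v \<in> lists A" using v(1) language_in by blast
  have "2 < length v"
  proof (rule ccontr)
    assume "\<not> 2 < length v"
    have "length w \<le> length (\<Phi> k v)" using v(2) by simp
    also have "\<dots> \<le> length v * E" using vA E by (rule length_iter_le)
    also have "\<dots> \<le> 2 * E" using \<open>\<not> 2 < length v\<close> by (intro mult_right_mono) auto
    finally show False using assms(3) by simp
  qed
  then obtain c t where ct: "v = c # t" by (cases v) auto
  then obtain m d where "t = m @ [d]" using \<open>2 < length v\<close> by (cases t rule: rev_cases) auto
  then have cd: "v = c # m @ [d]" "m \<noteq> []" using ct \<open>2 < length v\<close> by auto
  then obtain e m' where e: "m = e # m'" by (cases m) auto
  have "\<exists>x' y'. x' \<noteq> [] \<and> y' \<noteq> [] \<and> w = x' @ \<Phi> k m @ y'"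
    using v(2-4) cd by (intro cover_interior[of k c m d x w y]) auto
  then obtain x' y' where "x' \<noteq> []" "y' \<noteq> []" "w = x' @ \<Phi> k m @ y'" by blast
  moreover have "e \<in> A" using vA cd e by simp
  ultimately show ?thesis
    using e iter_Cons[of k e m'] by (intro bexI[of _ e] exI[of _ x'] exI[of _ "\<Phi> k m' @ y'"]) auto
qed

text \<open>For a suitable \<open>k\<close> every \<open>\<Phi> k [c]\<close> contains
  \<open>u\<close>, and every long word contains such an image. The contexts \<open>x\<close>,
  \<open>y\<close> are made nonempty because they later become elements of a semigroup without empty
  word.\<close>

lemma recurrence:
  assumes "u \<in> L"
  shows "\<exists>N. \<forall>w\<in>L. N \<le> length w \<longrightarrow> (\<exists>x y. x \<noteq> [] \<and> y \<noteq> [] \<and> w = x @ u @ y)"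
proof -
  obtain k where k: "\<forall>c\<in>A. sublist u (\<Phi> k [c])"
    using finite_language_occurs[of "{u}"] assms by auto
  define E where "E = Max ((\<lambda>c. length (\<Phi> k [c])) ` A)"
  have E: "length (\<Phi> k [c]) \<le> E" if "c \<in> A" for c
    unfolding E_def using that finite_alphabet by (intro Max_ge) auto
  have "\<exists>x y. x \<noteq> [] \<and> y \<noteq> [] \<and> w = x @ u @ y" if w: "w \<in> L" "2 * E + 1 \<le> length w" for w
  proof -
    obtain c x y where c: "c \<in> A" "x \<noteq> []" "y \<noteq> []" "w = x @ \<Phi> k [c] @ y"
      using contains_block[OF w(1) E] w(2) by fastforce
    obtain x' y' where "\<Phi> k [c] = x' @ u @ y'" using k c(1) by (auto simp: sublist_def)
    then show ?thesis using c by (intro exI[of _ "x @ x'"] exI[of _ "y' @ y"]) auto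
  qed
  then show ?thesis by blast
qed

text \<open>A power of \<open>r\<close> with many factors contains an image that in turn contains
  all words of \<open>L\<close> of length \<open>length r + 1\<close>. Then \<open>length r\<close>
  is a period of every point of \<open>X\<close>, which leaves only finitely many points.\<close>

lemma bounded_powers:
  assumes infinite: "infinite X"
    and X: "\<And>x i n. x \<in> X \<Longrightarrow> n \<ge> 1 \<Longrightarrow> map (\<lambda>k. x (i + int k)) [0..<n] \<in> L"
  shows "\<exists>M\<ge>1. \<forall>r. r \<noteq> [] \<longrightarrow> concat (replicate M r) \<notin> L"
proof (rule ccontr)
  assume no: "\<not> ?thesis"
  obtain C where C: "C \<ge> 1" "\<And>k c d. c \<in> A \<Longrightarrow> d \<in> A \<Longrightarrow> length (\<Phi> k [c]) \<le> C * length (\<Phi> k [d])"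
    using balance by blast
  let ?F = "{u \<in> L. length u \<le> 2}"
  have "finite ?F"
    by (rule finite_subset[OF _ finite_lists_length_le[OF finite_alphabet, of 2]])
      (use language_in in auto)
  \<comment> \<open>A level at which the image of every letter contains all words of
    \<open>L\<close> of length at most 2; covers of words of length \<open>l + 1\<close> will turn
    out to be that short.\<close>
  then obtain t where t: "\<And>u c. u \<in> L \<Longrightarrow> length u \<le> 2 \<Longrightarrow> c \<in> A \<Longrightarrow> sublist u (\<Phi> t [c])"
    using finite_language_occurs[of ?F] by blast
  define D where "D j = Max ((\<lambda>c. length (\<Phi> j [c])) ` A)" for j
  have D: "length (\<Phi> j [c]) \<le> D j" if "c \<in> A" for c j
    unfolding D_def using that finite_alphabet by (intro Max_ge) auto
  obtain a where a: "a \<in> A" using nonempty_alphabet by blast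
  \<comment> \<open>For the level \<open>k\<close> chosen below, \<open>D t * (D 1 * C)\<close>
    times \<open>length r\<close> bounds the letter images at level \<open>k + t\<close>. The power
    must be longer than twice this bound, hence the \<open>+ 1\<close>.\<close>
  define M where "M = 2 * (D t * (D 1 * C)) + 1"
  have "M \<ge> 1" by (simp add: M_def)
  then obtain r where r: "r \<noteq> []" "concat (replicate M r) \<in> L" using no by blast
  define l where "l = length r"
  have l: "l \<ge> 1" using r(1) by (cases r) (auto simp: l_def)
  obtain k0 where "\<forall>c\<in>A. l \<le> length (\<Phi> k0 [c])" using growth[of l] by blast
  \<comment> \<open>At the least such level all letter images have length at least \<open>l\<close>
    and yet, by \<open>balance\<close>, at most a multiple of \<open>l\<close> that does not depend
    on \<open>r\<close>.\<close>
  define k where "k = (LEAST k. \<forall>c\<in>A. l \<le> length (\<Phi> k [c]))"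
  have k: "\<forall>c\<in>A. l \<le> length (\<Phi> k [c])" unfolding k_def by (rule LeastI) fact
  have kb: "length (\<Phi> k [c]) \<le> D 1 * C * l" if c: "c \<in> A" for c
  proof (cases k)
    case 0
    have "1 \<le> D 1" using D[OF c, of 1] length_iter_letter[OF c, of 1] by linarith
    then have "1 * 1 * 1 \<le> D 1 * C * l" using C(1) l by (intro mult_mono) auto
    then show ?thesis using 0 by simp
  next
    case (Suc j)
    then have "\<not> (\<forall>c\<in>A. l \<le> length (\<Phi> j [c]))"
      by (intro not_less_Least[of j "\<lambda>k. \<forall>c\<in>A. l \<le> length (\<Phi> k [c])"]) (simp flip: k_def)
    then obtain c0 where "c0 \<in> A" "length (\<Phi> j [c0]) < l" by auto
    then have "length (\<Phi> j [c]) \<le> C * length (\<Phi> j [c0])" "C * length (\<Phi> j [c0]) \<le> C * l"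
      using C(2)[OF c] by auto
    then have "length (\<Phi> j [c]) \<le> C * l" by (rule le_trans)
    then have "length (\<Phi> j [c]) * D 1 \<le> C * l * D 1" by (rule mult_right_mono) simp
    moreover have "length (\<Phi> 1 (\<Phi> j [c])) \<le> length (\<Phi> j [c]) * D 1"
      by (rule length_iter_le[OF iter_in D]) (use c in simp)
    moreover have "\<Phi> k [c] = \<Phi> 1 (\<Phi> j [c])" using Suc by simp
    moreover have "C * l * D 1 = D 1 * C * l" by (simp only: mult.commute mult.assoc mult.left_commute)
    ultimately show ?thesis by (metis le_trans)
  qed
  have kt: "length (\<Phi> (k + t) [c]) \<le> D t * (D 1 * C * l)" if c: "c \<in> A" for c
  proof -
    have "length (\<Phi> k (\<Phi> t [c])) \<le> length (\<Phi> t [c]) * (D 1 * C * l)"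
      using c kb by (intro length_iter_le iter_in) auto
    also have "\<dots> \<le> D t * (D 1 * C * l)" using D[OF c] by (rule mult_right_mono) simp
    finally show ?thesis by (simp only: iter_add)
  qed
  let ?R = "concat (replicate M r)"
  have lenR: "length ?R = M * l" by (simp add: length_concat sum_list_replicate l_def)
  have "2 * (D t * (D 1 * C * l)) < length ?R"
  proof -
    have "M * l = 2 * (D t * (D 1 * C * l)) + l" by (simp add: M_def algebra_simps)
    then show ?thesis using lenR l by linarith
  qed
  then obtain c x y where c: "c \<in> A" "?R = x @ \<Phi> (k + t) [c] @ y"
    using contains_block[OF r(2) kt] by blast
  have period: "u ! 0 = u ! l" if u: "u \<in> L" "length u = l + 1" for u
  proof -
    obtain v x1 y1 where v: "v \<in> L" "\<Phi> k v = x1 @ u @ y1" "length x1 < length (\<Phi> k [hd v])"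
      "length y1 < length (\<Phi> k [last v])"
      using language_cover[OF u(1), of k] by blast
    have vA: "v \<in> lists A" using v(1) language_in by blast
    \<comment> \<open>A third letter would contribute at least \<open>l\<close> letters, and the
      overlaps with the two end images at least one each: \<open>l + 2\<close> in total, one more
      than \<open>u\<close> has.\<close>
    have "length v \<le> 2"
    proof (rule ccontr)
      assume len: "\<not> length v \<le> 2"
      then obtain c1 t1 where ct: "v = c1 # t1" by (cases v) auto
      then obtain m d where "t1 = m @ [d]" using len by (cases t1 rule: rev_cases) auto
      then have cd: "v = c1 # m @ [d]" "m \<noteq> []" using ct len by auto
      have "\<exists>x' y'. x' \<noteq> [] \<and> y' \<noteq> [] \<and> u = x' @ \<Phi> k m @ y'"
        using v(2-4) cd by (intro cover_interior[of k c1 m d x1 u y1]) auto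
      then obtain x' y' where x': "x' \<noteq> []" "y' \<noteq> []" "u = x' @ \<Phi> k m @ y'" by blast
      have "length m * l \<le> 1 * length (\<Phi> k m)"
        using vA cd k by (intro length_iter_ge) auto
      moreover have "1 * l \<le> length m * l" using cd(2) by (intro mult_right_mono) (cases m, auto)
      moreover have "length x' \<ge> 1" "length y' \<ge> 1" using x' by (auto simp: Suc_le_eq)
      moreover have "length u = length x' + length (\<Phi> k m) + length y'" using x'(3) by simp
      ultimately show False using u(2) by linarith
    qed
    then have "sublist v (\<Phi> t [c])" using t v(1) c(1) by blast
    then have "sublist (\<Phi> k v) (\<Phi> (k + t) [c])" unfolding iter_add by (rule iter_sublist_mono)
    moreover have "sublist u (\<Phi> k v)" unfolding v(2) by (rule sublist_appendI)
    moreover have "sublist (\<Phi> (k + t) [c]) ?R" unfolding c(2) by (rule sublist_appendI)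
    ultimately have "sublist u ?R" using sublist_order.order.trans by blast
    then obtain x2 y2 where R: "?R = x2 @ u @ y2" by (auto simp: sublist_def)
    then have len2: "length x2 + l + 1 + length y2 = M * l" using lenR u(2) by simp
    have "u ! 0 = ?R ! length x2" "u ! l = ?R ! (length x2 + l)"
      unfolding R using u(2) by (simp_all add: nth_append)
    moreover have "?R ! length x2 = r ! (length x2 mod l)" "?R ! (length x2 + l) = r ! ((length x2 + l) mod l)"
      using len2 nth_power[of "length x2" M r] nth_power[of "length x2 + l" M r]
      unfolding l_def by linarith+
    ultimately show ?thesis by simp
  qed
  have per: "x i = x (i + int l)" if "x \<in> X" for x i
    using period[OF X[OF that, of "l + 1" i]] by (auto simp del: upt_Suc simp: nth_append)
  have per_add: "x (i + int l * int n) = x i" if "x \<in> X" for x i n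
  proof (induction n)
    case (Suc n)
    then show ?case using per[OF that, of "i + int l * int n"] by (simp add: algebra_simps)
  qed simp
  have per_mod: "x i = x (i mod int l)" if "x \<in> X" for x i
  proof (cases "i div int l \<ge> 0")
    case True
    then show ?thesis using per_add[OF that, of "i mod int l" "nat (i div int l)"] by simp
  next
    case False
    then have *: "int (nat (- (i div int l))) = - (i div int l)" by simp
    have "i + int l * int (nat (- (i div int l))) = i mod int l"
      unfolding * using mult_div_mod_eq[of "int l" i] by linarith
    then show ?thesis using per_add[OF that, of i "nat (- (i div int l))"] by simp
  qed
  \<comment> \<open>With period \<open>l\<close>, a point is determined by its \<open>l\<close>
    letters from the origin on.\<close>
  let ?f = "\<lambda>x. map (\<lambda>k. x (0 + int k)) [0..<l]"
  have "inj_on ?f X"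
  proof (rule inj_onI)
    fix x y assume xy: "x \<in> X" "y \<in> X" "?f x = ?f y"
    show "x = y"
    proof
      fix i
      have "nat (i mod int l) < l" using l by (simp add: nat_less_iff)
      then have "?f x ! nat (i mod int l) = x (i mod int l)" "?f y ! nat (i mod int l) = y (i mod int l)"
        using l by simp_all
      then show "x i = y i" using per_mod[OF xy(1), of i] per_mod[OF xy(2), of i] xy(3) by metis
    qed
  qed
  moreover have "?f ` X \<subseteq> {w. set w \<subseteq> A \<and> length w \<le> l}"
  proof (rule image_subsetI)
    fix x assume "x \<in> X"
    then have "?f x \<in> lists A" by (rule language_in[OF X[OF _ l]])
    then show "?f x \<in> {w. set w \<subseteq> A \<and> length w \<le> l}" by auto
  qed
  then have "finite (?f ` X)" using finite_lists_length_le[OF finite_alphabet] finite_subset by blast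
  ultimately show False using infinite finite_imageD by blast
qed

end

section \<open>Recognizability\<close>

context primitive_substitution
begin

text \<open>The occurrence of \<open>\<Phi> (k + j) [a]\<close> at position \<open>length x\<close> in \<open>\<Phi> (k + j) v\<close> does not start at the
  boundary of the \<open>\<Phi> k\<close>-image of a letter.\<close>

definition uncut :: "nat \<Rightarrow> 'a \<Rightarrow> nat \<Rightarrow> 'a list \<Rightarrow> 'a list \<Rightarrow> bool" where
  "uncut k a j v x \<longleftrightarrow> v \<in> L \<and> (\<exists>s. \<Phi> (k + j) v = x @ \<Phi> (k + j) [a] @ s) \<and>
    \<not> (\<exists>y. prefix y (\<Phi> j v) \<and> x = \<Phi> k y)"

text \<open>A bad occurrence in the image of a long \<open>v\<close> can be seen in the image of a
  short word: \<open>v\<close> is a factor of some \<open>\<Phi> j u\<close>, and in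
  \<open>\<Phi> (k + j) u\<close> the occurrence has a trimmed cover \<open>v'\<close>. The inner
  letters of \<open>v'\<close> have images inside \<open>\<Phi> (k + j) [a]\<close>, each of at
  least a \<open>C\<close>-th of its length, so there are at most \<open>C\<close> of them besides
  the two end letters.\<close>

lemma uncut_bounded:
  assumes C: "\<And>k c d. c \<in> A \<Longrightarrow> d \<in> A \<Longrightarrow> length (\<Phi> k [c]) \<le> C * length (\<Phi> k [d])"
    and a: "a \<in> A" and v: "v \<in> L" "\<Phi> k v = \<alpha> @ \<Phi> (k + j) [a] @ \<beta>"
    and not_cut: "\<not> (\<exists>v1. prefix v1 v \<and> \<alpha> = \<Phi> k v1)"
  shows "\<exists>v x. uncut k a j v x \<and> length v \<le> C + 2"
proof -
  let ?W = "\<Phi> (k + j) [a]"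
  obtain u \<gamma> \<delta> where u: "u \<in> L" "\<Phi> j u = \<gamma> @ v @ \<delta>"
    using language_desubst[OF v(1), of j] by (auto simp: sublist_def)
  have uA: "\<Phi> j u \<in> lists A" using u(1) language_in iter_in by blast
  have W: "?W \<noteq> []" using a iter_nonempty[of "[a]"] by simp
  have full: "\<Phi> (k + j) u = (\<Phi> k \<gamma> @ \<alpha>) @ ?W @ (\<beta> @ \<Phi> k \<delta>)"
    using u(2) v(2) by (simp add: iter_add)
  obtain g v' h x y where g: "u = g @ v' @ h" "v' \<noteq> []" "\<Phi> k \<gamma> @ \<alpha> = \<Phi> (k + j) g @ x"
      "\<Phi> (k + j) v' = x @ ?W @ y" "length x < length (\<Phi> (k + j) [hd v'])"
      "length y < length (\<Phi> (k + j) [last v'])"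
    using cover[OF full W] by metis
  have "sublist v' u" using g(1) by (simp add: sublist_appendI)
  then have v'L: "v' \<in> L" using u(1) g(2) language_factor by blast
  have v'A: "v' \<in> lists A" using v'L language_in by blast
  \<comment> \<open>A boundary of letter images in \<open>\<Phi> (k + j) v'\<close> is also one in
    \<open>\<Phi> (k + j) u\<close>. As prefixes are recovered from image lengths, it would be one
    in \<open>\<Phi> k v\<close>.\<close>
  have "\<not> (\<exists>z. prefix z (\<Phi> j v') \<and> x = \<Phi> k z)"
  proof
    assume "\<exists>z. prefix z (\<Phi> j v') \<and> x = \<Phi> k z"
    then obtain z where z: "prefix z (\<Phi> j v')" "x = \<Phi> k z" by blast
    then have eq: "\<Phi> k \<gamma> @ \<alpha> = \<Phi> k (\<Phi> j g @ z)" using g(3) by (simp add: iter_add)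
    have z': "prefix (\<Phi> j g @ z) (\<Phi> j u)" using z(1) g(1) by (auto simp: prefix_def)
    have "prefix \<gamma> (\<Phi> j u)" using u(2) by simp
    moreover have "length (\<Phi> k \<gamma>) \<le> length (\<Phi> k (\<Phi> j g @ z))" using eq[symmetric] by simp
    ultimately have "prefix \<gamma> (\<Phi> j g @ z)" using z' uA by - (rule iter_prefix_reflect[of _ "\<Phi> j u"])
    then obtain z1 where z1: "\<Phi> j g @ z = \<gamma> @ z1" by (elim prefixE)
    then have \<alpha>: "\<alpha> = \<Phi> k z1" using eq by simp
    have "prefix z1 (v @ \<delta>)" using z' unfolding z1 u(2) by simp
    moreover have "prefix v (v @ \<delta>)" by simp
    moreover have "length (\<Phi> k z1) \<le> length (\<Phi> k v)" using \<alpha> v(2) by simp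
    moreover have "v @ \<delta> \<in> lists A" using uA u(2) by simp
    ultimately have "prefix z1 v" by - (rule iter_prefix_reflect[of _ "v @ \<delta>"])
    then show False using not_cut \<alpha> by blast
  qed
  moreover have "length v' \<le> C + 2"
  proof (rule ccontr)
    assume len: "\<not> length v' \<le> C + 2"
    then obtain c t where ct: "v' = c # t" by (cases v') auto
    then obtain m d where "t = m @ [d]" using len by (cases t rule: rev_cases) auto
    then have cd: "v' = c # m @ [d]" "C < length m" using ct len by auto
    have "\<exists>x' y'. x' \<noteq> [] \<and> y' \<noteq> [] \<and> ?W = x' @ \<Phi> (k + j) m @ y'"
      using g(4-6) cd by (intro cover_interior[of "k + j" c m d x _ y]) auto
    then obtain x' y' where x': "x' \<noteq> []" "?W = x' @ \<Phi> (k + j) m @ y'" by blast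
    then have "length (\<Phi> (k + j) m) < length ?W" by simp
    have "length m * length ?W \<le> C * length (\<Phi> (k + j) m)"
      using v'A cd C[OF a] by (intro length_iter_ge) auto
    also have "\<dots> \<le> C * length ?W" using x'(2) by (intro mult_left_mono) auto
    also have "\<dots> < length m * length ?W" using cd(2) W by (intro mult_strict_right_mono) auto
    finally show False by simp
  qed
  ultimately show ?thesis unfolding uncut_def using v'L g(4) by blast
qed

text \<open>Pushed to a common level, uncut occurrences of different levels never start at the same
  place: otherwise the start \<open>x'\<close> of the higher one would be
  \<open>\<Phi> (k + i) x\<close>, that is \<open>\<Phi> k (\<Phi> i x)\<close>, which is a cut.
  Splitting off \<open>\<Phi> k\<close> requires the levels to be at least \<open>k\<close>
  apart.\<close>

lemma uncut_inj:
  assumes n: "uncut k a j v x" and m: "uncut k a (k + j + i) v x'" and q: "q = h + (k + i)"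
    and eq: "length (\<Phi> q x) = length (\<Phi> h x')"
  shows False
proof -
  let ?J = "k + j + i"
  have vA: "v \<in> lists A" using n language_in by (simp add: uncut_def)
  obtain s where s: "\<Phi> (k + j) v = x @ \<Phi> (k + j) [a] @ s" using n by (auto simp: uncut_def)
  obtain s' where s': "\<Phi> (k + ?J) v = x' @ \<Phi> (k + ?J) [a] @ s'" using m by (auto simp: uncut_def)
  have e: "\<Phi> (k + ?J) v = \<Phi> (k + i) (\<Phi> (k + j) v)"
    unfolding iter_add[symmetric] by (simp add: ac_simps)
  have "prefix (\<Phi> (k + i) x) (\<Phi> (k + ?J) v)" unfolding e s by simp
  moreover have "prefix x' (\<Phi> (k + ?J) v)" unfolding s' by simp
  moreover have "length (\<Phi> h (\<Phi> (k + i) x)) = length (\<Phi> h x')"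
    using eq unfolding q iter_add by simp
  ultimately have "\<Phi> (k + i) x = x'" using vA by (intro iter_prefix_inj[OF _ _ iter_in]) auto
  then have "x' = \<Phi> k (\<Phi> i x)" by (simp add: iter_add)
  moreover have "\<Phi> ?J v = \<Phi> i (\<Phi> (k + j) v)"
    unfolding iter_add[symmetric] by (simp add: ac_simps)
  then have "prefix (\<Phi> i x) (\<Phi> ?J v)" using s by simp
  ultimately show False using m unfolding uncut_def by blast
qed

text \<open>If every \<open>p\<close> fails, a single short \<open>v\<close> carries uncut
  occurrences at many levels. Pushed to a common level, they are occurrences of the same word at
  distinct places of a word longer by a bounded factor only, so two of them overlap so far that a
  forbidden power appears.\<close>

lemma recognizable:
  assumes M: "M \<ge> 1" "\<And>r. r \<noteq> [] \<Longrightarrow> concat (replicate M r) \<notin> L" and a: "a \<in> A" and k: "k > 0"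
  shows "\<exists>p. \<forall>v\<in>L. \<forall>\<alpha> \<beta>. \<Phi> k v = \<alpha> @ \<Phi> p [a] @ \<beta> \<longrightarrow> (\<exists>v1. prefix v1 v \<and> \<alpha> = \<Phi> k v1)"
proof (rule ccontr)
  assume no: "\<not> ?thesis"
  obtain C where C: "\<And>k c d. c \<in> A \<Longrightarrow> d \<in> A \<Longrightarrow> length (\<Phi> k [c]) \<le> C * length (\<Phi> k [d])"
    using balance by blast
  \<comment> \<open>Only multiples of \<open>k\<close> are used as levels, so that distinct levels
    are at least \<open>k\<close> apart, as \<open>uncut_inj\<close> demands.\<close>
  have "\<exists>v x. uncut k a (k * n) v x \<and> length v \<le> C + 2" for n
  proof -
    obtain v \<alpha> \<beta> where "v \<in> L" "\<Phi> k v = \<alpha> @ \<Phi> (k + k * n) [a] @ \<beta>"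
      "\<not> (\<exists>v1. prefix v1 v \<and> \<alpha> = \<Phi> k v1)" using no by blast
    then show ?thesis by (intro uncut_bounded[OF C a]) auto
  qed
  then obtain V x where Vx: "\<And>n. uncut k a (k * n) (V n) (x n)" "\<And>n. length (V n) \<le> C + 2"
    by metis
  let ?F = "{w. set w \<subseteq> A \<and> length w \<le> C + 2}"
  have "V n \<in> ?F" for n
  proof -
    have "V n \<in> lists A" using Vx(1)[of n] by (intro language_in) (simp add: uncut_def)
    then show ?thesis using Vx(2)[of n] by auto
  qed
  then have "V ` UNIV \<subseteq> ?F" by blast
  then have "finite (V ` UNIV)" using finite_lists_length_le[OF finite_alphabet] finite_subset by blast
  then obtain n0 where n0: "infinite {n. V n = V n0}"
    using pigeonhole_infinite[of UNIV V] by auto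
  define v where "v = V n0"
  \<comment> \<open>One more than the number of values of the map \<open>f\<close> below.\<close>
  define B where "B = (C + 2) * C * M + 2"
  obtain I where I: "I \<subseteq> {n. V n = V n0}" "finite I" "card I = B"
    using infinite_arbitrarily_large[OF n0] by blast
  define m where "m = Max I"
  have m: "n \<le> m" if "n \<in> I" for n unfolding m_def using I(2) that by simp
  have un: "uncut k a (k * n) v (x n)" if "n \<in> I" for n using Vx(1)[of n] I(1) that by (auto simp: v_def)
  let ?q = "k + k * m"
  let ?W = "\<Phi> ?q [a]"
  define l where "l = length ?W"
  have l: "l > 0" using length_iter_letter[OF a, of ?q] unfolding l_def by linarith
  define pos where "pos n = length (\<Phi> (k * (m - n)) (x n))" for n
  have I_ne: "I \<noteq> {}" using I(3) by (auto simp: B_def)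
  then have vL: "v \<in> L" using un by (auto simp: uncut_def)
  have len_v: "length v \<le> C + 2" using Vx(2) by (simp add: v_def)
  have occ: "\<exists>s. \<Phi> ?q v = \<Phi> (k * (m - n)) (x n) @ ?W @ s" if n: "n \<in> I" for n
  proof -
    obtain s where s: "\<Phi> (k + k * n) v = x n @ \<Phi> (k + k * n) [a] @ s"
      using un[OF n] by (auto simp: uncut_def)
    obtain h where "m = n + h" using m[OF n] le_iff_add by blast
    then have "?q = k * (m - n) + (k + k * n)" by (simp add: algebra_simps)
    then have "\<Phi> ?q w = \<Phi> (k * (m - n)) (\<Phi> (k + k * n) w)" for w by (simp only: iter_add)
    then show ?thesis using s by simp
  qed
  have neq: "pos n \<noteq> pos n'" if n: "n \<in> I" "n' \<in> I" "n < n'" for n n'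
  proof
    assume eq: "pos n = pos n'"
    obtain i where i: "n' = n + 1 + i" using n(3) less_iff_Suc_add by auto
    obtain h where h: "m = n' + h" using m[OF n(2)] le_iff_add by blast
    show False
    proof (rule uncut_inj[OF un[OF n(1)]])
      show "uncut k a (k + k * n + k * i) v (x n')" using un[OF n(2)] i by (simp add: algebra_simps)
      show "k * (m - n) = k * h + (k + k * i)" using i h by (simp add: algebra_simps)
      show "length (\<Phi> (k * (m - n)) (x n)) = length (\<Phi> (k * h) (x n'))" using eq h by (simp add: pos_def)
    qed
  qed
  have "length (\<Phi> ?q v) \<le> length v * (C * l)"
    unfolding l_def using language_in[OF vL] C[OF _ a] by (intro length_iter_le)
  also have "\<dots> \<le> (C + 2) * (C * l)" using len_v by (intro mult_right_mono) auto
  finally have len_q: "length (\<Phi> ?q v) \<le> (C + 2) * C * l" by (simp only: mult.assoc)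
  \<comment> \<open>The number of the cell of length \<open>l / M\<close> in which
    \<open>pos n\<close> lies. Positions in the same cell are less than \<open>l / M\<close> apart,
    so that \<open>power_prefix\<close> applies.\<close>
  define f where "f n = pos n * M div l" for n
  have "f n \<le> (C + 2) * C * M" if n: "n \<in> I" for n
  proof -
    have "pos n \<le> (C + 2) * C * l" using occ[OF n] len_q unfolding pos_def by auto
    then have "pos n * M \<le> (C + 2) * C * l * M" by (rule mult_right_mono) simp
    then have "pos n * M div l \<le> (C + 2) * C * l * M div l" by (rule div_le_mono)
    also have "(C + 2) * C * l * M = ((C + 2) * C * M) * l" by (simp only: mult.commute mult.left_commute)
    also have "\<dots> div l = (C + 2) * C * M" using l by (intro div_mult_self_is_m)
    finally show ?thesis by (simp only: f_def)
  qed
  then have "f ` I \<subseteq> {..(C + 2) * C * M}" by auto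
  then have "card (f ` I) \<le> (C + 2) * C * M + 1" using card_mono[of "{..(C + 2) * C * M}"] by fastforce
  then have "\<not> inj_on f I" using card_image[of f I] I(3) by (auto simp: B_def)
  then obtain n1 n2 where n12: "n1 \<in> I" "n2 \<in> I" "n1 \<noteq> n2" "f n1 = f n2" by (auto simp: inj_on_def)
  then have "pos n1 \<noteq> pos n2" using neq by (metis nat_neq_iff)
  then obtain n n' where n: "n \<in> I" "n' \<in> I" "f n = f n'" "pos n < pos n'"
    using n12 by (metis nat_neq_iff)
  obtain s s' where s: "\<Phi> ?q v = \<Phi> (k * (m - n)) (x n) @ ?W @ s"
      "\<Phi> ?q v = \<Phi> (k * (m - n')) (x n') @ ?W @ s'"
    using occ n by blast
  have "prefix (\<Phi> (k * (m - n)) (x n)) (\<Phi> (k * (m - n')) (x n'))"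
  proof (rule prefix_length_prefix)
    show "prefix (\<Phi> (k * (m - n)) (x n)) (\<Phi> ?q v)" unfolding s(1) by simp
    show "prefix (\<Phi> (k * (m - n')) (x n')) (\<Phi> ?q v)" unfolding s(2) by simp
    show "length (\<Phi> (k * (m - n)) (x n)) \<le> length (\<Phi> (k * (m - n')) (x n'))"
      using n(4) by (simp add: pos_def)
  qed
  then obtain y where y: "\<Phi> (k * (m - n')) (x n') = \<Phi> (k * (m - n)) (x n) @ y" by (elim prefixE)
  then have leny: "pos n' = pos n + length y" "y \<noteq> []" using n(4) by (auto simp: pos_def)
  have "?W @ s = y @ ?W @ s'" using s y by simp
  moreover have "M * length y \<le> length ?W"
  proof (rule ccontr)
    assume "\<not> M * length y \<le> length ?W"
    then have "pos n * M + l \<le> pos n' * M" using leny by (simp add: l_def algebra_simps)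
    then have "(pos n * M + l) div l \<le> f n'" unfolding f_def by (rule div_le_mono)
    then have "f n + 1 \<le> f n'" using l unfolding f_def by simp
    then show False using n(3) by simp
  qed
  ultimately have "prefix (concat (replicate M y)) ?W" by (rule power_prefix)
  then have "sublist (concat (replicate M y)) ?W" by simp
  moreover have "?W \<in> L" by (intro iter_in_language letter_in_language a)
  moreover have "concat (replicate M y) \<noteq> []" using M(1) leny(2) by (cases M) auto
  ultimately show False using M(2)[OF leny(2)] language_factor by blast
qed

end

section \<open>The subshift of a proper primitive substitution\<close>

lemma in_blocks_iff: "w \<in> blocks X \<longleftrightarrow> (\<exists>x i n. x \<in> X \<and> n \<ge> 1 \<and> w = map (\<lambda>k. x (i + int k)) [0..<n])"
  by (auto simp: blocks_def)

lemma blocks_subset_iff: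
  "blocks X \<subseteq> B \<longleftrightarrow> (\<forall>x\<in>X. \<forall>i n. n \<ge> 1 \<longrightarrow> map (\<lambda>k. x (i + int k)) [0..<n] \<in> B)"
  unfolding blocks_def by blast

lemma blocks_factor:
  assumes "w \<in> blocks X" "sublist u w" "u \<noteq> []"
  shows "u \<in> blocks X"
proof -
  obtain x i n where w: "x \<in> X" "w = map (\<lambda>k. x (i + int k)) [0..<n]"
    using assms(1) by (auto simp: in_blocks_iff)
  obtain p s where ps: "w = p @ u @ s" using assms(2) by (auto simp: sublist_def)
  have "u = map (\<lambda>k. x ((i + int (length p)) + int k)) [0..<length u]"
  proof (rule nth_equalityI)
    fix j assume j: "j < length u"
    have "length w = n" using w(2) by simp
    then have len: "length p + length u + length s = n" using ps by simp
    have "u ! j = w ! (length p + j)" using j ps by (simp add: nth_append)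
    also have "\<dots> = x (i + int (length p + j))" using j len w(2) by simp
    finally show "u ! j = map (\<lambda>k. x ((i + int (length p)) + int k)) [0..<length u] ! j"
      using j by (simp add: add.assoc)
  qed simp
  moreover have "length u \<ge> 1" using assms(3) by (cases u) auto
  ultimately show ?thesis using w(1) unfolding in_blocks_iff by blast
qed

lemma subshift_translate:
  assumes "subshift A Y" "y \<in> Y"
  shows "(\<lambda>i. y (i + m)) \<in> Y"
proof -
  have Y: "shift ` Y = Y" using assms(1) by (simp add: subshift_def)
  have pos: "(\<lambda>i. y (i + int n)) \<in> Y" if "y \<in> Y" for y n
  proof (induction n)
    case (Suc n)
    then have "shift (\<lambda>i. y (i + int n)) \<in> Y" using Y by blast
    then show ?case by (simp add: shift_def algebra_simps)
  qed (use that in simp)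
  have neg: "(\<lambda>i. y (i - int n)) \<in> Y" if "y \<in> Y" for y n
  proof (induction n)
    case (Suc n)
    then obtain x where x: "x \<in> Y" "shift x = (\<lambda>i. y (i - int n))" using Y by (metis imageE)
    have "x i = y (i - int (Suc n))" for i
      using fun_cong[OF x(2), of "i - 1"] by (simp add: shift_def algebra_simps)
    then show ?case using x(1) by presburger
  qed (use that in simp)
  show ?thesis
  proof (cases "m \<ge> 0")
    case True
    then show ?thesis using pos[OF assms(2), of "nat m"] by simp
  next
    case False
    then show ?thesis using neg[OF assms(2), of "nat (- m)"] by simp
  qed
qed

context primitive_substitution
begin

abbreviation X :: "(int \<Rightarrow> 'a) set" where "X \<equiv> substitution_subshift A \<phi>"

lemma blocks_subset: "blocks X \<subseteq> L"
  by (auto simp: substitution_subshift_def blocks_subset_iff)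

lemma X_iff: "x \<in> X \<longleftrightarrow> range x \<subseteq> A \<and> (\<forall>i n. n \<ge> 1 \<longrightarrow> map (\<lambda>k. x (i + int k)) [0..<n] \<in> L)"
  by (simp add: substitution_subshift_def blocks_subset_iff)

lemma shift_X: "shift ` X = X"
proof
  show "shift ` X \<subseteq> X"
  proof (rule image_subsetI)
    fix x assume "x \<in> X"
    then have x: "range x \<subseteq> A" "\<And>i n. n \<ge> 1 \<Longrightarrow> map (\<lambda>k. x (i + int k)) [0..<n] \<in> L" by (auto simp: X_iff)
    have "map (\<lambda>k. shift x (i + int k)) [0..<n] \<in> L" if "n \<ge> 1" for i n
      using x(2)[OF that, of "i + 1"] by (simp add: shift_def algebra_simps)
    moreover have "range (shift x) \<subseteq> A" using x(1) by (auto simp: shift_def)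
    ultimately show "shift x \<in> X" unfolding X_iff by blast
  qed
  show "X \<subseteq> shift ` X"
  proof
    fix x assume "x \<in> X"
    then have x: "range x \<subseteq> A" "\<And>i n. n \<ge> 1 \<Longrightarrow> map (\<lambda>k. x (i + int k)) [0..<n] \<in> L" by (auto simp: X_iff)
    let ?y = "\<lambda>i. x (i - 1)"
    have "map (\<lambda>k. ?y (i + int k)) [0..<n] \<in> L" if "n \<ge> 1" for i n
      using x(2)[OF that, of "i - 1"] by (simp add: algebra_simps)
    moreover have "range ?y \<subseteq> A" using x(1) by auto
    ultimately have "?y \<in> X" unfolding X_iff by blast
    moreover have "x = shift ?y" by (simp add: shift_def)
    ultimately show "x \<in> shift ` X" by blast
  qed
qed

text \<open>A point outside \<open>X\<close> shows a word outside \<open>L\<close> at some position,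
  and this involves finitely many coordinates only.\<close>

lemma closed_X: "closedin (product_topology (\<lambda>_. discrete_topology A) UNIV) X"
proof -
  let ?T = "product_topology (\<lambda>_::int. discrete_topology A) UNIV"
  have top: "topspace ?T = {x. range x \<subseteq> A}"
    by (simp add: PiE_UNIV_domain image_subset_iff Pi_def)
  have "openin ?T (topspace ?T - X)"
  proof (subst openin_subopen, rule ballI)
    fix x assume x: "x \<in> topspace ?T - X"
    then have xA: "range x \<subseteq> A" and "x \<notin> X" unfolding top by simp_all
    then obtain i n where i: "n \<ge> 1" "map (\<lambda>k. x (i + int k)) [0..<n] \<notin> L"
      unfolding X_iff by blast
    let ?U = "\<lambda>j. if j \<in> {i..<i + int n} then {x j} else A"
    have "finite {j. ?U j \<noteq> topspace (discrete_topology A)}"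
      by (rule finite_subset[of _ "{i..<i + int n}"]) auto
    moreover have "openin (discrete_topology A) (?U j)" for j using xA by auto
    ultimately have "openin ?T (PiE UNIV ?U)" by (rule product_topology_basis[rotated])
    moreover have "x \<in> PiE UNIV ?U" using xA by (auto simp: PiE_UNIV_domain)
    moreover have "PiE UNIV ?U \<subseteq> topspace ?T - X"
    proof
      fix y assume y: "y \<in> PiE UNIV ?U"
      have U: "?U j \<subseteq> A" for j using xA by auto
      have yU: "y j \<in> ?U j" for j using y by (rule PiE_mem) simp
      have "range y \<subseteq> A" using subsetD[OF U yU] by blast
      moreover have "y (i + int k) = x (i + int k)" if "k < n" for k
        using yU[of "i + int k"] that by simp
      then have eq: "map (\<lambda>k. y (i + int k)) [0..<n] = map (\<lambda>k. x (i + int k)) [0..<n]" by simp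
      have "map (\<lambda>k. y (i + int k)) [0..<n] \<notin> L" unfolding eq by (rule i(2))
      then have "y \<notin> X" using i(1) unfolding X_iff by blast
      ultimately show "y \<in> topspace ?T - X" unfolding top by blast
    qed
    ultimately show "\<exists>T. openin ?T T \<and> x \<in> T \<and> T \<subseteq> topspace ?T - X" by blast
  qed
  moreover have "X \<subseteq> topspace ?T" unfolding top by (auto simp: X_iff image_subset_iff)
  ultimately show ?thesis by (simp add: closedin_def)
qed

text \<open>If a point \<open>x\<close> of \<open>X\<close> is missing from \<open>Y\<close>, so is
  a whole cylinder around \<open>x\<close>, as \<open>Y\<close> is closed. The window of the
  cylinder shows a block of \<open>x\<close>, which by uniform recurrence occurs in every point of
  \<open>Y\<close>; a translate of such a point lies in the cylinder.\<close>

lemma minimal_X: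
  assumes "X \<noteq> {}"
  shows "minimal_subshift A X"
proof -
  let ?T = "product_topology (\<lambda>_::int. discrete_topology A) UNIV"
  have top: "topspace ?T = {x. range x \<subseteq> A}"
    by (simp add: PiE_UNIV_domain image_subset_iff Pi_def)
  have sub: "subshift A X" using assms closed_X shift_X by (simp add: subshift_def)
  have "Y = X" if Y: "subshift A Y" "Y \<subseteq> X" for Y
  proof (rule ccontr)
    assume "Y \<noteq> X"
    then obtain x where x: "x \<in> X" "x \<notin> Y" using Y(2) by blast
    obtain y where y: "y \<in> Y" using Y(1) by (auto simp: subshift_def)
    have "openin ?T (topspace ?T - Y)" using Y(1) by (auto simp: subshift_def closedin_def)
    moreover have "x \<in> topspace ?T - Y" using x unfolding top by (auto simp: X_iff image_subset_iff)
    ultimately obtain U where U: "finite {i \<in> UNIV. U i \<noteq> topspace (discrete_topology A)}"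
        "x \<in> PiE UNIV U" "PiE UNIV U \<subseteq> topspace ?T - Y"
      unfolding openin_product_topology_alt by blast
    let ?J = "{i. U i \<noteq> A}"
    have finJ: "finite ?J" using U(1) by simp
    \<comment> \<open>Half-width of a window around the origin that contains all coordinates
      restricted by the cylinder; the 1 keeps the window nonempty.\<close>
    define N where "N = Max (insert 1 ((\<lambda>j. nat \<bar>j\<bar> + 1) ` ?J))"
    have N1: "N \<ge> 1" unfolding N_def using finJ by (intro Max_ge) auto
    have N: "\<bar>j\<bar> < int N" if "j \<in> ?J" for j
    proof -
      have "nat \<bar>j\<bar> + 1 \<le> N" unfolding N_def using finJ that by (intro Max_ge) auto
      then show ?thesis by linarith
    qed
    define u where "u = map (\<lambda>k. x (- int N + int k)) [0..<2 * N]"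
    have "1 \<le> 2 * N" using N1 by simp
    then have "u \<in> L" using x(1) unfolding X_iff u_def by blast
    then obtain K where K: "\<forall>w\<in>L. K \<le> length w \<longrightarrow> (\<exists>p s. p \<noteq> [] \<and> s \<noteq> [] \<and> w = p @ u @ s)"
      using recurrence by blast
    let ?w = "map (\<lambda>k. y (0 + int k)) [0..<K + 1]"
    have "y \<in> X" using y Y(2) by blast
    moreover have "1 \<le> K + 1" by simp
    ultimately have "?w \<in> L" unfolding X_iff by blast
    moreover have "K \<le> length ?w" by simp
    ultimately obtain p s where ps: "?w = p @ u @ s" using K by blast
    define m where "m = int (length p) + int N"
    have len: "length p + 2 * N + length s = K + 1" using arg_cong[OF ps, of length] by (simp add: u_def)
    have yx: "y (j + m) = x j" if j: "- int N \<le> j" "j < int N" for j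
    proof -
      define k where "k = nat (j + int N)"
      have k: "k < 2 * N" "int k = j + int N" using j by (auto simp: k_def)
      have "?w ! (length p + k) = u ! k" unfolding ps using k by (simp add: nth_append u_def)
      moreover have "?w ! (length p + k) = y (int (length p + k))" using k len by (simp del: upt_Suc)
      moreover have "u ! k = x j" using k by (simp add: u_def)
      moreover have "int (length p + k) = j + m" using k by (simp add: m_def)
      ultimately show ?thesis by simp
    qed
    let ?y = "\<lambda>i. y (i + m)"
    have "?y \<in> Y" using subshift_translate[OF Y(1) y] .
    moreover have "?y \<in> PiE UNIV U"
    proof -
      have "?y i \<in> U i" for i
      proof (cases "i \<in> ?J")
        case True
        then have "?y i = x i" using N[OF True] by (intro yx) auto
        then show ?thesis using U(2) by auto
      next
        case False
        then show ?thesis using \<open>y \<in> X\<close> by (auto simp: X_iff image_subset_iff)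
      qed
      then show ?thesis by auto
    qed
    ultimately show False using U(3) by blast
  qed
  then show ?thesis using sub by (auto simp: minimal_subshift_def)
qed

end

locale proper_substitution = nonerasing_substitution +
  assumes is_primitive: "primitive A \<phi>" and proper: "proper A \<phi>"

sublocale proper_substitution \<subseteq> primitive_substitution
  using is_primitive proper by unfold_locales (auto simp: proper_def)

context proper_substitution
begin

lemma ends: "\<exists>a\<in>A. \<exists>b\<in>A. \<forall>w\<in>lists A. w \<noteq> [] \<longrightarrow> (\<exists>t. \<Phi> 1 w = a # t) \<and> (\<exists>t. \<Phi> 1 w = t @ [b])"
proof -
  obtain a b where ab: "a \<in> A" "b \<in> A" "\<And>d. d \<in> A \<Longrightarrow> hd (\<phi> [d]) = a \<and> last (\<phi> [d]) = b"
    using proper by (auto simp: proper_def)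
  have 1: "\<Phi> 1 [d] = \<phi> [d]" for d by (simp add: letterwise_def)
  have hd: "\<exists>t. \<Phi> 1 [d] = a # t" if "d \<in> A" for d
    using ab(3)[OF that] subst_in[of "[d]"] that unfolding 1 by (cases "\<phi> [d]") auto
  have last: "\<exists>t. \<Phi> 1 [d] = t @ [b]" if "d \<in> A" for d
    using ab(3)[OF that] subst_in[of "[d]"] that unfolding 1 by (cases "\<phi> [d]" rule: rev_cases) auto
  have "(\<exists>t. \<Phi> 1 w = a # t) \<and> (\<exists>t. \<Phi> 1 w = t @ [b])" if w: "w \<in> lists A" "w \<noteq> []" for w
  proof
    obtain c t where ct: "w = c # t" using w by (cases w) auto
    then obtain t' where "\<Phi> 1 [c] = a # t'" using hd w by auto
    then show "\<exists>t. \<Phi> 1 w = a # t" unfolding ct iter_Cons[of 1 c t] by simp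
    obtain t d where td: "w = t @ [d]" using w by (cases w rule: rev_cases) auto
    then obtain t' where "\<Phi> 1 [d] = t' @ [b]" using last w by auto
    then show "\<exists>t. \<Phi> 1 w = t @ [b]" unfolding td iter_append by simp
  qed
  then show ?thesis using ab by blast
qed

definition first_letter :: 'a where
  "first_letter = (SOME a. a \<in> A \<and> (\<forall>w\<in>lists A. w \<noteq> [] \<longrightarrow> (\<exists>t. \<Phi> 1 w = a # t)))"

definition last_letter :: 'a where
  "last_letter = (SOME b. b \<in> A \<and> (\<forall>w\<in>lists A. w \<noteq> [] \<longrightarrow> (\<exists>t. \<Phi> 1 w = t @ [b])))"

lemma first_letter_props:
  "first_letter \<in> A" "w \<in> lists A \<Longrightarrow> w \<noteq> [] \<Longrightarrow> \<exists>t. \<Phi> 1 w = first_letter # t"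
proof -
  have "first_letter \<in> A \<and> (\<forall>w\<in>lists A. w \<noteq> [] \<longrightarrow> (\<exists>t. \<Phi> 1 w = first_letter # t))"
    unfolding first_letter_def by (rule someI_ex) (use ends in blast)
  then show "first_letter \<in> A" "w \<in> lists A \<Longrightarrow> w \<noteq> [] \<Longrightarrow> \<exists>t. \<Phi> 1 w = first_letter # t" by blast+
qed

lemma last_letter_props:
  "last_letter \<in> A" "w \<in> lists A \<Longrightarrow> w \<noteq> [] \<Longrightarrow> \<exists>t. \<Phi> 1 w = t @ [last_letter]"
proof -
  have "last_letter \<in> A \<and> (\<forall>w\<in>lists A. w \<noteq> [] \<longrightarrow> (\<exists>t. \<Phi> 1 w = t @ [last_letter]))"
    unfolding last_letter_def by (rule someI_ex) (use ends in blast)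
  then show "last_letter \<in> A" "w \<in> lists A \<Longrightarrow> w \<noteq> [] \<Longrightarrow> \<exists>t. \<Phi> 1 w = t @ [last_letter]" by blast+
qed

text \<open>One application of \<phi> creates the common first letter, and \<open>\<Phi> p\<close>
  is applied afterwards; this is why \<open>p < n\<close> is strict.\<close>

lemma iter_starts:
  assumes "w \<in> lists A" "w \<noteq> []" "p < n"
  shows "prefix (\<Phi> p [first_letter]) (\<Phi> n w)"
proof -
  obtain i where i: "n = p + (1 + i)" using assms(3) less_iff_Suc_add by auto
  obtain t where "\<Phi> 1 (\<Phi> i w) = first_letter # t"
    using first_letter_props(2)[OF iter_in iter_nonempty] assms by blast
  then have "\<Phi> n w = \<Phi> p [first_letter] @ \<Phi> p t"
    unfolding i iter_add by (simp only: iter_Cons[of p _ t])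
  then show ?thesis by simp
qed

lemma iter_ends:
  assumes "w \<in> lists A" "w \<noteq> []" "p < n"
  shows "suffix (\<Phi> p [last_letter]) (\<Phi> n w)"
proof -
  obtain i where i: "n = p + (1 + i)" using assms(3) less_iff_Suc_add by auto
  obtain t where "\<Phi> 1 (\<Phi> i w) = t @ [last_letter]"
    using last_letter_props(2)[OF iter_in iter_nonempty] assms by blast
  then have "\<Phi> n w = \<Phi> p t @ \<Phi> p [last_letter]"
    unfolding i iter_add by (simp only: iter_append)
  then show ?thesis by (simp add: suffix_def)
qed

text \<open>At any border between two letters of a word of \<open>L\<close>, one application of
  \<phi> puts \<open>last_letter\<close> before \<open>first_letter\<close>.\<close>

lemma connection_in_language: "[last_letter, first_letter] \<in> L"
proof -
  obtain k where k: "\<forall>j\<ge>k. \<forall>c\<in>A. 2 \<le> length (\<Phi> j [c])" using growth by blast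
  define w where "w = \<Phi> k [first_letter]"
  have w: "w \<in> L" unfolding w_def by (intro iter_in_language letter_in_language first_letter_props)
  have len: "2 \<le> length w" using k first_letter_props(1) by (simp add: w_def)
  then obtain c t where "w = c # t" by (cases w) auto
  moreover have "t \<noteq> []" using calculation len by auto
  ultimately have ct: "w = [c] @ t" "t \<noteq> []" by auto
  then have A: "[c] \<in> lists A" "t \<in> lists A" using language_in[OF w] by auto
  obtain s where s: "\<Phi> 1 [c] = s @ [last_letter]" using last_letter_props(2)[OF A(1)] by blast
  obtain s' where s': "\<Phi> 1 t = first_letter # s'" using first_letter_props(2)[OF A(2) ct(2)] by blast
  have "\<Phi> 1 w = s @ [last_letter, first_letter] @ s'" unfolding ct iter_append s s' by simp
  then have "sublist [last_letter, first_letter] (\<Phi> 1 w)" by (metis sublist_appendI)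
  then show ?thesis using iter_in_language[OF w] language_factor by blast
qed

text \<open>The fixed biinfinite word with \<open>\<Phi> m [last_letter]\<close> on the left of the origin and
  \<open>\<Phi> m [first_letter]\<close> on the right, for all \<open>m\<close>.\<close>

lemma fixed_point:
  "\<exists>z. \<forall>m. \<forall>j < length (\<Phi> m [last_letter, first_letter]).
     z (int j - int (length (\<Phi> m [last_letter]))) = \<Phi> m [last_letter, first_letter] ! j"
proof -
  define R where "R m = \<Phi> m [first_letter]" for m
  \<comment> \<open>Reversal turns the left half, which is extended to the left, into words extended
    by prefix order like \<open>R\<close>.\<close>
  define Q where "Q m = rev (\<Phi> m [last_letter])" for m
  have A: "[first_letter] \<in> lists A" "[last_letter] \<in> lists A"
    using first_letter_props(1) last_letter_props(1) by auto
  have R: "prefix (R m) (R n)" if "m \<le> n" for m n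
    using that iter_starts[OF A(1), of m n] by (cases "m = n") (auto simp: R_def)
  have Q: "prefix (Q m) (Q n)" if "m \<le> n" for m n
    using that iter_ends[OF A(2), of m n] by (cases "m = n") (auto simp: Q_def suffix_to_prefix)
  have R_nth: "R m ! i = R n ! i" if "i < length (R m)" "i < length (R n)" for m n i
  proof (cases "m \<le> n")
    case True then show ?thesis using R[OF True] that by (auto simp: prefix_def nth_append)
  next
    case False then show ?thesis using R[of n m] that by (auto simp: prefix_def nth_append)
  qed
  have Q_nth: "Q m ! i = Q n ! i" if "i < length (Q m)" "i < length (Q n)" for m n i
  proof (cases "m \<le> n")
    case True then show ?thesis using Q[OF True] that by (auto simp: prefix_def nth_append)
  next
    case False then show ?thesis using Q[of n m] that by (auto simp: prefix_def nth_append)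
  qed
  have "\<exists>m. i < length (R m)" for i
  proof -
    obtain m where "i + 1 \<le> length (\<Phi> m [first_letter])"
      using growth[of "i + 1"] first_letter_props(1) by blast
    then show ?thesis by (intro exI[of _ m]) (simp add: R_def)
  qed
  then obtain r where r: "\<And>i. i < length (R (r i))" by metis
  have "\<exists>m. i < length (Q m)" for i
  proof -
    obtain m where "i + 1 \<le> length (\<Phi> m [last_letter])"
      using growth[of "i + 1"] last_letter_props(1) by blast
    then show ?thesis by (intro exI[of _ m]) (simp add: Q_def)
  qed
  then obtain q where q: "\<And>i. i < length (Q (q i))" by metis
  \<comment> \<open>Position -1 holds the last letter of the left half, hence the index
    \<open>- i - 1\<close> into the reversed words.\<close>
  define z where "z i = (if i \<ge> 0 then R (r (nat i)) ! nat i else Q (q (nat (- i - 1))) ! nat (- i - 1))" for i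
  have "z (int j - int (length (\<Phi> m [last_letter]))) = \<Phi> m [last_letter, first_letter] ! j"
    if j: "j < length (\<Phi> m [last_letter, first_letter])" for m j
  proof (cases "j < length (Q m)")
    case False
    define i where "i = j - length (Q m)"
    have i: "int j - int (length (\<Phi> m [last_letter])) = int i" using False by (simp add: i_def Q_def)
    have lt: "i < length (R m)" using j False iter_Cons[of m last_letter "[first_letter]"] by (simp add: i_def Q_def R_def)
    have "z (int i) = R m ! i" using R_nth[OF r lt] by (simp add: z_def)
    also have "\<dots> = \<Phi> m [last_letter, first_letter] ! j"
      using False iter_Cons[of m last_letter "[first_letter]"] by (simp add: nth_append i_def Q_def R_def)
    finally show ?thesis by (simp only: i)
  next
    case True
    define i where "i = length (Q m) - 1 - j"
    have i: "int j - int (length (\<Phi> m [last_letter])) = - int i - 1" "i < length (Q m)"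
      using True by (auto simp: i_def Q_def)
    have "z (- int i - 1) = Q m ! i" using Q_nth[OF q i(2)] by (simp add: z_def)
    also have "\<dots> = \<Phi> m [last_letter] ! j" using True i(2) by (simp add: Q_def rev_nth i_def)
    also have "\<dots> = \<Phi> m [last_letter, first_letter] ! j"
      using True iter_Cons[of m last_letter "[first_letter]"] by (simp add: nth_append Q_def)
    finally show ?thesis by (simp only: i)
  qed
  then show ?thesis by blast
qed

text \<open>One inclusion is built into \<open>substitution_subshift\<close>; the other requires a
  point of \<open>X\<close>. The fixed point \<open>z\<close> serves: its blocks are factors of the
  words \<open>\<Phi> m [last_letter, first_letter]\<close>, which belong to \<open>L\<close> and,
  for suitable \<open>m\<close>, contain any given word of \<open>L\<close>.\<close>

lemma blocks_eq: "blocks X = L"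
proof -
  obtain z where z: "\<And>m j. j < length (\<Phi> m [last_letter, first_letter]) \<Longrightarrow>
      z (int j - int (length (\<Phi> m [last_letter]))) = \<Phi> m [last_letter, first_letter] ! j"
    using fixed_point by blast
  let ?U = "\<lambda>m. \<Phi> m [last_letter, first_letter]"
  let ?o = "\<lambda>m. int (length (\<Phi> m [last_letter]))"
  have block: "map (\<lambda>k. z (- ?o m + int k)) [0..<length (?U m)] = ?U m" for m
    by (rule nth_equalityI) (use z[of _ m] in \<open>auto simp: add.commute\<close>)
  have U: "?U m \<in> L" for m by (intro iter_in_language connection_in_language)
  have in_L: "map (\<lambda>k. z (i + int k)) [0..<n] \<in> L" if n: "n \<ge> 1" for i n
  proof -
    obtain m where m: "\<forall>c\<in>A. nat \<bar>i\<bar> + n \<le> length (\<Phi> m [c])" using growth[of "nat \<bar>i\<bar> + n"] by blast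
    then have m1: "nat \<bar>i\<bar> + n \<le> length (\<Phi> m [last_letter])" "nat \<bar>i\<bar> + n \<le> length (\<Phi> m [first_letter])"
      using first_letter_props(1) last_letter_props(1) by blast+
    have len: "length (?U m) = length (\<Phi> m [last_letter]) + length (\<Phi> m [first_letter])"
      using iter_Cons[of m last_letter "[first_letter]"] by simp
    define d where "d = nat (i + ?o m)"
    have d: "int d = i + ?o m" "d + n \<le> length (?U m)" using m1 len by (auto simp: d_def)
    have "map (\<lambda>k. z (i + int k)) [0..<n] = take n (drop d (?U m))"
    proof (rule nth_equalityI)
      fix k assume "k < length (map (\<lambda>k. z (i + int k)) [0..<n])"
      then have k: "k < n" by simp
      have "z (int (d + k) - ?o m) = ?U m ! (d + k)" using k d(2) by (intro z) simp
      moreover have "int (d + k) - ?o m = i + int k" using d(1) by simp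
      ultimately have "z (i + int k) = ?U m ! (d + k)" by (simp only:)
      then show "map (\<lambda>k. z (i + int k)) [0..<n] ! k = take n (drop d (?U m)) ! k"
        using k d(2) by simp
    qed (use d in simp)
    moreover have "sublist (take n (drop d (?U m))) (?U m)"
      by (meson sublist_drop sublist_order.order.trans sublist_take)
    moreover have "take n (drop d (?U m)) \<noteq> []" using n d(2) by auto
    ultimately show ?thesis using language_factor[OF U] by metis
  qed
  have "z i \<in> A" for i
    using language_in[OF in_L[of 1 i]] by simp
  then have zX: "z \<in> X" unfolding X_iff using in_L by auto
  have "w \<in> blocks X" if w: "w \<in> L" for w
  proof -
    obtain m where "sublist w (\<Phi> m [first_letter])" using w first_letter_props(1) by (auto simp: language_iff)
    then have "sublist w (?U m)" using iter_Cons[of m last_letter "[first_letter]"]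
      by (simp add: sublist_append)
    moreover have "length (?U m) \<ge> 1" using language_nonempty[OF U, of m] by (simp add: Suc_le_eq)
    then have "?U m \<in> blocks X" using zX block[of m] unfolding in_blocks_iff by metis
    ultimately show ?thesis using blocks_factor language_nonempty[OF w] by blast
  qed
  then show ?thesis using blocks_subset by blast
qed

text \<open>Periodicity means minimality together with finiteness, so \<open>minimal_X\<close> is
  what allows its negation to be read as infinity of \<open>X\<close>.\<close>

lemma nonperiodic_bounded_powers:
  assumes "\<not> periodic_substitution A \<phi>"
  shows "\<exists>M\<ge>1. \<forall>r. r \<noteq> [] \<longrightarrow> concat (replicate M r) \<notin> L"
proof (rule bounded_powers)
  have "X \<noteq> {}" using blocks_eq connection_in_language by (auto simp: blocks_def)
  then show "infinite X" using minimal_X assms by (auto simp: periodic_substitution_def periodic_subshift_def)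
qed (simp add: X_iff)

end

section \<open>Congruences of finite index\<close>

text \<open>An \<open>e\<close> with \<open>e a = a\<close> is a left identity because every element
  has the form \<open>a x\<close>; left division then yields inverses.\<close>

lemma is_groupI:
  assumes S: "is_semigroup S" and ne: "carrier S \<noteq> {}"
    and r: "\<And>a b. a \<in> carrier S \<Longrightarrow> b \<in> carrier S \<Longrightarrow> \<exists>x\<in>carrier S. a \<otimes>\<^bsub>S\<^esub> x = b"
    and l: "\<And>a b. a \<in> carrier S \<Longrightarrow> b \<in> carrier S \<Longrightarrow> \<exists>x\<in>carrier S. x \<otimes>\<^bsub>S\<^esub> a = b"
  shows "is_group S"
proof -
  have closed: "\<And>x y. x \<in> carrier S \<Longrightarrow> y \<in> carrier S \<Longrightarrow> x \<otimes>\<^bsub>S\<^esub> y \<in> carrier S"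
    and assoc: "\<And>x y z. x \<in> carrier S \<Longrightarrow> y \<in> carrier S \<Longrightarrow> z \<in> carrier S \<Longrightarrow>
      (x \<otimes>\<^bsub>S\<^esub> y) \<otimes>\<^bsub>S\<^esub> z = x \<otimes>\<^bsub>S\<^esub> (y \<otimes>\<^bsub>S\<^esub> z)"
    using S by (auto simp: is_semigroup_def)
  obtain a where a: "a \<in> carrier S" using ne by blast
  obtain e where e: "e \<in> carrier S" "e \<otimes>\<^bsub>S\<^esub> a = a" using l[OF a a] by blast
  have e_one: "e \<otimes>\<^bsub>S\<^esub> b = b" if b: "b \<in> carrier S" for b
  proof -
    obtain x where x: "x \<in> carrier S" "a \<otimes>\<^bsub>S\<^esub> x = b" using r[OF a b] by blast
    then show ?thesis using assoc[OF e(1) a x(1)] e(2) by simp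
  qed
  have "group (S\<lparr>one := e\<rparr>)"
    by (rule groupI) (use closed assoc e(1) e_one l in auto)
  then show ?thesis unfolding is_group_def by blast
qed

lemma congruence_refl: "is_congruence S \<theta> \<Longrightarrow> x \<in> carrier S \<Longrightarrow> (x, x) \<in> \<theta>"
  by (auto simp: is_congruence_def equiv_def refl_on_def)

lemma congruence_sym: "is_congruence S \<theta> \<Longrightarrow> (x, y) \<in> \<theta> \<Longrightarrow> (y, x) \<in> \<theta>"
  by (auto simp: is_congruence_def equiv_def sym_def)

lemma congruence_trans: "is_congruence S \<theta> \<Longrightarrow> (x, y) \<in> \<theta> \<Longrightarrow> (y, z) \<in> \<theta> \<Longrightarrow> (x, z) \<in> \<theta>"
  unfolding is_congruence_def equiv_def trans_def by blast

lemma congruence_mult: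
  "is_congruence S \<theta> \<Longrightarrow> (x, x') \<in> \<theta> \<Longrightarrow> (y, y') \<in> \<theta> \<Longrightarrow> (x \<otimes>\<^bsub>S\<^esub> y, x' \<otimes>\<^bsub>S\<^esub> y') \<in> \<theta>"
  unfolding is_congruence_def by blast

lemma congruence_in: "is_congruence S \<theta> \<Longrightarrow> (x, y) \<in> \<theta> \<Longrightarrow> x \<in> carrier S \<and> y \<in> carrier S"
  by (auto simp: is_congruence_def equiv_def refl_on_def)

lemma congruence_class_eq:
  "is_congruence S \<theta> \<Longrightarrow> x \<in> carrier S \<Longrightarrow> y \<in> carrier S \<Longrightarrow> \<theta> `` {x} = \<theta> `` {y} \<longleftrightarrow> (x, y) \<in> \<theta>"
  using eq_equiv_class_iff[of "carrier S" \<theta> x y] by (simp add: is_congruence_def)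

lemma quotient_mult:
  assumes \<theta>: "is_congruence S \<theta>" and x: "x \<in> carrier S" and y: "y \<in> carrier S"
  shows "\<theta> `` {x} \<otimes>\<^bsub>quotient_semigroup S \<theta>\<^esub> \<theta> `` {y} = \<theta> `` {x \<otimes>\<^bsub>S\<^esub> y}"
proof -
  have "z \<in> \<theta> `` (\<theta> `` {x} <#>\<^bsub>S\<^esub> \<theta> `` {y}) \<longleftrightarrow> z \<in> \<theta> `` {x \<otimes>\<^bsub>S\<^esub> y}" for z
  proof
    assume "z \<in> \<theta> `` (\<theta> `` {x} <#>\<^bsub>S\<^esub> \<theta> `` {y})"
    then obtain x' y' where xy: "(x, x') \<in> \<theta>" "(y, y') \<in> \<theta>" "(x' \<otimes>\<^bsub>S\<^esub> y', z) \<in> \<theta>"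
      by (auto simp: set_mult_def)
    have "(x \<otimes>\<^bsub>S\<^esub> y, z) \<in> \<theta>"
      by (rule congruence_trans[OF \<theta> congruence_mult[OF \<theta> xy(1,2)] xy(3)])
    then show "z \<in> \<theta> `` {x \<otimes>\<^bsub>S\<^esub> y}" by simp
  next
    assume "z \<in> \<theta> `` {x \<otimes>\<^bsub>S\<^esub> y}"
    then show "z \<in> \<theta> `` (\<theta> `` {x} <#>\<^bsub>S\<^esub> \<theta> `` {y})"
      using congruence_refl[OF \<theta> x] congruence_refl[OF \<theta> y] by (auto simp: set_mult_def)
  qed
  then show ?thesis by (auto simp: quotient_semigroup_def)
qed

lemma quotient_is_semigroup:
  assumes S: "is_semigroup S" and \<theta>: "is_congruence S \<theta>"
  shows "is_semigroup (quotient_semigroup S \<theta>)"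
proof -
  have carr: "carrier (quotient_semigroup S \<theta>) = carrier S // \<theta>" by (simp add: quotient_semigroup_def)
  have cl: "\<And>x y. x \<in> carrier S \<Longrightarrow> y \<in> carrier S \<Longrightarrow> x \<otimes>\<^bsub>S\<^esub> y \<in> carrier S"
    and as: "\<And>x y z. x \<in> carrier S \<Longrightarrow> y \<in> carrier S \<Longrightarrow> z \<in> carrier S \<Longrightarrow>
      (x \<otimes>\<^bsub>S\<^esub> y) \<otimes>\<^bsub>S\<^esub> z = x \<otimes>\<^bsub>S\<^esub> (y \<otimes>\<^bsub>S\<^esub> z)"
    using S by (auto simp: is_semigroup_def)
  show ?thesis unfolding is_semigroup_def carr
  proof (intro conjI ballI)
    fix x y assume "x \<in> carrier S // \<theta>" "y \<in> carrier S // \<theta>"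
    then obtain x' y' where "x' \<in> carrier S" "y' \<in> carrier S" "x = \<theta> `` {x'}" "y = \<theta> `` {y'}"
      by (meson quotientE)
    then show "x \<otimes>\<^bsub>quotient_semigroup S \<theta>\<^esub> y \<in> carrier S // \<theta>"
      using cl by (simp add: quotient_mult[OF \<theta>] quotientI)
  next
    fix x y z assume "x \<in> carrier S // \<theta>" "y \<in> carrier S // \<theta>" "z \<in> carrier S // \<theta>"
    then obtain x' y' z' where "x' \<in> carrier S" "y' \<in> carrier S" "z' \<in> carrier S"
      "x = \<theta> `` {x'}" "y = \<theta> `` {y'}" "z = \<theta> `` {z'}"
      by (meson quotientE)
    then show "(x \<otimes>\<^bsub>quotient_semigroup S \<theta>\<^esub> y) \<otimes>\<^bsub>quotient_semigroup S \<theta>\<^esub> z =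
        x \<otimes>\<^bsub>quotient_semigroup S \<theta>\<^esub> (y \<otimes>\<^bsub>quotient_semigroup S \<theta>\<^esub> z)"
      using cl by (simp add: quotient_mult[OF \<theta>] as)
  qed
qed

lemma carrier_free_semigroup [simp]: "carrier (free_semigroup A) = lists A - {[]}"
  by (simp add: free_semigroup_def)

lemma mult_free_semigroup [simp]: "u \<otimes>\<^bsub>free_semigroup A\<^esub> v = u @ v"
  by (simp add: free_semigroup_def)

lemma is_semigroup_free_semigroup: "is_semigroup (free_semigroup A)"
  by (auto simp: is_semigroup_def)

lemma hom_free_semigroup:
  "f \<in> hom (free_semigroup A) (free_semigroup A) \<longleftrightarrow>
    (\<forall>u\<in>lists A - {[]}. f u \<in> lists A - {[]}) \<and>
    (\<forall>u\<in>lists A - {[]}. \<forall>v\<in>lists A - {[]}. f (u @ v) = f u @ f v)"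
  by (auto simp: hom_def Pi_def)

text \<open>For finite index this says that the quotient is a group, but it avoids quotients and
  identities and passes directly to intersections and inverse images.\<close>

definition cancellative :: "'a set \<Rightarrow> ('a list \<times> 'a list) set \<Rightarrow> bool" where
  "cancellative A \<theta> \<longleftrightarrow> (\<forall>u\<in>lists A - {[]}. \<forall>v\<in>lists A - {[]}. \<forall>w\<in>lists A - {[]}.
     ((u @ w, v @ w) \<in> \<theta> \<longrightarrow> (u, v) \<in> \<theta>) \<and> ((w @ u, w @ v) \<in> \<theta> \<longrightarrow> (u, v) \<in> \<theta>))"

lemma pro_congruences_fin_semigroup:
  "pro_congruences fin_semigroup A =
    {\<theta>. is_congruence (free_semigroup A) \<theta> \<and> finite ((lists A - {[]}) // \<theta>)}"
  unfolding pro_congruences_def fin_semigroup_def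
  using quotient_is_semigroup[OF is_semigroup_free_semigroup]
  by (auto simp: quotient_semigroup_def)

text \<open>In a finite cancellative semigroup the translations are injective, hence surjective, so
  all equations are solvable. \<open>A\<close> must be nonempty, since the empty semigroup is
  cancellative but not a group.\<close>

lemma fin_group_quotient_iff:
  assumes A: "A \<noteq> {}" and \<theta>: "is_congruence (free_semigroup A) \<theta>"
  shows "fin_group (quotient_semigroup (free_semigroup A) \<theta>) \<longleftrightarrow>
    finite ((lists A - {[]}) // \<theta>) \<and> cancellative A \<theta>"
proof -
  let ?W = "lists A - {[]}"
  let ?Q = "quotient_semigroup (free_semigroup A) \<theta>"
  have carr: "carrier ?Q = ?W // \<theta>" by (simp add: quotient_semigroup_def)
  have ceq: "\<theta> `` {x} = \<theta> `` {y} \<longleftrightarrow> (x, y) \<in> \<theta>" if "x \<in> ?W" "y \<in> ?W" for x y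
    using congruence_class_eq[OF \<theta>] that by simp
  have mult: "\<theta> `` {x} \<otimes>\<^bsub>?Q\<^esub> \<theta> `` {y} = \<theta> `` {x @ y}" if "x \<in> ?W" "y \<in> ?W" for x y
    using quotient_mult[OF \<theta>] that by simp
  have app: "x @ y \<in> ?W" if "x \<in> ?W" "y \<in> ?W" for x y using that by auto
  have semi: "is_semigroup ?Q" by (rule quotient_is_semigroup[OF is_semigroup_free_semigroup \<theta>])
  have "cancellative A \<theta>" if grp: "is_group ?Q"
  proof -
    obtain e where e: "group (?Q\<lparr>one := e\<rparr>)" using grp by (auto simp: is_group_def)
    have lc: "x = y" if "z \<otimes>\<^bsub>?Q\<^esub> x = z \<otimes>\<^bsub>?Q\<^esub> y" "x \<in> ?W // \<theta>" "y \<in> ?W // \<theta>" "z \<in> ?W // \<theta>" for x y z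
      using monoid.Units_l_cancel[OF group.is_monoid[OF e], of z x y] that
      by (simp add: carr group.Units_eq[OF e])
    have rc: "x = y" if "x \<otimes>\<^bsub>?Q\<^esub> z = y \<otimes>\<^bsub>?Q\<^esub> z" "x \<in> ?W // \<theta>" "y \<in> ?W // \<theta>" "z \<in> ?W // \<theta>" for x y z
      using group.right_cancel[OF e, of z x y] that by (simp add: carr)
    show ?thesis unfolding cancellative_def
    proof (intro ballI conjI impI)
      fix u v w assume W: "u \<in> ?W" "v \<in> ?W" "w \<in> ?W"
      have q: "\<theta> `` {u} \<in> ?W // \<theta>" "\<theta> `` {v} \<in> ?W // \<theta>" "\<theta> `` {w} \<in> ?W // \<theta>"
        using W by (simp_all only: quotientI)
      { assume "(u @ w, v @ w) \<in> \<theta>"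
        then have "\<theta> `` {u @ w} = \<theta> `` {v @ w}" using ceq[OF app[OF W(1,3)] app[OF W(2,3)]] by simp
        then have "\<theta> `` {u} = \<theta> `` {v}" using rc[OF _ q] mult W by simp
        then show "(u, v) \<in> \<theta>" using ceq[OF W(1,2)] by simp }
      { assume "(w @ u, w @ v) \<in> \<theta>"
        then have "\<theta> `` {w @ u} = \<theta> `` {w @ v}" using ceq[OF app[OF W(3,1)] app[OF W(3,2)]] by simp
        then have "\<theta> `` {u} = \<theta> `` {v}" using lc[OF _ q] mult W by simp
        then show "(u, v) \<in> \<theta>" using ceq[OF W(1,2)] by simp }
    qed
  qed
  moreover have "is_group ?Q" if fin: "finite (?W // \<theta>)" and c: "cancellative A \<theta>"
  proof (rule is_groupI[OF semi])
    obtain a where "a \<in> A" using A by blast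
    then have "[a] \<in> ?W" by simp
    then have "\<theta> `` {[a]} \<in> ?W // \<theta>" by (rule quotientI)
    then show "carrier ?Q \<noteq> {}" unfolding carr by (metis empty_iff)
    fix x y assume xy: "x \<in> carrier ?Q" "y \<in> carrier ?Q"
    obtain w where w: "w \<in> ?W" "x = \<theta> `` {w}" using xy(1) unfolding carr by (rule quotientE)
    have cl: "x \<otimes>\<^bsub>?Q\<^esub> z \<in> carrier ?Q" "z \<otimes>\<^bsub>?Q\<^esub> x \<in> carrier ?Q" if "z \<in> carrier ?Q" for z
      using semi xy(1) that by (auto simp: is_semigroup_def)
    have "inj_on (\<lambda>z. x \<otimes>\<^bsub>?Q\<^esub> z) (carrier ?Q)"
    proof (rule inj_onI)
      fix p q assume pq: "p \<in> carrier ?Q" "q \<in> carrier ?Q" "x \<otimes>\<^bsub>?Q\<^esub> p = x \<otimes>\<^bsub>?Q\<^esub> q"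
      obtain u where u: "u \<in> ?W" "p = \<theta> `` {u}" using pq(1) unfolding carr by (rule quotientE)
      obtain v where v: "v \<in> ?W" "q = \<theta> `` {v}" using pq(2) unfolding carr by (rule quotientE)
      have "\<theta> `` {w @ u} = \<theta> `` {w @ v}"
        using pq(3) unfolding w(2) u(2) v(2) by (simp only: mult[OF w(1) u(1)] mult[OF w(1) v(1)])
      then have "(w @ u, w @ v) \<in> \<theta>" using ceq[OF app[OF w(1) u(1)] app[OF w(1) v(1)]] by (rule iffD1[rotated])
      then have "(u, v) \<in> \<theta>" using c w(1) u(1) v(1) unfolding cancellative_def by blast
      then show "p = q" unfolding u(2) v(2) using ceq[OF u(1) v(1)] by (rule iffD2[rotated])
    qed
    then have "(\<lambda>z. x \<otimes>\<^bsub>?Q\<^esub> z) ` carrier ?Q = carrier ?Q"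
      using fin cl by (intro endo_inj_surj) (auto simp: carr)
    then show "\<exists>z\<in>carrier ?Q. x \<otimes>\<^bsub>?Q\<^esub> z = y" using xy(2) by (metis (no_types, lifting) imageE)
    have "inj_on (\<lambda>z. z \<otimes>\<^bsub>?Q\<^esub> x) (carrier ?Q)"
    proof (rule inj_onI)
      fix p q assume pq: "p \<in> carrier ?Q" "q \<in> carrier ?Q" "p \<otimes>\<^bsub>?Q\<^esub> x = q \<otimes>\<^bsub>?Q\<^esub> x"
      obtain u where u: "u \<in> ?W" "p = \<theta> `` {u}" using pq(1) unfolding carr by (rule quotientE)
      obtain v where v: "v \<in> ?W" "q = \<theta> `` {v}" using pq(2) unfolding carr by (rule quotientE)
      have "\<theta> `` {u @ w} = \<theta> `` {v @ w}"
        using pq(3) unfolding w(2) u(2) v(2) by (simp only: mult[OF u(1) w(1)] mult[OF v(1) w(1)])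
      then have "(u @ w, v @ w) \<in> \<theta>" using ceq[OF app[OF u(1) w(1)] app[OF v(1) w(1)]] by (rule iffD1[rotated])
      then have "(u, v) \<in> \<theta>" using c w(1) u(1) v(1) unfolding cancellative_def by blast
      then show "p = q" unfolding u(2) v(2) using ceq[OF u(1) v(1)] by (rule iffD2[rotated])
    qed
    then have "(\<lambda>z. z \<otimes>\<^bsub>?Q\<^esub> x) ` carrier ?Q = carrier ?Q"
      using fin cl by (intro endo_inj_surj) (auto simp: carr)
    then show "\<exists>z\<in>carrier ?Q. z \<otimes>\<^bsub>?Q\<^esub> x = y" using xy(2) by (metis (no_types, lifting) imageE)
  qed
  ultimately show ?thesis by (auto simp: fin_group_def carr)
qed

lemma pro_congruences_fin_group:
  "A \<noteq> {} \<Longrightarrow> pro_congruences fin_group A = {\<theta> \<in> pro_congruences fin_semigroup A. cancellative A \<theta>}"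
  unfolding pro_congruences_fin_semigroup
  using fin_group_quotient_iff[of A] by (auto simp: pro_congruences_def)

definition pullback :: "'a set \<Rightarrow> ('a list \<Rightarrow> 'a list) \<Rightarrow> ('a list \<times> 'a list) set \<Rightarrow> ('a list \<times> 'a list) set" where
  "pullback A f \<theta> = {(u, v). u \<in> lists A - {[]} \<and> v \<in> lists A - {[]} \<and> (f u, f v) \<in> \<theta>}"

lemma congruence_free_semigroupI:
  assumes "\<And>u v. (u, v) \<in> \<theta> \<Longrightarrow> u \<in> lists A - {[]} \<and> v \<in> lists A - {[]}"
    and "\<And>u. u \<in> lists A - {[]} \<Longrightarrow> (u, u) \<in> \<theta>"
    and "\<And>u v. (u, v) \<in> \<theta> \<Longrightarrow> (v, u) \<in> \<theta>"
    and "\<And>u v w. (u, v) \<in> \<theta> \<Longrightarrow> (v, w) \<in> \<theta> \<Longrightarrow> (u, w) \<in> \<theta>"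
    and "\<And>u u' v v'. (u, u') \<in> \<theta> \<Longrightarrow> (v, v') \<in> \<theta> \<Longrightarrow> (u @ v, u' @ v') \<in> \<theta>"
  shows "is_congruence (free_semigroup A) \<theta>"
proof -
  have "equiv (lists A - {[]}) \<theta>"
  proof (rule equivI)
    show "\<theta> \<subseteq> (lists A - {[]}) \<times> (lists A - {[]})" using assms(1) by fast
    show "refl_on (lists A - {[]}) \<theta>" using assms(2) by (intro refl_onI)
    show "sym \<theta>" using assms(3) by (rule symI)
    show "trans \<theta>" using assms(4) by (rule transI)
  qed
  moreover have "\<forall>(u, u')\<in>\<theta>. \<forall>(v, v')\<in>\<theta>. (u @ v, u' @ v') \<in> \<theta>" using assms(5) by fast
  ultimately show ?thesis by (simp only: is_congruence_def carrier_free_semigroup mult_free_semigroup)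
qed

text \<open>The common pattern for finite index: a map with finitely many values whose kernel
  refines the relation.\<close>

lemma finite_quotient_if_kernel:
  assumes "finite (g ` W)" and "\<And>u v. u \<in> W \<Longrightarrow> v \<in> W \<Longrightarrow> g u = g v \<Longrightarrow> (u, v) \<in> \<theta>" and "equiv W \<theta>"
  shows "finite (W // \<theta>)"
proof -
  define s where "s y = \<theta> `` {SOME u. u \<in> W \<and> g u = y}" for y
  have "W // \<theta> \<subseteq> s ` g ` W"
  proof
    fix c assume "c \<in> W // \<theta>"
    then obtain u where u: "u \<in> W" "c = \<theta> `` {u}" by (rule quotientE)
    let ?v = "SOME v. v \<in> W \<and> g v = g u"
    have "?v \<in> W \<and> g ?v = g u" by (rule someI[of _ u]) (use u in simp)
    then have "(u, ?v) \<in> \<theta>" using assms(2) u(1) by simp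
    then have "c = s (g u)" unfolding s_def u(2) by (rule equiv_class_eq[OF assms(3)])
    then show "c \<in> s ` g ` W" using u(1) by blast
  qed
  then show ?thesis using assms(1) finite_surj finite_imageI finite_subset by metis
qed

lemma pullback_in_pro_congruences:
  assumes \<theta>: "\<theta> \<in> pro_congruences fin_semigroup A" and f: "f \<in> hom (free_semigroup A) (free_semigroup A)"
  shows "pullback A f \<theta> \<in> pro_congruences fin_semigroup A"
proof -
  let ?W = "lists A - {[]}"
  have c: "is_congruence (free_semigroup A) \<theta>" and fin: "finite (?W // \<theta>)"
    using \<theta> by (auto simp: pro_congruences_fin_semigroup)
  have fW: "f u \<in> ?W" if "u \<in> ?W" for u using f that by (simp add: hom_free_semigroup)
  have fm: "f (u @ v) = f u @ f v" if "u \<in> ?W" "v \<in> ?W" for u v using f that by (simp add: hom_free_semigroup)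
  have cong: "is_congruence (free_semigroup A) (pullback A f \<theta>)"
  proof (rule congruence_free_semigroupI)
    fix u assume "u \<in> ?W"
    then show "(u, u) \<in> pullback A f \<theta>" using fW congruence_refl[OF c, of "f u"] by (simp add: pullback_def)
  next
    fix u u' v v' assume "(u, u') \<in> pullback A f \<theta>" "(v, v') \<in> pullback A f \<theta>"
    then show "(u @ v, u' @ v') \<in> pullback A f \<theta>"
      using congruence_mult[OF c, of "f u" "f u'" "f v" "f v'"] fm by (auto simp: pullback_def)
  qed (auto simp: pullback_def intro: congruence_sym[OF c] congruence_trans[OF c])
  have "finite (?W // pullback A f \<theta>)"
  proof (rule finite_quotient_if_kernel)
    have "(\<lambda>u. \<theta> `` {f u}) ` ?W \<subseteq> ?W // \<theta>" by (intro image_subsetI quotientI fW)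
    then show "finite ((\<lambda>u. \<theta> `` {f u}) ` ?W)" using fin finite_subset by blast
    show "equiv ?W (pullback A f \<theta>)" using cong by (simp add: is_congruence_def)
    fix u v assume "u \<in> ?W" "v \<in> ?W" "\<theta> `` {f u} = \<theta> `` {f v}"
    then show "(u, v) \<in> pullback A f \<theta>"
      using congruence_class_eq[OF c, of "f u" "f v"] fW by (simp add: pullback_def)
  qed
  then show ?thesis using cong by (simp add: pro_congruences_fin_semigroup)
qed

lemma pullback_cancellative:
  assumes "cancellative A \<theta>" and f: "f \<in> hom (free_semigroup A) (free_semigroup A)"
  shows "cancellative A (pullback A f \<theta>)"
  unfolding cancellative_def
proof (intro ballI)
  let ?W = "lists A - {[]}"
  fix u v w assume W: "u \<in> ?W" "v \<in> ?W" "w \<in> ?W"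
  have fW: "f u \<in> ?W" "f v \<in> ?W" "f w \<in> ?W" using f W by (simp_all add: hom_free_semigroup)
  have fm: "f (x @ y) = f x @ f y" if "x \<in> ?W" "y \<in> ?W" for x y using f that by (simp add: hom_free_semigroup)
  show "((u @ w, v @ w) \<in> pullback A f \<theta> \<longrightarrow> (u, v) \<in> pullback A f \<theta>) \<and>
      ((w @ u, w @ v) \<in> pullback A f \<theta> \<longrightarrow> (u, v) \<in> pullback A f \<theta>)"
  proof -
    have pb: "(x, y) \<in> pullback A f \<theta> \<longleftrightarrow> (f x, f y) \<in> \<theta>" if "x \<in> ?W" "y \<in> ?W" for x y
      using that by (simp add: pullback_def)
    have app: "x @ y \<in> ?W" if "x \<in> ?W" "y \<in> ?W" for x y using that by auto
    have "((f u @ f w, f v @ f w) \<in> \<theta> \<longrightarrow> (f u, f v) \<in> \<theta>) \<and>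
        ((f w @ f u, f w @ f v) \<in> \<theta> \<longrightarrow> (f u, f v) \<in> \<theta>)"
      using assms(1) fW unfolding cancellative_def by blast
    then show ?thesis
      by (simp only: pb[OF app[OF W(1,3)] app[OF W(2,3)]] pb[OF app[OF W(3,1)] app[OF W(3,2)]]
          pb[OF W(1,2)] fm[OF W(1,3)] fm[OF W(2,3)] fm[OF W(3,1)] fm[OF W(3,2)])
  qed
qed

lemma inter_in_pro_congruences:
  assumes "\<theta> \<in> pro_congruences fin_semigroup A" "\<rho> \<in> pro_congruences fin_semigroup A"
  shows "\<theta> \<inter> \<rho> \<in> pro_congruences fin_semigroup A"
proof -
  let ?W = "lists A - {[]}"
  have c: "is_congruence (free_semigroup A) \<theta>" "is_congruence (free_semigroup A) \<rho>"
    and fin: "finite (?W // \<theta>)" "finite (?W // \<rho>)"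
    using assms by (auto simp: pro_congruences_fin_semigroup)
  have cong: "is_congruence (free_semigroup A) (\<theta> \<inter> \<rho>)"
  proof (rule congruence_free_semigroupI)
    fix u u' v v' assume "(u, u') \<in> \<theta> \<inter> \<rho>" "(v, v') \<in> \<theta> \<inter> \<rho>"
    then show "(u @ v, u' @ v') \<in> \<theta> \<inter> \<rho>"
      using congruence_mult[OF c(1), of u u' v v'] congruence_mult[OF c(2), of u u' v v'] by simp
  next
    fix u v assume "(u, v) \<in> \<theta> \<inter> \<rho>"
    then show "u \<in> ?W \<and> v \<in> ?W" using congruence_in[OF c(1), of u v] by simp
  next
    fix u assume "u \<in> ?W"
    then show "(u, u) \<in> \<theta> \<inter> \<rho>" using congruence_refl[OF c(1), of u] congruence_refl[OF c(2), of u] by simp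
  next
    fix u v assume "(u, v) \<in> \<theta> \<inter> \<rho>"
    then show "(v, u) \<in> \<theta> \<inter> \<rho>" using congruence_sym[OF c(1), of u v] congruence_sym[OF c(2), of u v] by simp
  next
    fix u v w assume "(u, v) \<in> \<theta> \<inter> \<rho>" "(v, w) \<in> \<theta> \<inter> \<rho>"
    then show "(u, w) \<in> \<theta> \<inter> \<rho>"
      using congruence_trans[OF c(1), of u v w] congruence_trans[OF c(2), of u v w] by simp
  qed
  have "finite (?W // (\<theta> \<inter> \<rho>))"
  proof (rule finite_quotient_if_kernel)
    have "(\<lambda>u. (\<theta> `` {u}, \<rho> `` {u})) ` ?W \<subseteq> (?W // \<theta>) \<times> (?W // \<rho>)"
      by (intro image_subsetI SigmaI quotientI)
    then show "finite ((\<lambda>u. (\<theta> `` {u}, \<rho> `` {u})) ` ?W)" using fin finite_subset finite_cartesian_product by blast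
    show "equiv ?W (\<theta> \<inter> \<rho>)" using cong by (simp add: is_congruence_def)
    fix u v assume "u \<in> ?W" "v \<in> ?W" "(\<theta> `` {u}, \<rho> `` {u}) = (\<theta> `` {v}, \<rho> `` {v})"
    then show "(u, v) \<in> \<theta> \<inter> \<rho>"
      using congruence_class_eq[OF c(1), of u v] congruence_class_eq[OF c(2), of u v] by simp
  qed
  then show ?thesis using cong by (simp add: pro_congruences_fin_semigroup)
qed

lemma full_in_pro_congruences: "(lists A - {[]}) \<times> (lists A - {[]}) \<in> pro_congruences fin_semigroup A"
proof -
  let ?W = "lists A - {[]}"
  have "?W // (?W \<times> ?W) \<subseteq> {?W}"
  proof
    fix c assume "c \<in> ?W // (?W \<times> ?W)"
    then obtain w where "w \<in> ?W" "c = (?W \<times> ?W) `` {w}" by (rule quotientE)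
    then show "c \<in> {?W}" by blast
  qed
  then have "finite (?W // (?W \<times> ?W))" using finite_subset by blast
  moreover have "is_congruence (free_semigroup A) (?W \<times> ?W)"
    by (rule congruence_free_semigroupI) auto
  ultimately show ?thesis by (simp add: pro_congruences_fin_semigroup)
qed

section \<open>Free profinite semigroups\<close>

text \<open>Common setting for the free profinite semigroup and group. Intersections make the index
  set directed, \<open>full\<close> makes it nonempty, and inverse images let endomorphisms of the
  free semigroup act on the limit.\<close>

locale pro =
  fixes V :: "'a list set monoid \<Rightarrow> bool" and A :: "'a set"
  assumes fin_semigroup_congruence: "\<theta> \<in> pro_congruences V A \<Longrightarrow> \<theta> \<in> pro_congruences fin_semigroup A"
    and inter: "\<theta> \<in> pro_congruences V A \<Longrightarrow> \<rho> \<in> pro_congruences V A \<Longrightarrow> \<theta> \<inter> \<rho> \<in> pro_congruences V A"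
    and full: "(lists A - {[]}) \<times> (lists A - {[]}) \<in> pro_congruences V A"
    and pullback: "\<theta> \<in> pro_congruences V A \<Longrightarrow> f \<in> hom (free_semigroup A) (free_semigroup A) \<Longrightarrow>
      pullback A f \<theta> \<in> pro_congruences V A"
begin

abbreviation C :: "('a list \<times> 'a list) set set" where "C \<equiv> pro_congruences V A"
abbreviation \<Omega> :: "'a pro monoid" where "\<Omega> \<equiv> free_pro V A"
abbreviation Pro :: "'a pro set" where "Pro \<equiv> carrier \<Omega>"
abbreviation T :: "'a pro topology" where "T \<equiv> free_pro_topology V A"
abbreviation W :: "'a list set" where "W \<equiv> lists A - {[]}"
abbreviation word :: "'a list \<Rightarrow> 'a pro" where "word \<equiv> pro_word V A"
abbreviation mul :: "'a pro \<Rightarrow> 'a pro \<Rightarrow> 'a pro" (infixl "\<cdot>" 70) where "x \<cdot> y \<equiv> x \<otimes>\<^bsub>\<Omega>\<^esub> y"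

lemma cong: "\<theta> \<in> C \<Longrightarrow> is_congruence (free_semigroup A) \<theta>"
  by (simp add: pro_congruences_def)

lemma finite_quotient: "\<theta> \<in> C \<Longrightarrow> finite (W // \<theta>)"
  using fin_semigroup_congruence by (simp add: pro_congruences_fin_semigroup)

lemma equiv: "\<theta> \<in> C \<Longrightarrow> equiv W \<theta>"
  using cong by (simp add: is_congruence_def)

lemma append_W: "u \<in> W \<Longrightarrow> v \<in> W \<Longrightarrow> u @ v \<in> W"
  by auto

lemma carrier_iff: "x \<in> Pro \<longleftrightarrow> x \<in> extensional C \<and> (\<forall>\<theta>\<in>C. x \<theta> \<in> W // \<theta>) \<and>
    (\<forall>\<theta>\<in>C. \<forall>\<rho>\<in>C. \<theta> \<subseteq> \<rho> \<longrightarrow> x \<theta> \<subseteq> x \<rho>)"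
  by (auto simp: free_pro_def PiE_def)

lemma in_class:
  assumes "x \<in> Pro" "\<theta> \<in> C" "w \<in> x \<theta>"
  shows "w \<in> W" "x \<theta> = \<theta> `` {w}"
proof -
  have "x \<theta> \<in> W // \<theta>" using assms by (simp only: carrier_iff)
  then obtain u where u: "u \<in> W" "x \<theta> = \<theta> `` {u}" by (rule quotientE)
  then have "(u, w) \<in> \<theta>" using assms(3) by simp
  then show "w \<in> W" "x \<theta> = \<theta> `` {w}"
    using congruence_in[OF cong[OF assms(2)], of u w] equiv_class_eq[OF equiv[OF assms(2)], of u w] u
    by simp_all
qed

lemma rep: "x \<in> Pro \<Longrightarrow> \<theta> \<in> C \<Longrightarrow> \<exists>w. w \<in> x \<theta>"
proof -
  assume x: "x \<in> Pro" "\<theta> \<in> C"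
  then have "x \<theta> \<in> W // \<theta>" by (simp only: carrier_iff)
  then obtain u where "u \<in> W" "x \<theta> = \<theta> `` {u}" by (rule quotientE)
  then show ?thesis using congruence_refl[OF cong[OF x(2)], of u] by auto
qed

lemma class_eq: "\<theta> \<in> C \<Longrightarrow> u \<in> W \<Longrightarrow> v \<in> W \<Longrightarrow> \<theta> `` {u} = \<theta> `` {v} \<longleftrightarrow> (u, v) \<in> \<theta>"
  using congruence_class_eq[OF cong, of \<theta> u v] by simp

lemma mem_class_iff:
  "x \<in> Pro \<Longrightarrow> \<theta> \<in> C \<Longrightarrow> w \<in> x \<theta> \<Longrightarrow> v \<in> x \<theta> \<longleftrightarrow> (w, v) \<in> \<theta>"
  using in_class(2)[of x \<theta> w] by simp

lemma coord_eqI: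
  assumes "x \<in> Pro" "y \<in> Pro" "\<theta> \<in> C" "w \<in> x \<theta>" "w \<in> y \<theta>"
  shows "x \<theta> = y \<theta>"
  using in_class(2)[OF assms(1,3,4)] in_class(2)[OF assms(2,3,5)] by simp

lemma eqI:
  assumes "x \<in> Pro" "y \<in> Pro" "\<And>\<theta>. \<theta> \<in> C \<Longrightarrow> x \<theta> = y \<theta>"
  shows "x = y"
  using assms by (intro extensionalityI[of x C y]) (auto simp: carrier_iff)

lemma mono: "x \<in> Pro \<Longrightarrow> \<theta> \<in> C \<Longrightarrow> \<rho> \<in> C \<Longrightarrow> \<theta> \<subseteq> \<rho> \<Longrightarrow> x \<theta> \<subseteq> x \<rho>"
  by (simp only: carrier_iff)

lemma coord_eq_mono:
  assumes x: "x \<in> Pro" "y \<in> Pro" and "\<theta> \<in> C" "\<rho> \<in> C" "\<theta> \<subseteq> \<rho>" "x \<theta> = y \<theta>"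
  shows "x \<rho> = y \<rho>"
proof -
  obtain w where "w \<in> x \<theta>" using rep assms by blast
  then show ?thesis using coord_eqI[OF x assms(4)] mono assms by blast
qed

text \<open>A class is determined by any of its members, so a common representative of two
  comparable coordinates is enough for compatibility.\<close>

lemma carrierI:
  assumes "x \<in> extensional C" "\<And>\<theta>. \<theta> \<in> C \<Longrightarrow> \<exists>w\<in>W. x \<theta> = \<theta> `` {w}"
    and "\<And>\<theta> \<rho>. \<theta> \<in> C \<Longrightarrow> \<rho> \<in> C \<Longrightarrow> \<theta> \<subseteq> \<rho> \<Longrightarrow> \<exists>w. w \<in> W \<and> w \<in> x \<theta> \<and> w \<in> x \<rho>"
  shows "x \<in> Pro"
  unfolding carrier_iff
proof (intro conjI ballI impI)
  show "x \<in> extensional C" by fact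
  show q: "x \<theta> \<in> W // \<theta>" if "\<theta> \<in> C" for \<theta> using assms(2)[OF that] quotientI by metis
  fix \<theta> \<rho> assume t: "\<theta> \<in> C" "\<rho> \<in> C" "\<theta> \<subseteq> \<rho>"
  obtain w where w: "w \<in> W" "w \<in> x \<theta>" "w \<in> x \<rho>" using assms(3)[OF t] by blast
  have *: "x \<tau> = \<tau> `` {w}" if tau: "\<tau> \<in> C" "w \<in> x \<tau>" for \<tau>
  proof -
    obtain u where u: "u \<in> W" "x \<tau> = \<tau> `` {u}" using assms(2)[OF tau(1)] by blast
    then have "(u, w) \<in> \<tau>" using tau(2) by simp
    then show ?thesis using u equiv_class_eq[OF equiv[OF tau(1)], of u w] by simp
  qed
  show "x \<theta> \<subseteq> x \<rho>" using *[OF t(1) w(2)] *[OF t(2) w(3)] t(3) by auto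
qed

lemma word_coord: "\<theta> \<in> C \<Longrightarrow> word w \<theta> = \<theta> `` {w}"
  by (simp add: pro_word_def)

lemma word_rep: "\<theta> \<in> C \<Longrightarrow> w \<in> W \<Longrightarrow> w \<in> word w \<theta>"
  using congruence_refl[OF cong, of \<theta> w] by (simp add: word_coord)

lemma word_closed: "w \<in> W \<Longrightarrow> word w \<in> Pro"
proof (rule carrierI)
  assume w: "w \<in> W"
  show "word w \<in> extensional C" by (simp add: pro_word_def)
  show "\<exists>u\<in>W. word w \<theta> = \<theta> `` {u}" if "\<theta> \<in> C" for \<theta> using word_coord[OF that] w by blast
  show "\<exists>u. u \<in> W \<and> u \<in> word w \<theta> \<and> u \<in> word w \<rho>" if "\<theta> \<in> C" "\<rho> \<in> C" for \<theta> \<rho>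
    using word_rep w that by blast
qed

lemma mult_coord:
  assumes "x \<in> Pro" "y \<in> Pro" "\<theta> \<in> C" "u \<in> x \<theta>" "v \<in> y \<theta>"
  shows "(x \<cdot> y) \<theta> = \<theta> `` {u @ v}"
proof -
  have "u \<in> W" "v \<in> W" "x \<theta> = \<theta> `` {u}" "y \<theta> = \<theta> `` {v}" using in_class assms by blast+
  then show ?thesis
    using assms(3) quotient_mult[OF cong[OF assms(3)], of u v] by (simp add: free_pro_def)
qed

lemma mult_rep:
  assumes "x \<in> Pro" "y \<in> Pro" "\<theta> \<in> C" "u \<in> x \<theta>" "v \<in> y \<theta>"
  shows "u @ v \<in> (x \<cdot> y) \<theta>"
proof -
  have "u @ v \<in> W" using in_class(1) assms append_W by blast
  then show ?thesis
    using mult_coord[OF assms] congruence_refl[OF cong[OF assms(3)], of "u @ v"] by simp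
qed

lemma mult_closed: "x \<in> Pro \<Longrightarrow> y \<in> Pro \<Longrightarrow> x \<cdot> y \<in> Pro"
proof (rule carrierI)
  assume xy: "x \<in> Pro" "y \<in> Pro"
  show "x \<cdot> y \<in> extensional C" by (simp add: free_pro_def)
  show "\<exists>w\<in>W. (x \<cdot> y) \<theta> = \<theta> `` {w}" if t: "\<theta> \<in> C" for \<theta>
  proof -
    obtain u v where uv: "u \<in> x \<theta>" "v \<in> y \<theta>" using rep xy t by blast
    then have "u @ v \<in> W" using in_class(1) xy t append_W by blast
    then show ?thesis using mult_coord[OF xy t uv] by blast
  qed
  show "\<exists>w. w \<in> W \<and> w \<in> (x \<cdot> y) \<theta> \<and> w \<in> (x \<cdot> y) \<rho>" if t: "\<theta> \<in> C" "\<rho> \<in> C" "\<theta> \<subseteq> \<rho>" for \<theta> \<rho>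
  proof -
    obtain u v where uv: "u \<in> x \<theta>" "v \<in> y \<theta>" using rep xy t by blast
    have uv': "u \<in> x \<rho>" "v \<in> y \<rho>" using mono[OF xy(1) t] mono[OF xy(2) t] uv by auto
    have "u @ v \<in> W" using in_class(1)[OF xy(1) t(1) uv(1)] in_class(1)[OF xy(2) t(1) uv(2)] by (rule append_W)
    then show ?thesis using mult_rep[OF xy t(1) uv] mult_rep[OF xy t(2) uv'] by (intro exI conjI)
  qed
qed

lemma mult_assoc:
  assumes x: "x \<in> Pro" and y: "y \<in> Pro" and z: "z \<in> Pro"
  shows "x \<cdot> y \<cdot> z = x \<cdot> (y \<cdot> z)"
proof (rule eqI)
  fix \<theta> assume t: "\<theta> \<in> C"
  obtain u v w where uvw: "u \<in> x \<theta>" "v \<in> y \<theta>" "w \<in> z \<theta>"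
    using rep[OF x t] rep[OF y t] rep[OF z t] by blast
  have 1: "u @ v @ w \<in> (x \<cdot> y \<cdot> z) \<theta>"
    using mult_rep[OF mult_closed[OF x y] z t mult_rep[OF x y t uvw(1,2)] uvw(3)] by simp
  have 2: "u @ v @ w \<in> (x \<cdot> (y \<cdot> z)) \<theta>"
    by (rule mult_rep[OF x mult_closed[OF y z] t uvw(1) mult_rep[OF y z t uvw(2,3)]])
  show "(x \<cdot> y \<cdot> z) \<theta> = (x \<cdot> (y \<cdot> z)) \<theta>"
    by (rule coord_eqI[OF mult_closed[OF mult_closed[OF x y] z] mult_closed[OF x mult_closed[OF y z]] t 1 2])
qed (use x y z in \<open>auto intro: mult_closed\<close>)

lemma is_semigroup: "is_semigroup \<Omega>"
  unfolding is_semigroup_def using mult_closed mult_assoc by blast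

lemma mult_coord_cong:
  assumes "x \<in> Pro" "y \<in> Pro" "x' \<in> Pro" "y' \<in> Pro" "\<theta> \<in> C"
    "x \<theta> = x' \<theta>" "y \<theta> = y' \<theta>"
  shows "(x \<cdot> y) \<theta> = (x' \<cdot> y') \<theta>"
proof -
  obtain u v where uv: "u \<in> x \<theta>" "v \<in> y \<theta>" using rep assms(1,2,5) by blast
  then show ?thesis
    using mult_coord[OF assms(1,2,5) uv] mult_coord[OF assms(3,4,5), of u v] assms(6,7) by simp
qed

lemma word_mult: "u \<in> W \<Longrightarrow> v \<in> W \<Longrightarrow> word u \<cdot> word v = word (u @ v)"
  by (rule eqI) (auto intro!: mult_closed word_closed simp: word_coord mult_coord[OF word_closed word_closed _ word_rep word_rep])

lemma words_approximate: "x \<in> Pro \<Longrightarrow> \<theta> \<in> C \<Longrightarrow> \<exists>w\<in>W. word w \<theta> = x \<theta>"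
  using rep in_class word_coord by metis

lemma topspace: "topspace T = Pro"
  by (auto simp: free_pro_topology_def carrier_iff PiE_def)

lemma openin_cylinder:
  assumes t: "\<theta> \<in> C"
  shows "openin T {y \<in> Pro. y \<theta> = c}"
proof (cases "c \<in> W // \<theta>")
  case True
  let ?U = "\<lambda>\<rho>. if \<rho> = \<theta> then {c} else W // \<rho>"
  have "openin (product_topology (\<lambda>\<theta>. discrete_topology (W // \<theta>)) C) (PiE C ?U)"
  proof -
    have "finite {\<rho> \<in> C. ?U \<rho> \<noteq> W // \<rho>}" by (rule finite_subset[of _ "{\<theta>}"]) auto
    moreover have "?U \<rho> \<subseteq> W // \<rho>" if "\<rho> \<in> C" for \<rho> using True by simp
    ultimately show ?thesis by (subst openin_PiE_gen) auto
  qed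
  moreover have "{y \<in> Pro. y \<theta> = c} = PiE C ?U \<inter> Pro"
  proof (intro equalityI subsetI)
    fix y assume "y \<in> {y \<in> Pro. y \<theta> = c}"
    then have y: "y \<in> Pro" "y \<theta> = c" by simp_all
    have "y \<in> PiE C ?U"
    proof (rule PiE_I)
      fix \<rho> assume "\<rho> \<in> C"
      then show "y \<rho> \<in> ?U \<rho>" using y by (simp add: carrier_iff)
    next
      fix \<rho> assume "\<rho> \<notin> C"
      then show "y \<rho> = undefined" using y(1) by (simp add: carrier_iff extensional_def)
    qed
    then show "y \<in> PiE C ?U \<inter> Pro" using y(1) by (rule IntI)
  next
    fix y assume y: "y \<in> PiE C ?U \<inter> Pro"
    then have "y \<theta> \<in> ?U \<theta>" using PiE_mem[of y C ?U \<theta>] t by simp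
    then show "y \<in> {y \<in> Pro. y \<theta> = c}" using y by simp
  qed
  ultimately show ?thesis
    unfolding free_pro_topology_def openin_subtopology carrier_free_semigroup
    by (intro exI[of _ "PiE C ?U"] conjI)
next
  case False
  then have *: "{y \<in> Pro. y \<theta> = c} = {}" using t by (auto simp: carrier_iff)
  show ?thesis unfolding * by (rule openin_empty)
qed

lemma finite_inter:
  "finite F \<Longrightarrow> F \<subseteq> C \<Longrightarrow> \<exists>\<theta>\<in>C. \<forall>\<rho>\<in>F. \<theta> \<subseteq> \<rho>"
proof (induction F rule: finite_induct)
  case (insert \<rho> F)
  then obtain \<theta> where t: "\<theta> \<in> C" "\<forall>\<rho>\<in>F. \<theta> \<subseteq> \<rho>" by auto
  then have "\<theta> \<inter> \<rho> \<in> C" using insert.prems inter by auto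
  then show ?case using t(2) by (intro bexI[of _ "\<theta> \<inter> \<rho>"]) auto
qed (use full in auto)

text \<open>A basic open set of the product restricts finitely many coordinates; a congruence below
  all of them, which exists by directedness, controls them at once.\<close>

lemma openin_iff:
  "openin T U \<longleftrightarrow> U \<subseteq> Pro \<and> (\<forall>x\<in>U. \<exists>\<theta>\<in>C. \<forall>y\<in>Pro. y \<theta> = x \<theta> \<longrightarrow> y \<in> U)"
proof (intro iffI conjI ballI)
  assume U: "openin T U"
  then show sub: "U \<subseteq> Pro" using openin_subset topspace by blast
  fix x assume x: "x \<in> U"
  obtain S where S: "openin (product_topology (\<lambda>\<theta>. discrete_topology (W // \<theta>)) C) S" "U = S \<inter> Pro"
    using U unfolding free_pro_topology_def openin_subtopology by auto
  then obtain B where B: "finite {\<theta> \<in> C. B \<theta> \<noteq> W // \<theta>}" "x \<in> PiE C B" "PiE C B \<subseteq> S"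
    using x unfolding openin_product_topology_alt by auto
  obtain \<theta> where t: "\<theta> \<in> C" "\<forall>\<rho>\<in>{\<theta> \<in> C. B \<theta> \<noteq> W // \<theta>}. \<theta> \<subseteq> \<rho>" using finite_inter[OF B(1)] by blast
  have "y \<in> U" if y: "y \<in> Pro" "y \<theta> = x \<theta>" for y
  proof -
    have "y \<rho> \<in> B \<rho>" if r: "\<rho> \<in> C" for \<rho>
    proof (cases "B \<rho> = W // \<rho>")
      case True
      then show ?thesis using y r by (simp add: carrier_iff)
    next
      case False
      then have "y \<rho> = x \<rho>" using r t sub x y by (intro coord_eq_mono[of y x \<theta> \<rho>]) auto
      then show ?thesis using B(2) r by auto
    qed
    moreover have "y \<in> extensional C" using y by (simp add: carrier_iff)
    ultimately have "y \<in> PiE C B" by (simp add: PiE_def)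
    then show ?thesis using B(3) S(2) y(1) by blast
  qed
  then show "\<exists>\<theta>\<in>C. \<forall>y\<in>Pro. y \<theta> = x \<theta> \<longrightarrow> y \<in> U" using t(1) by blast
next
  assume U: "U \<subseteq> Pro \<and> (\<forall>x\<in>U. \<exists>\<theta>\<in>C. \<forall>y\<in>Pro. y \<theta> = x \<theta> \<longrightarrow> y \<in> U)"
  show "openin T U"
  proof (subst openin_subopen, rule ballI)
    fix x assume x: "x \<in> U"
    then obtain \<theta> where "\<theta> \<in> C" "\<forall>y\<in>Pro. y \<theta> = x \<theta> \<longrightarrow> y \<in> U" using U by blast
    then show "\<exists>S. openin T S \<and> x \<in> S \<and> S \<subseteq> U"
      using openin_cylinder[of \<theta> "x \<theta>"] x U
      by (intro exI[of _ "{y \<in> Pro. y \<theta> = x \<theta>}"]) blast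
  qed
qed

text \<open>Each compatibility condition involves only two coordinates, so the limit is closed in a
  product of finite discrete spaces.\<close>

lemma compact: "compact_space T"
proof -
  let ?P = "product_topology (\<lambda>\<theta>. discrete_topology (W // \<theta>)) C"
  have "compact_space ?P"
    by (simp add: compact_space_product_topology compact_space_discrete_topology finite_quotient)
  moreover have "openin ?P (topspace ?P - Pro)"
  proof (subst openin_subopen, rule ballI)
    fix x assume x: "x \<in> topspace ?P - Pro"
    then have xq: "x \<in> extensional C" "\<And>\<theta>. \<theta> \<in> C \<Longrightarrow> x \<theta> \<in> W // \<theta>" by (auto simp: PiE_def)
    have "x \<notin> Pro" using x by simp
    then have "\<not> (\<forall>\<theta>\<in>C. \<forall>\<rho>\<in>C. \<theta> \<subseteq> \<rho> \<longrightarrow> x \<theta> \<subseteq> x \<rho>)" using xq by (simp add: carrier_iff)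
    then obtain \<theta> \<rho> where t: "\<theta> \<in> C" "\<rho> \<in> C" "\<theta> \<subseteq> \<rho>" "\<not> x \<theta> \<subseteq> x \<rho>" by blast
    let ?U = "\<lambda>\<tau>. if \<tau> \<in> {\<theta>, \<rho>} then {x \<tau>} else W // \<tau>"
    have "openin ?P (PiE C ?U)"
    proof -
      have "finite {\<tau> \<in> C. ?U \<tau> \<noteq> W // \<tau>}" by (rule finite_subset[of _ "{\<theta>, \<rho>}"]) auto
      moreover have "?U \<tau> \<subseteq> W // \<tau>" if "\<tau> \<in> C" for \<tau> using xq that by simp
      ultimately show ?thesis by (subst openin_PiE_gen) auto
    qed
    moreover have "x \<in> PiE C ?U" using xq by (auto simp: PiE_def)
    moreover have "PiE C ?U \<subseteq> topspace ?P - Pro"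
    proof
      fix y assume y: "y \<in> PiE C ?U"
      have yU: "y \<tau> \<in> ?U \<tau>" if "\<tau> \<in> C" for \<tau> using y that by (rule PiE_mem)
      have "y \<theta> = x \<theta>" "y \<rho> = x \<rho>" using yU[OF t(1)] yU[OF t(2)] by auto
      then have "y \<notin> Pro" using t unfolding carrier_iff by blast
      moreover have "y \<tau> \<in> W // \<tau>" if "\<tau> \<in> C" for \<tau> using yU[OF that] xq(2)[OF that] by (auto split: if_splits)
      then have "y \<in> topspace ?P" using y by (auto simp: PiE_def)
      ultimately show "y \<in> topspace ?P - Pro" by blast
    qed
    ultimately show "\<exists>S. openin ?P S \<and> x \<in> S \<and> S \<subseteq> topspace ?P - Pro" by blast
  qed
  moreover have "Pro \<subseteq> topspace ?P" by (auto simp: carrier_iff PiE_def)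
  ultimately have "compactin ?P (Pro)" by (intro closedin_compact_space) (simp_all add: closedin_def)
  then show ?thesis unfolding free_pro_topology_def by (simp add: compact_space_subtopology)
qed

lemma Hausdorff: "Hausdorff_space T"
  unfolding free_pro_topology_def
  by (intro Hausdorff_space_subtopology) (simp add: Hausdorff_space_product_topology)

lemma in_closure_iff:
  assumes "B \<subseteq> Pro"
  shows "x \<in> T closure_of B \<longleftrightarrow> x \<in> Pro \<and> (\<forall>\<theta>\<in>C. \<exists>b\<in>B. b \<theta> = x \<theta>)"
proof
  assume x: "x \<in> T closure_of B"
  then have xc: "x \<in> Pro" using topspace by (auto simp: in_closure_of)
  moreover have "\<exists>b\<in>B. b \<theta> = x \<theta>" if t: "\<theta> \<in> C" for \<theta>
  proof -
    have "x \<in> {y \<in> Pro. y \<theta> = x \<theta>}" using xc by simp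
    moreover have "\<forall>U. x \<in> U \<and> openin T U \<longrightarrow> (\<exists>y. y \<in> B \<and> y \<in> U)"
      using x unfolding in_closure_of by (rule conjunct2)
    ultimately have "\<exists>b. b \<in> B \<and> b \<in> {y \<in> Pro. y \<theta> = x \<theta>}"
      using openin_cylinder[OF t, of "x \<theta>"] by (simp only: simp_thms)
    then show ?thesis by auto
  qed
  ultimately show "x \<in> Pro \<and> (\<forall>\<theta>\<in>C. \<exists>b\<in>B. b \<theta> = x \<theta>)" by blast
next
  assume x: "x \<in> Pro \<and> (\<forall>\<theta>\<in>C. \<exists>b\<in>B. b \<theta> = x \<theta>)"
  have "\<exists>y\<in>B. y \<in> U" if U: "x \<in> U" "openin T U" for U
  proof -
    obtain \<theta> where t: "\<theta> \<in> C" "\<forall>y\<in>Pro. y \<theta> = x \<theta> \<longrightarrow> y \<in> U" using U unfolding openin_iff by blast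
    then obtain b where "b \<in> B" "b \<theta> = x \<theta>" using x by blast
    then show ?thesis using t(2) assms by blast
  qed
  then show "x \<in> T closure_of B" unfolding in_closure_of topspace using x by blast
qed

lemma words_dense: "T closure_of (word ` W) = Pro"
proof (rule Set.set_eqI)
  fix x
  have sub: "word ` W \<subseteq> Pro" by (rule image_subsetI[OF word_closed])
  have "\<exists>b\<in>word ` W. b \<theta> = x \<theta>" if "x \<in> Pro" "\<theta> \<in> C" for \<theta>
    using words_approximate[OF that] by (simp only: bex_simps)
  then show "x \<in> T closure_of (word ` W) \<longleftrightarrow> x \<in> Pro"
    unfolding in_closure_iff[OF sub] by metis
qed

text \<open>The solution sets \<open>F \<theta>\<close> are closed, nonempty and shrink with
  \<theta> in a directed family, so they have a common point. Two unknowns cover equations of the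
  form \<open>x s y = e\<close>; an equation in one unknown ignores the second.\<close>

lemma compactness:
  assumes ex: "\<And>\<theta>. \<theta> \<in> C \<Longrightarrow> \<exists>x\<in>Pro. \<exists>y\<in>Pro. P \<theta> x y"
    and coord: "\<And>\<theta> x y x' y'. \<theta> \<in> C \<Longrightarrow> x \<in> Pro \<Longrightarrow> y \<in> Pro \<Longrightarrow> x' \<in> Pro \<Longrightarrow>
      y' \<in> Pro \<Longrightarrow> x \<theta> = x' \<theta> \<Longrightarrow> y \<theta> = y' \<theta> \<Longrightarrow> P \<theta> x y \<Longrightarrow> P \<theta> x' y'"
    and anti: "\<And>\<theta> \<rho> x y. \<theta> \<in> C \<Longrightarrow> \<rho> \<in> C \<Longrightarrow> \<theta> \<subseteq> \<rho> \<Longrightarrow> x \<in> Pro \<Longrightarrow> y \<in> Pro \<Longrightarrow>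
      P \<theta> x y \<Longrightarrow> P \<rho> x y"
  shows "\<exists>x\<in>Pro. \<exists>y\<in>Pro. \<forall>\<theta>\<in>C. P \<theta> x y"
proof -
  let ?TT = "prod_topology T T"
  define F where "F \<theta> = {(x, y). x \<in> Pro \<and> y \<in> Pro \<and> P \<theta> x y}" for \<theta>
  have top: "topspace ?TT = Pro \<times> Pro" by (simp add: topspace)
  have closed: "closedin ?TT (F \<theta>)" if t: "\<theta> \<in> C" for \<theta>
  proof -
    have "openin ?TT (topspace ?TT - F \<theta>)"
      unfolding openin_prod_topology_alt
    proof (intro allI impI)
      fix x y assume xy: "(x, y) \<in> topspace ?TT - F \<theta>"
      then have c: "x \<in> Pro" "y \<in> Pro" "\<not> P \<theta> x y"
        unfolding top F_def by simp_all
      let ?U = "{z \<in> Pro. z \<theta> = x \<theta>}" and ?V = "{z \<in> Pro. z \<theta> = y \<theta>}"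
      have "openin T ?U" "openin T ?V" "x \<in> ?U" "y \<in> ?V" using openin_cylinder[OF t] c by auto
      moreover have "?U \<times> ?V \<subseteq> topspace ?TT - F \<theta>"
      proof
        fix z assume "z \<in> ?U \<times> ?V"
        then obtain z1 z2 where z: "z = (z1, z2)" "z1 \<in> Pro" "z1 \<theta> = x \<theta>"
          "z2 \<in> Pro" "z2 \<theta> = y \<theta>" by auto
        have "\<not> P \<theta> z1 z2" using coord[OF t z(2,4) c(1,2) z(3,5)] c(3) by blast
        then show "z \<in> topspace ?TT - F \<theta>" using z unfolding top F_def by simp
      qed
      ultimately show "\<exists>U V. openin T U \<and> openin T V \<and> x \<in> U \<and> y \<in> V \<and> U \<times> V \<subseteq> topspace ?TT - F \<theta>"
        by blast
    qed
    moreover have "F \<theta> \<subseteq> topspace ?TT" unfolding top F_def by auto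
    ultimately show ?thesis by (simp add: closedin_def)
  qed
  have "compact_space ?TT" using compact by (simp add: compact_space_prod_topology)
  moreover have "\<forall>c\<in>F ` C. closedin ?TT c" using closed by blast
  moreover have "\<Inter> \<F> \<noteq> {}" if \<F>: "finite \<F>" "\<F> \<subseteq> F ` C" for \<F>
  proof -
    obtain G where G: "G \<subseteq> C" "finite G" "\<F> = F ` G" using finite_subset_image[OF \<F>] by blast
    obtain \<theta> where t: "\<theta> \<in> C" "\<forall>\<rho>\<in>G. \<theta> \<subseteq> \<rho>" using finite_inter[OF G(2,1)] by blast
    obtain x y where xy: "x \<in> Pro" "y \<in> Pro" "P \<theta> x y" using ex[OF t(1)] by blast
    have "(x, y) \<in> F \<rho>" if "\<rho> \<in> G" for \<rho>
    proof -
      have "P \<rho> x y" using G(1) that t(2) by (intro anti[OF t(1) _ _ xy]) auto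
      then show ?thesis using xy by (simp add: F_def)
    qed
    then show ?thesis unfolding G(3) by blast
  qed
  ultimately have "\<Inter> (F ` C) \<noteq> {}" unfolding compact_space_fip by (metis (no_types, lifting))
  then obtain x y where "\<forall>\<theta>\<in>C. (x, y) \<in> F \<theta>" by auto
  then show ?thesis using full unfolding F_def by blast
qed

end

lemma continuous_map_proI:
  assumes "pro V A" "pro V' A'" and g: "\<And>x. x \<in> carrier (free_pro V A) \<Longrightarrow> g x \<in> carrier (free_pro V' A')"
    and coord: "\<And>\<theta>. \<theta> \<in> pro_congruences V' A' \<Longrightarrow> \<exists>\<rho>\<in>pro_congruences V A.
      \<forall>x\<in>carrier (free_pro V A). \<forall>y\<in>carrier (free_pro V A). x \<rho> = y \<rho> \<longrightarrow> g x \<theta> = g y \<theta>"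
  shows "continuous_map (free_pro_topology V A) (free_pro_topology V' A') g"
proof -
  interpret P: pro V A by fact
  interpret Q: pro V' A' by fact
  have "openin P.T {x \<in> P.Pro. g x \<in> U}" if U: "openin Q.T U" for U
    unfolding P.openin_iff
  proof (intro conjI ballI)
    fix x assume "x \<in> {x \<in> P.Pro. g x \<in> U}"
    then have x: "x \<in> P.Pro" "g x \<in> U" by auto
    then obtain \<theta> where t: "\<theta> \<in> Q.C" "\<forall>y\<in>Q.Pro. y \<theta> = g x \<theta> \<longrightarrow> y \<in> U"
      using U unfolding Q.openin_iff by meson
    then obtain \<rho> where r: "\<rho> \<in> P.C" "\<forall>x\<in>P.Pro. \<forall>y\<in>P.Pro. x \<rho> = y \<rho> \<longrightarrow> g x \<theta> = g y \<theta>"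
      using coord[OF t(1)] by (elim bexE)
    have "y \<in> {x \<in> P.Pro. g x \<in> U}" if y: "y \<in> P.Pro" "y \<rho> = x \<rho>" for y
    proof -
      have "g y \<theta> = g x \<theta>" by (rule r(2)[rule_format, OF y(1) x(1) y(2)])
      then have "g y \<in> U" using t(2) g[OF y(1)] by simp
      then show ?thesis using y(1) by simp
    qed
    then show "\<exists>\<rho>\<in>P.C. \<forall>y\<in>P.Pro. y \<rho> = x \<rho> \<longrightarrow> y \<in> {x \<in> P.Pro. g x \<in> U}"
      using r(1) by (intro bexI[of _ \<rho>]) auto
  qed auto
  then show ?thesis unfolding continuous_map_def P.topspace Q.topspace using g by auto
qed

context pro
begin

text \<open>
  Continuous endomorphisms are defined coordinatewise from endomorphisms \<open>f \<theta>\<close> of the free semigroup.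
  These may depend on \<open>\<theta>\<close>, because the coordinates of \<open>\<phi>\<^sup>\<omega>\<close> are those of different powers of \<open>\<phi>\<close>.
\<close>

definition compatible :: "(('a list \<times> 'a list) set \<Rightarrow> 'a list \<Rightarrow> 'a list) \<Rightarrow> bool" where
  "compatible f \<longleftrightarrow> (\<forall>\<theta>\<in>C. f \<theta> \<in> hom (free_semigroup A) (free_semigroup A)) \<and>
    (\<forall>\<theta>\<in>C. \<forall>\<rho>\<in>C. \<theta> \<subseteq> \<rho> \<longrightarrow> (\<forall>u\<in>W. (f \<theta> u, f \<rho> u) \<in> \<rho>))"

text \<open>Coordinate \<theta> of the value needs only the coordinate of \<open>x\<close> at the
  inverse image of \<theta>, a class that \<open>f \<theta>\<close> maps into a single
  \<theta>-class.\<close>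

definition lift :: "(('a list \<times> 'a list) set \<Rightarrow> 'a list \<Rightarrow> 'a list) \<Rightarrow> 'a pro \<Rightarrow> 'a pro" where
  "lift f x = (\<lambda>\<theta>\<in>C. \<theta> `` (f \<theta> ` x (pullback A (f \<theta>) \<theta>)))"

lemma lift_coord: "\<theta> \<in> C \<Longrightarrow> lift f x \<theta> = \<theta> `` (f \<theta> ` x (pullback A (f \<theta>) \<theta>))"
  by (simp add: lift_def)

lemma compatible_hom: "compatible f \<Longrightarrow> \<theta> \<in> C \<Longrightarrow> f \<theta> \<in> hom (free_semigroup A) (free_semigroup A)"
  by (simp add: compatible_def)

lemma compatible_in: "compatible f \<Longrightarrow> \<theta> \<in> C \<Longrightarrow> u \<in> W \<Longrightarrow> f \<theta> u \<in> W"
  using compatible_hom[of f \<theta>] by (simp only: hom_free_semigroup)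

lemma compatible_append:
  "compatible f \<Longrightarrow> \<theta> \<in> C \<Longrightarrow> u \<in> W \<Longrightarrow> v \<in> W \<Longrightarrow> f \<theta> (u @ v) = f \<theta> u @ f \<theta> v"
  using compatible_hom[of f \<theta>] by (simp only: hom_free_semigroup)

lemma compatible_pullback: "compatible f \<Longrightarrow> \<theta> \<in> C \<Longrightarrow> pullback A (f \<theta>) \<theta> \<in> C"
  by (rule pullback[OF _ compatible_hom])

lemma lift_rep:
  assumes f: "compatible f" and x: "x \<in> Pro" and t: "\<theta> \<in> C" and u: "u \<in> x (pullback A (f \<theta>) \<theta>)"
  shows "lift f x \<theta> = \<theta> `` {f \<theta> u}"
proof -
  let ?\<rho> = "pullback A (f \<theta>) \<theta>"
  have r: "?\<rho> \<in> C" by (rule compatible_pullback[OF f t])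
  have "\<theta> `` {f \<theta> v} = \<theta> `` {f \<theta> u}" if "v \<in> x ?\<rho>" for v
  proof -
    have "(u, v) \<in> ?\<rho>" using mem_class_iff[OF x r u] that by simp
    then have "(f \<theta> u, f \<theta> v) \<in> \<theta>" by (simp add: pullback_def)
    then show ?thesis using equiv_class_eq[OF equiv[OF t]] by simp
  qed
  then have "\<theta> `` (f \<theta> ` x ?\<rho>) = \<theta> `` {f \<theta> u}" using u by blast
  then show ?thesis using t by (simp only: lift_coord)
qed

lemma lift_mem:
  assumes f: "compatible f" and x: "x \<in> Pro" and t: "\<theta> \<in> C" and u: "u \<in> x (pullback A (f \<theta>) \<theta>)"
  shows "f \<theta> u \<in> lift f x \<theta>"
proof -
  have "u \<in> W" by (rule in_class(1)[OF x compatible_pullback[OF f t] u])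
  then have "f \<theta> u \<in> W" by (rule compatible_in[OF f t])
  then show ?thesis using congruence_refl[OF cong[OF t], of "f \<theta> u"] by (simp add: lift_rep[OF assms])
qed

lemma lift_closed:
  assumes f: "compatible f" and x: "x \<in> Pro"
  shows "lift f x \<in> Pro"
proof (rule carrierI)
  show "lift f x \<in> extensional C" by (simp add: lift_def)
  fix \<theta> assume t: "\<theta> \<in> C"
  obtain u where u: "u \<in> x (pullback A (f \<theta>) \<theta>)" using rep[OF x compatible_pullback[OF f t]] by blast
  show "\<exists>w\<in>W. lift f x \<theta> = \<theta> `` {w}"
    by (rule bexI[of _ "f \<theta> u"],
        rule lift_rep[OF f x t u],
        rule compatible_in[OF f t in_class(1)[OF x compatible_pullback[OF f t] u]])
next
  fix \<theta> \<rho> assume t: "\<theta> \<in> C" "\<rho> \<in> C" "\<theta> \<subseteq> \<rho>"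
  let ?a = "pullback A (f \<theta>) \<theta>" and ?b = "pullback A (f \<rho>) \<rho>"
  have c: "?a \<in> C" "?b \<in> C" using compatible_pullback[OF f] t by simp_all
  \<comment> \<open>As \<open>f \<theta>\<close> and \<open>f \<rho>\<close> may differ, a word is
    taken that represents \<open>x\<close> modulo both inverse images.\<close>
  have ab: "?a \<inter> ?b \<in> C" by (rule inter[OF c])
  obtain u where u: "u \<in> x (?a \<inter> ?b)" using rep[OF x ab] by blast
  have ua: "u \<in> x ?a" "u \<in> x ?b" using mono[OF x ab c(1)] mono[OF x ab c(2)] u by auto
  have uW: "u \<in> W" by (rule in_class(1)[OF x ab u])
  have 1: "f \<theta> u \<in> lift f x \<theta>" by (rule lift_mem[OF f x t(1) ua(1)])
  have "(f \<theta> u, f \<rho> u) \<in> \<rho>" using f t uW unfolding compatible_def by blast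
  then have "f \<theta> u \<in> lift f x \<rho>"
    using lift_rep[OF f x t(2) ua(2)] congruence_sym[OF cong[OF t(2)]] by simp
  then show "\<exists>w. w \<in> W \<and> w \<in> lift f x \<theta> \<and> w \<in> lift f x \<rho>"
    using 1 compatible_in[OF f t(1) uW] by (intro exI[of _ "f \<theta> u"] conjI)
qed

lemma lift_mult:
  assumes f: "compatible f" and x: "x \<in> Pro" and y: "y \<in> Pro"
  shows "lift f (x \<cdot> y) = lift f x \<cdot> lift f y"
proof (rule eqI)
  show "lift f (x \<cdot> y) \<in> Pro" by (rule lift_closed[OF f mult_closed[OF x y]])
  show "lift f x \<cdot> lift f y \<in> Pro" by (rule mult_closed[OF lift_closed[OF f x] lift_closed[OF f y]])
  fix \<theta> assume t: "\<theta> \<in> C"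
  let ?\<rho> = "pullback A (f \<theta>) \<theta>"
  have r: "?\<rho> \<in> C" by (rule compatible_pullback[OF f t])
  obtain u v where uv: "u \<in> x ?\<rho>" "v \<in> y ?\<rho>" using rep[OF x r] rep[OF y r] by blast
  have W: "u \<in> W" "v \<in> W" by (rule in_class(1)[OF x r uv(1)], rule in_class(1)[OF y r uv(2)])
  have "lift f (x \<cdot> y) \<theta> = \<theta> `` {f \<theta> (u @ v)}"
    by (rule lift_rep[OF f mult_closed[OF x y] t mult_rep[OF x y r uv]])
  also have "\<dots> = \<theta> `` {f \<theta> u @ f \<theta> v}" by (simp only: compatible_append[OF f t W])
  also have "\<dots> = (lift f x \<cdot> lift f y) \<theta>"
    by (rule mult_coord[symmetric, OF lift_closed[OF f x] lift_closed[OF f y] t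
        lift_mem[OF f x t uv(1)] lift_mem[OF f y t uv(2)]])
  finally show "lift f (x \<cdot> y) \<theta> = (lift f x \<cdot> lift f y) \<theta>" .
qed

lemma lift_word:
  assumes f: "compatible f" and w: "w \<in> W" and t: "\<theta> \<in> C"
  shows "lift f (word w) \<theta> = \<theta> `` {f \<theta> w}"
  by (rule lift_rep[OF f word_closed[OF w] t word_rep[OF compatible_pullback[OF f t] w]])

lemma lift_hom: "compatible f \<Longrightarrow> lift f \<in> hom \<Omega> \<Omega>"
  by (simp add: hom_def lift_closed lift_mult)

lemma lift_continuous: "compatible f \<Longrightarrow> continuous_map T T (lift f)"
proof (rule continuous_map_proI[OF pro_axioms pro_axioms])
  assume f: "compatible f"
  show "lift f x \<in> Pro" if "x \<in> Pro" for x by (rule lift_closed[OF f that])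
  fix \<theta> assume t: "\<theta> \<in> C"
  show "\<exists>\<rho>\<in>C. \<forall>x\<in>Pro. \<forall>y\<in>Pro. x \<rho> = y \<rho> \<longrightarrow> lift f x \<theta> = lift f y \<theta>"
    by (rule bexI[OF _ compatible_pullback[OF f t]]) (simp add: lift_coord[OF t])
qed

lemma continuous_eqI:
  assumes "continuous_map T Y g" "continuous_map T Y h" "Hausdorff_space Y"
    and "\<And>w. w \<in> W \<Longrightarrow> g (word w) = h (word w)" and x: "x \<in> Pro"
  shows "g x = h x"
proof -
  have "x \<in> T closure_of (word ` W)" unfolding words_dense by (rule x)
  moreover have "\<And>y. y \<in> word ` W \<Longrightarrow> g y = h y" using assms(4) by (elim imageE) simp
  ultimately show ?thesis using forall_in_closure_of_eq[OF _ assms(3,1,2)] by (metis (no_types, lifting))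
qed

lemma hom_cong:
  assumes t: "\<theta> \<in> C" and f: "f \<in> hom (free_semigroup A) (free_semigroup A)"
    and g: "g \<in> hom (free_semigroup A) (free_semigroup A)"
    and a: "\<And>a. a \<in> A \<Longrightarrow> (f [a], g [a]) \<in> \<theta>" and u: "u \<in> W"
  shows "(f u, g u) \<in> \<theta>"
proof -
  have app: "h (v @ w) = h v @ h w" if "h \<in> hom (free_semigroup A) (free_semigroup A)" "v \<in> W" "w \<in> W" for h v w
    using that by (simp only: hom_free_semigroup)
  have "u \<noteq> []" "set u \<subseteq> A" using u by auto
  then show ?thesis
  proof (induction u rule: list_nonempty_induct)
    case (single x)
    then show ?case using a by simp
  next
    case (cons x xs)
    then have W: "[x] \<in> W" "xs \<in> W" "x \<in> A" "set xs \<subseteq> A" by auto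
    have "(f [x] @ f xs, g [x] @ g xs) \<in> \<theta>"
      using congruence_mult[OF cong[OF t] a[OF W(3)] cons.IH[OF W(4)]] by simp
    then show ?case using app[OF f W(1,2)] app[OF g W(1,2)] by simp
  qed
qed

end

section \<open>The idempotent power of an endomorphism\<close>

locale pro_endo = pro V A for V :: "'a list set monoid \<Rightarrow> bool" and A :: "'a set" +
  fixes \<phi> :: "'a list \<Rightarrow> 'a list"
  assumes finite_alphabet: "finite A" and phi_hom: "\<phi> \<in> hom (free_semigroup A) (free_semigroup A)"
begin

lemma power_in: "u \<in> W \<Longrightarrow> (\<phi> ^^ n) u \<in> W"
proof (induction n)
  case (Suc n)
  then show ?case using phi_hom by (simp only: hom_free_semigroup funpow.simps comp_apply)
qed (simp only: funpow.simps id_apply)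

lemma power_append: "u \<in> W \<Longrightarrow> v \<in> W \<Longrightarrow> (\<phi> ^^ n) (u @ v) = (\<phi> ^^ n) u @ (\<phi> ^^ n) v"
proof (induction n)
  case (Suc n)
  have "\<phi> ((\<phi> ^^ n) u @ (\<phi> ^^ n) v) = \<phi> ((\<phi> ^^ n) u) @ \<phi> ((\<phi> ^^ n) v)"
    using phi_hom power_in[OF Suc.prems(1), of n] power_in[OF Suc.prems(2), of n]
    by (simp only: hom_free_semigroup)
  then show ?case using Suc by (simp only: funpow.simps comp_apply)
qed (simp only: funpow.simps id_apply)

lemma power_hom: "\<phi> ^^ n \<in> hom (free_semigroup A) (free_semigroup A)"
  unfolding hom_free_semigroup using power_in power_append by (intro conjI ballI)

lemma power_compatible: "compatible (\<lambda>_. \<phi> ^^ n)"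
  unfolding compatible_def
proof (intro conjI ballI impI)
  fix \<rho> u assume "\<rho> \<in> C" "u \<in> W"
  then show "((\<phi> ^^ n) u, (\<phi> ^^ n) u) \<in> \<rho>"
    using power_in by (intro congruence_refl[OF cong]) (simp_all only: carrier_free_semigroup)
qed (rule power_hom)

definition E :: "nat \<Rightarrow> 'a pro \<Rightarrow> 'a pro" where "E n = lift (\<lambda>_. \<phi> ^^ n)"

lemmas E_closed = lift_closed[OF power_compatible, folded E_def]
  and E_mult = lift_mult[OF power_compatible, folded E_def]
  and E_continuous = lift_continuous[OF power_compatible, folded E_def]
  and E_rep = lift_rep[OF power_compatible, folded E_def]

lemma E_word: "w \<in> W \<Longrightarrow> E n (word w) = word ((\<phi> ^^ n) w)"
proof (rule eqI)
  assume w: "w \<in> W"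
  show "E n (word w) \<in> Pro" by (rule E_closed[OF word_closed[OF w]])
  show "word ((\<phi> ^^ n) w) \<in> Pro" by (rule word_closed[OF power_in[OF w]])
  fix \<theta> assume "\<theta> \<in> C"
  then show "E n (word w) \<theta> = word ((\<phi> ^^ n) w) \<theta>"
    unfolding E_def using lift_word[OF power_compatible w] by (simp only: word_coord)
qed

lemma E_E: "x \<in> Pro \<Longrightarrow> E m (E n x) = E (m + n) x"
proof (rule continuous_eqI[OF _ E_continuous Hausdorff])
  show "continuous_map T T (\<lambda>x. E m (E n x))"
    using continuous_map_compose[OF E_continuous E_continuous] by (simp only: comp_def)
  fix w assume w: "w \<in> W"
  show "E m (E n (word w)) = E (m + n) (word w)"
    by (simp only: E_word[OF w] E_word[OF power_in[OF w]] funpow_add comp_apply)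
qed

lemma E_0: "x \<in> Pro \<Longrightarrow> E 0 x = x"
proof (rule continuous_eqI[OF E_continuous _ Hausdorff])
  show "continuous_map T T (\<lambda>x. x)" by simp
  show "E 0 (word w) = word w" if "w \<in> W" for w
    using E_word[OF that, of 0] by (simp only: funpow.simps id_apply)
qed

text \<open>Modulo a congruence of finite index, \<open>\<phi> ^^ n\<close> is determined by the images of the letters, so it
  is eventually periodic in \<open>n\<close>, and constant along sufficiently large factorials.\<close>

lemma eventually_stable:
  assumes t: "\<theta> \<in> C"
  shows "\<exists>N. \<forall>n\<ge>N. \<forall>m\<ge>N. \<forall>u\<in>W. ((\<phi> ^^ fact n) u, (\<phi> ^^ fact m) u) \<in> \<theta> \<and>
    ((\<phi> ^^ (fact n + fact m)) u, (\<phi> ^^ fact m) u) \<in> \<theta>"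
proof -
  define c where "c n = (\<lambda>a\<in>A. \<theta> `` {(\<phi> ^^ n) [a]})" for n
  have letter: "(\<phi> ^^ n) [a] \<in> W" if "a \<in> A" for a n using that by (intro power_in) simp
  have "c n \<in> (\<Pi>\<^sub>E a\<in>A. W // \<theta>)" for n
    unfolding c_def by (intro restrict_PiE_iff[THEN iffD2] ballI quotientI letter)
  then have "range c \<subseteq> (\<Pi>\<^sub>E a\<in>A. W // \<theta>)" by (rule image_subsetI)
  moreover have "finite (\<Pi>\<^sub>E a\<in>A. W // \<theta>)" using finite_alphabet finite_quotient[OF t] by (intro finite_PiE)
  ultimately have "finite (range c)" by (rule finite_subset)
  then have "\<not> inj c" using finite_imageD[of c UNIV] by auto
  then obtain i j where "c i = c j" "i \<noteq> j" by (auto simp: inj_on_def)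
  then obtain i j where ij: "c i = c j" "i < j" by (metis nat_neq_iff)
  define p where "p = j - i"
  have p: "p > 0" "j = p + i" using ij by (auto simp: p_def)
  have period0: "((\<phi> ^^ j) u, (\<phi> ^^ i) u) \<in> \<theta>" if u: "u \<in> W" for u
  proof (rule hom_cong[OF t power_hom power_hom _ u])
    fix a assume a: "a \<in> A"
    have "\<theta> `` {(\<phi> ^^ j) [a]} = \<theta> `` {(\<phi> ^^ i) [a]}" using fun_cong[OF ij(1), of a] a by (simp add: c_def)
    then show "((\<phi> ^^ j) [a], (\<phi> ^^ i) [a]) \<in> \<theta>" using class_eq[OF t letter[OF a] letter[OF a]] by simp
  qed
  have period: "((\<phi> ^^ (s * p + n)) u, (\<phi> ^^ n) u) \<in> \<theta>" if n: "n \<ge> i" and u: "u \<in> W" for n s u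
  proof (induction s)
    case 0
    have "((\<phi> ^^ n) u, (\<phi> ^^ n) u) \<in> \<theta>"
      by (rule congruence_refl[OF cong[OF t]]) (simp only: carrier_free_semigroup power_in[OF u])
    then show ?case by simp
  next
    case (Suc s)
    define k where "k = s * p + n - i"
    have k: "s * p + n = i + k" "Suc s * p + n = j + k" using n p by (auto simp: k_def)
    have "((\<phi> ^^ (Suc s * p + n)) u, (\<phi> ^^ (s * p + n)) u) \<in> \<theta>"
      unfolding k using period0[OF power_in[OF u, of k]] by (simp only: funpow_add comp_apply)
    then show ?case using Suc.IH by (rule congruence_trans[OF cong[OF t]])
  qed
  \<comment> \<open>From \<open>i + p\<close> on, factorials lie beyond the preperiod
    \<open>i\<close> and are multiples of the period \<open>p\<close>.\<close>
  define N where "N = i + p"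
  have fact_ge: "i \<le> fact n" if "n \<ge> N" for n
    using that fact_ge_self[of n] by (simp add: N_def)
  have p_dvd: "p dvd fact n" if "n \<ge> N" for n using that p by (intro dvd_fact) (auto simp: N_def)
  \<comment> \<open>This clause expresses that the limit is idempotent modulo \<theta>; the other
    one is derived from it by exchanging \<open>n\<close> and \<open>m\<close>.\<close>
  have add: "((\<phi> ^^ (fact n + fact m)) u, (\<phi> ^^ fact m) u) \<in> \<theta>" if nm: "n \<ge> N" "m \<ge> N" "u \<in> W" for n m u
  proof -
    obtain s where "fact n = p * s" using p_dvd[OF nm(1)] by (elim dvdE)
    then show ?thesis using period[OF fact_ge[OF nm(2)] nm(3), of s] by (simp only: mult.commute)
  qed
  have "((\<phi> ^^ fact n) u, (\<phi> ^^ fact m) u) \<in> \<theta>" if "n \<ge> N" "m \<ge> N" "u \<in> W" for n m u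
  proof -
    have 1: "((\<phi> ^^ (fact m + fact n)) u, (\<phi> ^^ fact n) u) \<in> \<theta>" by (rule add[OF that(2,1,3)])
    have 2: "((\<phi> ^^ (fact m + fact n)) u, (\<phi> ^^ fact m) u) \<in> \<theta>"
      using add[OF that] by (simp only: add.commute)
    show ?thesis by (rule congruence_trans[OF cong[OF t] congruence_sym[OF cong[OF t] 1] 2])
  qed
  then show ?thesis using add by blast
qed

definition index :: "('a list \<times> 'a list) set \<Rightarrow> nat" where
  "index \<theta> = (SOME N. \<forall>n\<ge>N. \<forall>m\<ge>N. \<forall>u\<in>W. ((\<phi> ^^ fact n) u, (\<phi> ^^ fact m) u) \<in> \<theta> \<and>
    ((\<phi> ^^ (fact n + fact m)) u, (\<phi> ^^ fact m) u) \<in> \<theta>)"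

lemma index:
  assumes "\<theta> \<in> C" "n \<ge> index \<theta>" "m \<ge> index \<theta>" "u \<in> W"
  shows "((\<phi> ^^ fact n) u, (\<phi> ^^ fact m) u) \<in> \<theta>" "((\<phi> ^^ (fact n + fact m)) u, (\<phi> ^^ fact m) u) \<in> \<theta>"
proof -
  have "\<forall>n\<ge>index \<theta>. \<forall>m\<ge>index \<theta>. \<forall>u\<in>W. ((\<phi> ^^ fact n) u, (\<phi> ^^ fact m) u) \<in> \<theta> \<and>
    ((\<phi> ^^ (fact n + fact m)) u, (\<phi> ^^ fact m) u) \<in> \<theta>"
    unfolding index_def by (rule someI_ex[OF eventually_stable[OF assms(1)]])
  then show "((\<phi> ^^ fact n) u, (\<phi> ^^ fact m) u) \<in> \<theta>" "((\<phi> ^^ (fact n + fact m)) u, (\<phi> ^^ fact m) u) \<in> \<theta>"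
    using assms(2-4) by simp_all
qed

definition omega :: "'a pro \<Rightarrow> 'a pro" where "omega = lift (\<lambda>\<theta>. \<phi> ^^ fact (index \<theta>))"

lemma omega_compatible: "compatible (\<lambda>\<theta>. \<phi> ^^ fact (index \<theta>))"
  unfolding compatible_def
proof (intro conjI ballI impI)
  fix \<theta> \<rho> u assume t: "\<theta> \<in> C" "\<rho> \<in> C" "\<theta> \<subseteq> \<rho>" and u: "u \<in> W"
  let ?n = "max (index \<theta>) (index \<rho>)"
  have "((\<phi> ^^ fact (index \<theta>)) u, (\<phi> ^^ fact ?n) u) \<in> \<rho>"
    using index(1)[OF t(1) _ _ u, of "index \<theta>" ?n] t(3) by auto
  moreover have "((\<phi> ^^ fact ?n) u, (\<phi> ^^ fact (index \<rho>)) u) \<in> \<rho>"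
    using index(1)[OF t(2) _ _ u, of ?n "index \<rho>"] by simp
  ultimately show "((\<phi> ^^ fact (index \<theta>)) u, (\<phi> ^^ fact (index \<rho>)) u) \<in> \<rho>"
    by (rule congruence_trans[OF cong[OF t(2)]])
qed (rule power_hom)

lemmas omega_closed = lift_closed[OF omega_compatible, folded omega_def]
  and omega_mult = lift_mult[OF omega_compatible, folded omega_def]
  and omega_continuous = lift_continuous[OF omega_compatible, folded omega_def]

text \<open>The exponent may be chosen as large as desired; this freedom is what brings arbitrarily
  long iterates into play later.\<close>

lemma omega_coord:
  assumes x: "x \<in> Pro" and t: "\<theta> \<in> C" and n: "n \<ge> index \<theta>"
  shows "omega x \<theta> = E (fact n) x \<theta>"
proof -
  let ?a = "pullback A (\<phi> ^^ fact (index \<theta>)) \<theta>" and ?b = "pullback A (\<phi> ^^ fact n) \<theta>"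
  have c: "?a \<in> C" "?b \<in> C" by (rule pullback[OF t power_hom])+
  obtain u where u: "u \<in> x (?a \<inter> ?b)" using rep[OF x inter[OF c]] by blast
  have uW: "u \<in> W" by (rule in_class(1)[OF x inter[OF c] u])
  have ua: "u \<in> x ?a" "u \<in> x ?b"
    using mono[OF x inter[OF c] c(1)] mono[OF x inter[OF c] c(2)] u by auto
  have 1: "omega x \<theta> = \<theta> `` {(\<phi> ^^ fact (index \<theta>)) u}"
    unfolding omega_def by (rule lift_rep[OF omega_compatible x t ua(1)])
  have 2: "E (fact n) x \<theta> = \<theta> `` {(\<phi> ^^ fact n) u}" by (rule E_rep[OF x t ua(2)])
  show ?thesis unfolding 1 2
    by (rule equiv_class_eq[OF equiv[OF t] index(1)[OF t order_refl n uW]])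
qed

lemma E_coord_cong:
  "x \<in> Pro \<Longrightarrow> y \<in> Pro \<Longrightarrow> \<theta> \<in> C \<Longrightarrow> x (pullback A (\<phi> ^^ n) \<theta>) = y (pullback A (\<phi> ^^ n) \<theta>) \<Longrightarrow>
    E n x \<theta> = E n y \<theta>"
  by (simp only: E_def lift_coord)

text \<open>Modulo \<theta> the outer exponent is \<open>fact ?n\<close>, and the inner one, read at
  the inverse image of \<theta>, is \<open>fact ?m\<close>. Their sum is reduced to
  \<open>fact ?m\<close> by the second clause of \<open>index\<close>.\<close>

lemma omega_omega:
  assumes x: "x \<in> Pro"
  shows "omega (omega x) = omega x"
proof (rule eqI)
  show "omega (omega x) \<in> Pro" "omega x \<in> Pro" by (intro omega_closed x)+
  fix \<theta> assume t: "\<theta> \<in> C"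
  let ?n = "index \<theta>"
  let ?\<rho> = "pullback A (\<phi> ^^ fact ?n) \<theta>"
  have r: "?\<rho> \<in> C" by (rule pullback[OF t power_hom])
  let ?m = "max (index ?\<rho>) ?n"
  have "omega (omega x) \<theta> = E (fact ?n) (omega x) \<theta>" by (rule omega_coord[OF omega_closed[OF x] t order_refl])
  also have "\<dots> = E (fact ?n) (E (fact ?m) x) \<theta>"
    by (rule E_coord_cong[OF omega_closed[OF x] E_closed[OF x] t omega_coord[OF x r max.cobounded1]])
  also have "\<dots> = E (fact ?n + fact ?m) x \<theta>" by (simp only: E_E[OF x])
  also have "\<dots> = E (fact ?m) x \<theta>"
  proof -
    let ?a = "pullback A (\<phi> ^^ (fact ?n + fact ?m)) \<theta>" and ?b = "pullback A (\<phi> ^^ fact ?m) \<theta>"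
    have c: "?a \<in> C" "?b \<in> C" by (rule pullback[OF t power_hom])+
    obtain u where u: "u \<in> x (?a \<inter> ?b)" using rep[OF x inter[OF c]] by blast
    have uW: "u \<in> W" by (rule in_class(1)[OF x inter[OF c] u])
    have ua: "u \<in> x ?a" "u \<in> x ?b"
      using mono[OF x inter[OF c] c(1)] mono[OF x inter[OF c] c(2)] u by auto
    show ?thesis unfolding E_rep[OF x t ua(1)] E_rep[OF x t ua(2)]
      by (rule equiv_class_eq[OF equiv[OF t] index(2)[OF t order_refl max.cobounded2 uW]])
  qed
  also have "\<dots> = omega x \<theta>" by (rule omega_coord[OF x t max.cobounded2, symmetric])
  finally show "omega (omega x) \<theta> = omega x \<theta>" .
qed

lemma restrict_continuous: "continuous_map T T f \<Longrightarrow> continuous_map T T (restrict f (Pro))"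
  by (rule continuous_map_eq) (simp_all add: topspace)

lemma End_restrict:
  assumes "f \<in> hom \<Omega> \<Omega>" "continuous_map T T f"
  shows "restrict f (Pro) \<in> End \<Omega> T"
proof -
  have "restrict f (Pro) \<in> hom \<Omega> \<Omega>"
    using assms(1) mult_closed by (auto simp: hom_def)
  then show ?thesis using restrict_continuous[OF assms(2)] by (simp add: End_def)
qed

text \<open>Convergence in \<open>End_topology\<close> is pointwise, and by
  \<open>omega_coord\<close> every coordinate is eventually constant; uniqueness of the limit comes
  from the Hausdorff property. Agreement with \<open>E 1\<close> is asked on \<open>Pro\<close>
  only, since \<open>group_extension\<close> is \<open>undefined\<close> elsewhere.\<close>

lemma omega_power_eq:
  assumes \<Phi>: "\<And>x. x \<in> Pro \<Longrightarrow> \<Phi> x = E 1 x" and x: "x \<in> Pro"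
  shows "omega_power \<Omega> T \<Phi> x = omega x"
proof -
  have pow: "(\<Phi> ^^ n) x = E n x" if x: "x \<in> Pro" for n x
  proof (induction n)
    case 0
    then show ?case using E_0[OF x] by simp
  next
    case (Suc n)
    then have "(\<Phi> ^^ Suc n) x = E 1 (E n x)" using \<Phi>[OF E_closed[OF x]] by simp
    also have "\<dots> = E (Suc n) x" using E_E[OF x, of 1 n] by simp
    finally show ?case .
  qed
  let ?F = "\<lambda>n. restrict (\<Phi> ^^ fact n) (Pro)"
  let ?o = "restrict omega (Pro)"
  have F_eq: "?F n = restrict (E (fact n)) (Pro)" for n
    by (rule restrict_ext) (rule pow)
  have o_End: "?o \<in> End \<Omega> T"
    by (rule End_restrict[OF lift_hom[OF omega_compatible, folded omega_def] omega_continuous])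
  have F_End: "?F n \<in> End \<Omega> T" for n
    unfolding F_eq by (rule End_restrict[OF lift_hom[OF power_compatible, folded E_def] E_continuous])
  have pw: "limitin T (\<lambda>n. ?F n x) (?o x) sequentially" if x: "x \<in> Pro" for x
    unfolding limitin_def topspace
  proof (intro conjI allI impI)
    show "?o x \<in> Pro" using omega_closed[OF x] x by simp
    fix U assume U: "openin T U \<and> ?o x \<in> U"
    then obtain \<theta> where t: "\<theta> \<in> C" "\<forall>y\<in>Pro. y \<theta> = ?o x \<theta> \<longrightarrow> y \<in> U"
      unfolding openin_iff by meson
    have "?F n x \<in> U" if "n \<ge> index \<theta>" for n
    proof -
      have "?F n x = E (fact n) x" using x by (simp add: F_eq)
      then show ?thesis using t(2) omega_coord[OF x t(1) that] E_closed[OF x, of "fact n"] x by simp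
    qed
    then show "\<forall>\<^sub>F n in sequentially. ?F n x \<in> U" by (rule eventually_sequentiallyI)
  qed
  have lim: "limitin (End_topology \<Omega> T) ?F ?o sequentially"
    unfolding End_topology_def limitin_subtopology
  proof (intro conjI)
    show "?o \<in> End \<Omega> T" by (rule o_End)
    show "\<forall>\<^sub>F n in sequentially. ?F n \<in> End \<Omega> T" using F_End by simp
    show "limitin (product_topology (\<lambda>_. T) (Pro)) ?F ?o sequentially"
      unfolding limitin_componentwise
    proof (intro conjI ballI)
      show "?o \<in> extensional (Pro)" by simp
      show "\<forall>\<^sub>F n in sequentially. ?F n \<in> topspace (product_topology (\<lambda>_. T) (Pro))"
        unfolding F_eq using E_closed by (simp add: topspace)
    qed (rule pw)
  qed
  have haus: "Hausdorff_space (End_topology \<Omega> T)"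
    unfolding End_topology_def
    by (intro Hausdorff_space_subtopology) (simp add: Hausdorff_space_product_topology Hausdorff)
  have "omega_power \<Omega> T \<Phi> = ?o"
    unfolding omega_power_def
  proof (rule the_equality)
    fix \<Psi> assume "limitin (End_topology \<Omega> T) ?F \<Psi> sequentially"
    then show "\<Psi> = ?o" using limitin_Hausdorff_unique[OF _ lim _ haus] by simp
  qed (rule lim)
  then show ?thesis using x by simp
qed

text \<open>Existence is provided by \<open>E 1\<close>. For uniqueness, letters determine the
  values on words, and words are dense.\<close>

lemma endomorphism_extension:
  "(THE f. f \<in> End \<Omega> T \<and> (\<forall>a\<in>A. f (word [a]) = word (\<phi> [a]))) = restrict (E 1) (Pro)"
proof (rule the_equality)
  have e_End: "restrict (E 1) (Pro) \<in> End \<Omega> T"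
    by (rule End_restrict[OF lift_hom[OF power_compatible, folded E_def] E_continuous])
  have e_word: "restrict (E 1) (Pro) (word [a]) = word (\<phi> [a])" if "a \<in> A" for a
  proof -
    have a: "[a] \<in> W" using that by simp
    then show ?thesis using word_closed[OF a] E_word[OF a, of 1] by simp
  qed
  show "restrict (E 1) (Pro) \<in> End \<Omega> T \<and>
      (\<forall>a\<in>A. restrict (E 1) (Pro) (word [a]) = word (\<phi> [a]))"
    using e_End e_word by blast
  fix f assume f: "f \<in> End \<Omega> T \<and> (\<forall>a\<in>A. f (word [a]) = word (\<phi> [a]))"
  then have fhom: "f \<in> hom \<Omega> \<Omega>" and fext: "f \<in> extensional (Pro)" and fc: "continuous_map T T f"
    by (simp_all add: End_def)
  have f_word: "f (word w) = E 1 (word w)" if w: "w \<in> W" for w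
  proof -
    have "w \<noteq> []" "set w \<subseteq> A" using w by auto
    then show ?thesis
    proof (induction w rule: list_nonempty_induct)
      case (single a)
      then have a: "[a] \<in> W" "a \<in> A" by auto
      then show ?case using f E_word[OF a(1), of 1] by simp
    next
      case (cons a w)
      then have aw: "[a] \<in> W" "w \<in> W" "a \<in> A" "set w \<subseteq> A" by auto
      have "f (word ([a] @ w)) = f (word [a] \<cdot> word w)" by (simp only: word_mult[OF aw(1,2)])
      also have "\<dots> = f (word [a]) \<cdot> f (word w)" by (rule hom_mult[OF fhom word_closed[OF aw(1)] word_closed[OF aw(2)]])
      also have "\<dots> = E 1 (word [a]) \<cdot> E 1 (word w)"
        using f aw(3) E_word[OF aw(1), of 1] cons.IH[OF aw(4)] by simp
      also have "\<dots> = E 1 (word ([a] @ w))"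
        by (simp only: E_mult[OF word_closed[OF aw(1)] word_closed[OF aw(2)], symmetric] word_mult[OF aw(1,2)])
      finally show ?case by simp
    qed
  qed
  have "f x = E 1 x" if "x \<in> Pro" for x
    by (rule continuous_eqI[OF fc E_continuous Hausdorff f_word that])
  then show "f = restrict (E 1) (Pro)"
    using fext by (intro extensionalityI[of f "Pro"]) simp_all
qed

end

section \<open>Stability\<close>

context pro
begin

text \<open>The passage from finite quotients to the limit: products are coordinatewise, so
  \<open>compactness\<close> turns solutions modulo every congruence into one solution. The next two
  lemmas are one-sided versions.\<close>

lemma solve_two_sided:
  assumes s: "s \<in> Pro" and e: "e \<in> Pro"
    and ex: "\<And>\<theta>. \<theta> \<in> C \<Longrightarrow> \<exists>x\<in>Pro. \<exists>y\<in>Pro. (x \<cdot> s \<cdot> y) \<theta> = e \<theta>"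
  shows "\<exists>x\<in>Pro. \<exists>y\<in>Pro. x \<cdot> s \<cdot> y = e"
proof -
  have "\<exists>x\<in>Pro. \<exists>y\<in>Pro. \<forall>\<theta>\<in>C. (x \<cdot> s \<cdot> y) \<theta> = e \<theta>"
  proof (rule compactness[OF ex])
    fix \<theta> x y x' y'
    assume t: "\<theta> \<in> C" and c: "x \<in> Pro" "y \<in> Pro" "x' \<in> Pro" "y' \<in> Pro"
      and eq: "x \<theta> = x' \<theta>" "y \<theta> = y' \<theta>" and P: "(x \<cdot> s \<cdot> y) \<theta> = e \<theta>"
    have "(x \<cdot> s) \<theta> = (x' \<cdot> s) \<theta>" by (rule mult_coord_cong[OF c(1) s c(3) s t eq(1) refl])
    then have "(x \<cdot> s \<cdot> y) \<theta> = (x' \<cdot> s \<cdot> y') \<theta>"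
      by (rule mult_coord_cong[OF mult_closed[OF c(1) s] c(2) mult_closed[OF c(3) s] c(4) t _ eq(2)])
    then show "(x' \<cdot> s \<cdot> y') \<theta> = e \<theta>" using P by simp
  next
    fix \<theta> \<rho> x y assume t: "\<theta> \<in> C" "\<rho> \<in> C" "\<theta> \<subseteq> \<rho>" and c: "x \<in> Pro" "y \<in> Pro"
      and P: "(x \<cdot> s \<cdot> y) \<theta> = e \<theta>"
    show "(x \<cdot> s \<cdot> y) \<rho> = e \<rho>"
      by (rule coord_eq_mono[OF mult_closed[OF mult_closed[OF c(1) s] c(2)] e t P])
  qed
  then obtain x y where xy: "x \<in> Pro" "y \<in> Pro" "\<forall>\<theta>\<in>C. (x \<cdot> s \<cdot> y) \<theta> = e \<theta>" by (elim bexE)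
  have "x \<cdot> s \<cdot> y = e"
    by (rule eqI[OF mult_closed[OF mult_closed[OF xy(1) s] xy(2)] e]) (rule xy(3)[rule_format])
  then show ?thesis using xy(1,2) by (intro bexI)
qed

lemma solve_right:
  assumes s: "s \<in> Pro" and e: "e \<in> Pro"
    and ex: "\<And>\<theta>. \<theta> \<in> C \<Longrightarrow> \<exists>x\<in>Pro. (s \<cdot> x) \<theta> = e \<theta>"
  shows "\<exists>x\<in>Pro. s \<cdot> x = e"
proof -
  have "\<exists>x\<in>Pro. \<exists>y\<in>Pro. \<forall>\<theta>\<in>C. (s \<cdot> x) \<theta> = e \<theta>"
  proof (rule compactness)
    show "\<exists>x\<in>Pro. \<exists>y\<in>Pro. (s \<cdot> x) \<theta> = e \<theta>" if "\<theta> \<in> C" for \<theta> using ex[OF that] by auto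
    show "(s \<cdot> x') \<theta> = e \<theta>"
      if "\<theta> \<in> C" "x \<in> Pro" "y \<in> Pro" "x' \<in> Pro" "y' \<in> Pro" "x \<theta> = x' \<theta>" "y \<theta> = y' \<theta>"
        "(s \<cdot> x) \<theta> = e \<theta>" for \<theta> x y x' y'
      using mult_coord_cong[OF s that(2) s that(4,1) refl that(6)] that(8) by simp
    show "(s \<cdot> x) \<rho> = e \<rho>"
      if "\<theta> \<in> C" "\<rho> \<in> C" "\<theta> \<subseteq> \<rho>" "x \<in> Pro" "y \<in> Pro" "(s \<cdot> x) \<theta> = e \<theta>" for \<theta> \<rho> x y
      by (rule coord_eq_mono[OF mult_closed[OF s that(4)] e that(1-3,6)])
  qed
  then obtain x where x: "x \<in> Pro" "\<forall>\<theta>\<in>C. (s \<cdot> x) \<theta> = e \<theta>" by (elim bexE)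
  have "s \<cdot> x = e" by (rule eqI[OF mult_closed[OF s x(1)] e]) (rule x(2)[rule_format])
  then show ?thesis using x(1) by (intro bexI)
qed

lemma solve_left:
  assumes s: "s \<in> Pro" and e: "e \<in> Pro"
    and ex: "\<And>\<theta>. \<theta> \<in> C \<Longrightarrow> \<exists>x\<in>Pro. (x \<cdot> s) \<theta> = e \<theta>"
  shows "\<exists>x\<in>Pro. x \<cdot> s = e"
proof -
  have "\<exists>x\<in>Pro. \<exists>y\<in>Pro. \<forall>\<theta>\<in>C. (x \<cdot> s) \<theta> = e \<theta>"
  proof (rule compactness)
    show "\<exists>x\<in>Pro. \<exists>y\<in>Pro. (x \<cdot> s) \<theta> = e \<theta>" if "\<theta> \<in> C" for \<theta> using ex[OF that] by auto
    show "(x' \<cdot> s) \<theta> = e \<theta>"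
      if "\<theta> \<in> C" "x \<in> Pro" "y \<in> Pro" "x' \<in> Pro" "y' \<in> Pro" "x \<theta> = x' \<theta>" "y \<theta> = y' \<theta>"
        "(x \<cdot> s) \<theta> = e \<theta>" for \<theta> x y x' y'
      using mult_coord_cong[OF that(2) s that(4) s that(1,6) refl] that(8) by simp
    show "(x \<cdot> s) \<rho> = e \<rho>"
      if "\<theta> \<in> C" "\<rho> \<in> C" "\<theta> \<subseteq> \<rho>" "x \<in> Pro" "y \<in> Pro" "(x \<cdot> s) \<theta> = e \<theta>" for \<theta> \<rho> x y
      by (rule coord_eq_mono[OF mult_closed[OF that(4) s] e that(1-3,6)])
  qed
  then obtain x where x: "x \<in> Pro" "\<forall>\<theta>\<in>C. (x \<cdot> s) \<theta> = e \<theta>" by (elim bexE)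
  have "x \<cdot> s = e" by (rule eqI[OF mult_closed[OF x(1) s] e]) (rule x(2)[rule_format])
  then show ?thesis using x(1) by (intro bexI)
qed

abbreviation (input) wpow :: "'a list \<Rightarrow> nat \<Rightarrow> 'a list" where "wpow w n \<equiv> concat (replicate n w)"

lemma wpow_add: "wpow w (m + n) = wpow w m @ wpow w n"
  by (simp add: replicate_add)

lemma wpow_in: "w \<in> W \<Longrightarrow> wpow w (Suc n) \<in> W"
  by (induction n) auto

lemma wpow_periodic:
  assumes t: "\<theta> \<in> C" and w: "w \<in> W"
  shows "\<exists>i d. (wpow w (Suc i + Suc (Suc d)), wpow w (Suc i)) \<in> \<theta>"
proof -
  \<comment> \<open>Only odd exponents are compared, so exponents with equal classes are at least 2
    apart. One factor can then be split off the period with a nonempty word remaining.\<close>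
  define c where "c n = \<theta> `` {wpow w (Suc (2 * n))}" for n
  have "range c \<subseteq> W // \<theta>" unfolding c_def by (intro image_subsetI quotientI wpow_in w)
  then have "finite (range c)" using finite_quotient[OF t] by (rule finite_subset)
  then have "\<not> inj c" using finite_imageD[of c UNIV] by auto
  then obtain m n where "c m = c n" "m \<noteq> n" by (auto simp: inj_on_def)
  then obtain m n where mn: "c m = c n" "n < m" by (metis nat_neq_iff)
  have "(wpow w (Suc (2 * m)), wpow w (Suc (2 * n))) \<in> \<theta>"
    using mn(1) class_eq[OF t wpow_in[OF w] wpow_in[OF w]] unfolding c_def by (rule iffD1[rotated])
  moreover obtain d where d: "m = n + 1 + d" using mn(2) less_iff_Suc_add by auto
  have "Suc (2 * m) = Suc (2 * n) + Suc (Suc (2 * d))" unfolding d by simp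
  ultimately show ?thesis by metis
qed

lemma wpow_sandwich:
  assumes t: "\<theta> \<in> C" and W: "a \<in> W" "b \<in> W" "c \<in> W" and b: "(b, a @ b @ c) \<in> \<theta>"
  shows "(b, wpow a (Suc n) @ b @ wpow c (Suc n)) \<in> \<theta>"
proof (induction n)
  case (Suc n)
  have re: "(p, p) \<in> \<theta>" if "p \<in> W" for p using congruence_refl[OF cong[OF t], of p] that by simp
  have mu: "(p @ q, p' @ q') \<in> \<theta>" if "(p, p') \<in> \<theta>" "(q, q') \<in> \<theta>" for p q p' q'
    using congruence_mult[OF cong[OF t] that] by simp
  have "(wpow a (Suc n) @ b, wpow a (Suc n) @ a @ b @ c) \<in> \<theta>" by (rule mu[OF re[OF wpow_in[OF W(1)]] b])
  then have "((wpow a (Suc n) @ b) @ wpow c (Suc n), (wpow a (Suc n) @ a @ b @ c) @ wpow c (Suc n)) \<in> \<theta>"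
    by (rule mu[OF _ re[OF wpow_in[OF W(3)]]])
  moreover have "wpow a (Suc (Suc n)) = wpow a (Suc n) @ a" using wpow_add[of "Suc n" 1 a] by simp
  moreover have "wpow c (Suc (Suc n)) = c @ wpow c (Suc n)" by simp
  ultimately have "(wpow a (Suc n) @ b @ wpow c (Suc n), wpow a (Suc (Suc n)) @ b @ wpow c (Suc (Suc n))) \<in> \<theta>"
    by (simp only: append_assoc)
  then show ?case by (rule congruence_trans[OF cong[OF t] Suc.IH])
qed (use b in simp)

text \<open>In a finite quotient \<open>b = a b c\<close> gives \<open>b = a^n b c^n\<close> for all
  positive \<open>n\<close>. If \<open>c^(i + p) = c^i\<close>, then
  \<open>b = a^i b c^i = a^i b c^(i + p) = b c^p\<close>, so \<open>b\<close> is recovered from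
  \<open>b c\<close> with the factor \<open>c^(p - 1)\<close>.\<close>

lemma stable_right:
  assumes u: "u \<in> Pro" and x: "x \<in> Pro" and w: "w \<in> Pro" and eq: "x = u \<cdot> x \<cdot> w"
  shows "\<exists>z\<in>Pro. x \<cdot> w \<cdot> z = x"
proof (rule solve_right[OF mult_closed[OF x w] x])
  fix \<theta> assume t: "\<theta> \<in> C"
  obtain a b c where abc: "a \<in> u \<theta>" "b \<in> x \<theta>" "c \<in> w \<theta>" using rep[OF u t] rep[OF x t] rep[OF w t] by blast
  have W: "a \<in> W" "b \<in> W" "c \<in> W"
    by (rule in_class(1)[OF u t abc(1)], rule in_class(1)[OF x t abc(2)], rule in_class(1)[OF w t abc(3)])
  have tr: "\<And>p q r. (p, q) \<in> \<theta> \<Longrightarrow> (q, r) \<in> \<theta> \<Longrightarrow> (p, r) \<in> \<theta>" using congruence_trans[OF cong[OF t]] .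
  have sy: "\<And>p q. (p, q) \<in> \<theta> \<Longrightarrow> (q, p) \<in> \<theta>" using congruence_sym[OF cong[OF t]] .
  have re: "(p, p) \<in> \<theta>" if "p \<in> W" for p using congruence_refl[OF cong[OF t], of p] that by simp
  have mu: "(p @ q, p' @ q') \<in> \<theta>" if "(p, p') \<in> \<theta>" "(q, q') \<in> \<theta>" for p q p' q'
    using congruence_mult[OF cong[OF t] that] by simp
  have "(a @ b) @ c \<in> x \<theta>" using mult_rep[OF mult_closed[OF u x] w t mult_rep[OF u x t abc(1,2)] abc(3)] eq by simp
  then have b: "(b, a @ b @ c) \<in> \<theta>" using mem_class_iff[OF x t abc(2)] by simp
  have bn: "(b, wpow a (Suc n) @ b @ wpow c (Suc n)) \<in> \<theta>" for n by (rule wpow_sandwich[OF t W b])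
  obtain i d where id: "(wpow c (Suc i + Suc (Suc d)), wpow c (Suc i)) \<in> \<theta>" using wpow_periodic[OF t W(3)] by blast
  let ?ab = "wpow a (Suc i) @ b"
  have ab: "?ab \<in> W" by (rule append_W[OF wpow_in[OF W(1)] W(2)])
  have 1: "(b, ?ab @ wpow c (Suc i)) \<in> \<theta>" using bn[of i] by simp
  have 2: "(?ab @ wpow c (Suc i), ?ab @ wpow c (Suc i + Suc (Suc d))) \<in> \<theta>" by (rule mu[OF re[OF ab] sy[OF id]])
  have "((?ab @ wpow c (Suc i)) @ wpow c (Suc (Suc d)), b @ wpow c (Suc (Suc d))) \<in> \<theta>"
    by (rule mu[OF sy[OF 1] re[OF wpow_in[OF W(3)]]])
  then have 3: "(?ab @ wpow c (Suc i + Suc (Suc d)), b @ wpow c (Suc (Suc d))) \<in> \<theta>"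
    by (simp only: wpow_add append_assoc)
  have "(b, b @ wpow c (Suc (Suc d))) \<in> \<theta>" by (rule tr[OF 1 tr[OF 2 3]])
  then have "b @ wpow c (Suc (Suc d)) \<in> x \<theta>" using mem_class_iff[OF x t abc(2)] by simp
  moreover have "(b @ c) @ wpow c (Suc d) \<in> (x \<cdot> w \<cdot> word (wpow c (Suc d))) \<theta>"
    by (rule mult_rep[OF mult_closed[OF x w] word_closed[OF wpow_in[OF W(3)]] t mult_rep[OF x w t abc(2,3)]
        word_rep[OF t wpow_in[OF W(3)]]])
  ultimately have "(x \<cdot> w \<cdot> word (wpow c (Suc d))) \<theta> = x \<theta>"
    by (intro coord_eqI[OF mult_closed[OF mult_closed[OF x w] word_closed[OF wpow_in[OF W(3)]]] x t]) simp_all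
  then show "\<exists>z\<in>Pro. (x \<cdot> w \<cdot> z) \<theta> = x \<theta>" by (rule bexI[OF _ word_closed[OF wpow_in[OF W(3)]]])
qed

text \<open>The dual argument, based on the periodicity of the powers of \<open>a\<close>.\<close>

lemma stable_left:
  assumes u: "u \<in> Pro" and x: "x \<in> Pro" and w: "w \<in> Pro" and eq: "x = u \<cdot> x \<cdot> w"
  shows "\<exists>z\<in>Pro. z \<cdot> (u \<cdot> x) = x"
proof (rule solve_left[OF mult_closed[OF u x] x])
  fix \<theta> assume t: "\<theta> \<in> C"
  obtain a b c where abc: "a \<in> u \<theta>" "b \<in> x \<theta>" "c \<in> w \<theta>" using rep[OF u t] rep[OF x t] rep[OF w t] by blast
  have W: "a \<in> W" "b \<in> W" "c \<in> W"
    by (rule in_class(1)[OF u t abc(1)], rule in_class(1)[OF x t abc(2)], rule in_class(1)[OF w t abc(3)])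
  have tr: "\<And>p q r. (p, q) \<in> \<theta> \<Longrightarrow> (q, r) \<in> \<theta> \<Longrightarrow> (p, r) \<in> \<theta>" using congruence_trans[OF cong[OF t]] .
  have sy: "\<And>p q. (p, q) \<in> \<theta> \<Longrightarrow> (q, p) \<in> \<theta>" using congruence_sym[OF cong[OF t]] .
  have re: "(p, p) \<in> \<theta>" if "p \<in> W" for p using congruence_refl[OF cong[OF t], of p] that by simp
  have mu: "(p @ q, p' @ q') \<in> \<theta>" if "(p, p') \<in> \<theta>" "(q, q') \<in> \<theta>" for p q p' q'
    using congruence_mult[OF cong[OF t] that] by simp
  have "(a @ b) @ c \<in> x \<theta>" using mult_rep[OF mult_closed[OF u x] w t mult_rep[OF u x t abc(1,2)] abc(3)] eq by simp
  then have b: "(b, a @ b @ c) \<in> \<theta>" using mem_class_iff[OF x t abc(2)] by simp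
  have bn: "(b, wpow a (Suc n) @ b @ wpow c (Suc n)) \<in> \<theta>" for n by (rule wpow_sandwich[OF t W b])
  obtain i d where id: "(wpow a (Suc i + Suc (Suc d)), wpow a (Suc i)) \<in> \<theta>" using wpow_periodic[OF t W(1)] by blast
  let ?bc = "b @ wpow c (Suc i)"
  have bc: "?bc \<in> W" by (rule append_W[OF W(2) wpow_in[OF W(3)]])
  have 1: "(b, wpow a (Suc i) @ ?bc) \<in> \<theta>" by (rule bn)
  have 2: "(wpow a (Suc i) @ ?bc, wpow a (Suc i + Suc (Suc d)) @ ?bc) \<in> \<theta>" by (rule mu[OF sy[OF id] re[OF bc]])
  have "(wpow a (Suc (Suc d)) @ (wpow a (Suc i) @ ?bc), wpow a (Suc (Suc d)) @ b) \<in> \<theta>"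
    by (rule mu[OF re[OF wpow_in[OF W(1)]] sy[OF 1]])
  moreover have "wpow a (Suc i + Suc (Suc d)) = wpow a (Suc (Suc d)) @ wpow a (Suc i)"
    unfolding wpow_add[symmetric] by (simp only: add.commute)
  ultimately have 3: "(wpow a (Suc i + Suc (Suc d)) @ ?bc, wpow a (Suc (Suc d)) @ b) \<in> \<theta>"
    by (simp only: append_assoc)
  have "(b, wpow a (Suc (Suc d)) @ b) \<in> \<theta>" by (rule tr[OF 1 tr[OF 2 3]])
  moreover have "wpow a (Suc (Suc d)) = wpow a (Suc d) @ a" using wpow_add[of "Suc d" 1 a] by simp
  ultimately have "wpow a (Suc d) @ (a @ b) \<in> x \<theta>"
    using mem_class_iff[OF x t abc(2)] by (simp only: append_assoc)
  moreover have "wpow a (Suc d) @ (a @ b) \<in> (word (wpow a (Suc d)) \<cdot> (u \<cdot> x)) \<theta>"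
    by (rule mult_rep[OF word_closed[OF wpow_in[OF W(1)]] mult_closed[OF u x] t
        word_rep[OF t wpow_in[OF W(1)]] mult_rep[OF u x t abc(1,2)]])
  ultimately have "(word (wpow a (Suc d)) \<cdot> (u \<cdot> x)) \<theta> = x \<theta>"
    by (intro coord_eqI[OF mult_closed[OF word_closed[OF wpow_in[OF W(1)]] mult_closed[OF u x]] x t])
  then show "\<exists>z\<in>Pro. (z \<cdot> (u \<cdot> x)) \<theta> = x \<theta>" by (rule bexI[OF _ word_closed[OF wpow_in[OF W(1)]]])
qed

end

lemma pro_fin_semigroup: "pro fin_semigroup A"
  by unfold_locales
    (auto simp: inter_in_pro_congruences full_in_pro_congruences pullback_in_pro_congruences)

lemma pro_fin_group:
  assumes "A \<noteq> {}"
  shows "pro fin_group A"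
proof
  note eq = pro_congruences_fin_group[OF assms]
  show "\<theta> \<in> pro_congruences fin_semigroup A" if "\<theta> \<in> pro_congruences fin_group A" for \<theta>
    using that by (simp add: eq)
  show "\<theta> \<inter> \<rho> \<in> pro_congruences fin_group A"
    if "\<theta> \<in> pro_congruences fin_group A" "\<rho> \<in> pro_congruences fin_group A" for \<theta> \<rho>
  proof -
    have c: "cancellative A \<theta>" "cancellative A \<rho>" using that by (simp_all add: eq)
    have "cancellative A (\<theta> \<inter> \<rho>)"
      unfolding cancellative_def
    proof (intro ballI)
      fix u v w assume W: "u \<in> lists A - {[]}" "v \<in> lists A - {[]}" "w \<in> lists A - {[]}"
      note spec = cancellative_def[THEN iffD1, THEN bspec, OF _ W(1), THEN bspec, OF _ W(2), THEN bspec, OF _ W(3)]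
      show "((u @ w, v @ w) \<in> \<theta> \<inter> \<rho> \<longrightarrow> (u, v) \<in> \<theta> \<inter> \<rho>) \<and>
          ((w @ u, w @ v) \<in> \<theta> \<inter> \<rho> \<longrightarrow> (u, v) \<in> \<theta> \<inter> \<rho>)"
        using spec[OF c(1)] spec[OF c(2)] by (simp only: Int_iff) blast
    qed
    then show ?thesis using that by (simp add: eq inter_in_pro_congruences)
  qed
  show "(lists A - {[]}) \<times> (lists A - {[]}) \<in> pro_congruences fin_group A"
    by (simp add: eq full_in_pro_congruences cancellative_def)
  show "pullback A f \<theta> \<in> pro_congruences fin_group A"
    if "\<theta> \<in> pro_congruences fin_group A" "f \<in> hom (free_semigroup A) (free_semigroup A)" for \<theta> f
    using that by (simp add: eq pullback_in_pro_congruences pullback_cancellative)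
qed

section \<open>The image of the idempotent power\<close>

lemma (in nonerasing_substitution) phi_hom: "\<phi> \<in> hom (free_semigroup A) (free_semigroup A)"
  using substitution by (simp add: substitution_def)

sublocale proper_substitution \<subseteq> S: pro_endo fin_semigroup A \<phi>
  by (intro pro_endo.intro pro_fin_semigroup pro_endo_axioms.intro finite_alphabet phi_hom)

sublocale proper_substitution \<subseteq> G: pro_endo fin_group A \<phi>
  by (intro pro_endo.intro pro_fin_group pro_endo_axioms.intro finite_alphabet phi_hom nonempty_alphabet)

context proper_substitution
begin

abbreviation smul :: "'a pro \<Rightarrow> 'a pro \<Rightarrow> 'a pro" (infixl "\<star>" 70) where "x \<star> y \<equiv> x \<otimes>\<^bsub>S.\<Omega>\<^esub> y"

abbreviation M :: "'a pro set" where "M \<equiv> S.omega ` S.Pro"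

lemma letter_W: "d \<in> A \<Longrightarrow> [d] \<in> S.W"
  by simp

lemma iter_W: "w \<in> S.W \<Longrightarrow> \<Phi> n w \<in> S.W"
  using iter_in[of w n] iter_nonempty[of w n] by simp

lemma power_eq: "w \<in> S.W \<Longrightarrow> (\<phi> ^^ n) w = \<Phi> n w"
  using iter_eq[of w n] by simp

lemma omega_word_coord:
  "w \<in> S.W \<Longrightarrow> \<theta> \<in> S.C \<Longrightarrow> n \<ge> S.index \<theta> \<Longrightarrow> S.omega (S.word w) \<theta> = S.word (\<Phi> (fact n) w) \<theta>"
  using S.omega_coord[OF S.word_closed, of w \<theta> n] S.E_word[of w "fact n"] power_eq[of w "fact n"] by simp

lemma large_fact: "\<exists>n\<ge>S.index \<theta>. (k::nat) \<le> fact n"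
  using fact_ge_self[of "max (S.index \<theta>) k"] by (intro exI[of _ "max (S.index \<theta>) k"]) simp

text \<open>Modulo \<theta>, the idempotent power sends \<open>d\<close> to the word
  \<open>\<Phi> (fact n) [d]\<close> for any large \<open>n\<close>. Length at least 2 keeps the
  cofactor of the first letter nonempty.\<close>

lemma omega_letter_starts:
  assumes d: "d \<in> A"
  shows "\<exists>y\<in>S.Pro. S.word [first_letter] \<star> y = S.omega (S.word [d])"
proof (rule S.solve_right)
  note a = letter_W[OF first_letter_props(1)]
  show "S.word [first_letter] \<in> S.Pro" by (rule S.word_closed[OF a])
  show "S.omega (S.word [d]) \<in> S.Pro" by (rule S.omega_closed[OF S.word_closed[OF letter_W[OF d]]])
  fix \<theta> assume t: "\<theta> \<in> S.C"
  obtain k where k: "\<forall>j\<ge>k. \<forall>c\<in>A. 2 \<le> length (\<Phi> j [c])" using growth by blast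
  obtain n where n: "n \<ge> S.index \<theta>" "max k 1 \<le> fact n" using large_fact by blast
  have "prefix (\<Phi> 0 [first_letter]) (\<Phi> (fact n) [d])" using d n(2) by (intro iter_starts) auto
  then obtain s where s: "\<Phi> (fact n) [d] = [first_letter] @ s" by (auto simp: prefix_def)
  have "2 \<le> length (\<Phi> (fact n) [d])" using k n(2) d by simp
  then have "s \<noteq> []" unfolding s by auto
  moreover have "s \<in> lists A" using iter_in[of "[d]" "fact n"] d unfolding s by simp
  ultimately have sW: "s \<in> S.W" by simp
  have "(S.word [first_letter] \<star> S.word s) \<theta> = S.omega (S.word [d]) \<theta>"
    unfolding omega_word_coord[OF letter_W[OF d] t n(1)] s S.word_mult[OF a sW] ..
  then show "\<exists>x\<in>S.Pro. (S.word [first_letter] \<star> x) \<theta> = S.omega (S.word [d]) \<theta>"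
    by (rule bexI[OF _ S.word_closed[OF sW]])
qed

lemma omega_letter_ends:
  assumes d: "d \<in> A"
  shows "\<exists>y\<in>S.Pro. y \<star> S.word [last_letter] = S.omega (S.word [d])"
proof (rule S.solve_left)
  note b = letter_W[OF last_letter_props(1)]
  show "S.word [last_letter] \<in> S.Pro" by (rule S.word_closed[OF b])
  show "S.omega (S.word [d]) \<in> S.Pro" by (rule S.omega_closed[OF S.word_closed[OF letter_W[OF d]]])
  fix \<theta> assume t: "\<theta> \<in> S.C"
  obtain k where k: "\<forall>j\<ge>k. \<forall>c\<in>A. 2 \<le> length (\<Phi> j [c])" using growth by blast
  obtain n where n: "n \<ge> S.index \<theta>" "max k 1 \<le> fact n" using large_fact by blast
  have "suffix (\<Phi> 0 [last_letter]) (\<Phi> (fact n) [d])" using d n(2) by (intro iter_ends) auto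
  then obtain s where s: "\<Phi> (fact n) [d] = s @ [last_letter]" by (auto simp: suffix_def)
  have "2 \<le> length (\<Phi> (fact n) [d])" using k n(2) d by simp
  then have "s \<noteq> []" unfolding s by auto
  moreover have "s \<in> lists A" using iter_in[of "[d]" "fact n"] d unfolding s by simp
  ultimately have sW: "s \<in> S.W" by simp
  have "(S.word s \<star> S.word [last_letter]) \<theta> = S.omega (S.word [d]) \<theta>"
    unfolding omega_word_coord[OF letter_W[OF d] t n(1)] s S.word_mult[OF sW b] ..
  then show "\<exists>x\<in>S.Pro. (x \<star> S.word [last_letter]) \<theta> = S.omega (S.word [d]) \<theta>"
    by (rule bexI[OF _ S.word_closed[OF sW]])
qed

text \<open>Here recurrence takes the place of properness: long iterates contain every letter away
  from both ends.\<close>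

lemma omega_letter_contains:
  assumes d: "d \<in> A" and c: "c \<in> A"
  shows "\<exists>x\<in>S.Pro. \<exists>y\<in>S.Pro. x \<star> S.word [c] \<star> y = S.omega (S.word [d])"
proof (rule S.solve_two_sided)
  show "S.word [c] \<in> S.Pro" by (rule S.word_closed[OF letter_W[OF c]])
  show "S.omega (S.word [d]) \<in> S.Pro" by (rule S.omega_closed[OF S.word_closed[OF letter_W[OF d]]])
  fix \<theta> assume t: "\<theta> \<in> S.C"
  obtain N where N: "\<forall>w\<in>L. N \<le> length w \<longrightarrow> (\<exists>x y. x \<noteq> [] \<and> y \<noteq> [] \<and> w = x @ [c] @ y)"
    using recurrence[OF letter_in_language[OF c]] by blast
  obtain k where k: "\<forall>j\<ge>k. \<forall>c\<in>A. N \<le> length (\<Phi> j [c])" using growth by blast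
  obtain n where n: "n \<ge> S.index \<theta>" "k \<le> fact n" using large_fact by blast
  have "\<Phi> (fact n) [d] \<in> L" by (rule iter_in_language[OF letter_in_language[OF d]])
  moreover have "N \<le> length (\<Phi> (fact n) [d])" using k n(2) d by simp
  ultimately obtain x y where xy: "x \<noteq> []" "y \<noteq> []" "\<Phi> (fact n) [d] = x @ [c] @ y" using N by blast
  have "x @ [c] @ y \<in> lists A" using iter_in[of "[d]" "fact n"] d unfolding xy(3) by simp
  then have W: "x \<in> S.W" "y \<in> S.W" using xy(1,2) by auto
  have "(S.word x \<star> S.word [c] \<star> S.word y) \<theta> = S.omega (S.word [d]) \<theta>"
    unfolding omega_word_coord[OF letter_W[OF d] t n(1)] xy(3) S.word_mult[OF W(1) letter_W[OF c]]
      S.word_mult[OF S.append_W[OF W(1) letter_W[OF c]] W(2)] append_assoc ..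
  then show "\<exists>x\<in>S.Pro. \<exists>y\<in>S.Pro. (x \<star> S.word [c] \<star> y) \<theta> = S.omega (S.word [d]) \<theta>"
    by (intro bexI[OF _ S.word_closed[OF W(1)]] bexI[OF _ S.word_closed[OF W(2)]])
qed

abbreviation gen :: "'a \<Rightarrow> 'a pro" where "gen d \<equiv> S.omega (S.word [d])"

lemma gen_closed: "d \<in> A \<Longrightarrow> gen d \<in> S.Pro"
  by (rule S.omega_closed[OF S.word_closed[OF letter_W]])

lemma gen_fixed: "d \<in> A \<Longrightarrow> S.omega (gen d) = gen d"
  by (rule S.omega_omega[OF S.word_closed[OF letter_W]])

text \<open>Applying \<open>S.omega\<close>, which fixes \<open>gen d\<close>, turns a factorization
  that starts with a letter into one that starts with an element of \<open>M\<close>.\<close>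

lemma gen_starts: "d \<in> A \<Longrightarrow> \<exists>y\<in>S.Pro. gen d = gen first_letter \<star> y"
proof -
  assume d: "d \<in> A"
  obtain y where y: "y \<in> S.Pro" "S.word [first_letter] \<star> y = gen d" using omega_letter_starts[OF d] by blast
  have "gen d = S.omega (S.word [first_letter] \<star> y)" unfolding y(2) gen_fixed[OF d] ..
  also have "\<dots> = gen first_letter \<star> S.omega y"
    by (rule S.omega_mult[OF S.word_closed[OF letter_W[OF first_letter_props(1)]] y(1)])
  finally show ?thesis by (rule bexI[OF _ S.omega_closed[OF y(1)]])
qed

lemma gen_ends: "d \<in> A \<Longrightarrow> \<exists>y\<in>S.Pro. gen d = y \<star> gen last_letter"
proof -
  assume d: "d \<in> A"
  obtain y where y: "y \<in> S.Pro" "y \<star> S.word [last_letter] = gen d" using omega_letter_ends[OF d] by blast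
  have "gen d = S.omega (y \<star> S.word [last_letter])" unfolding y(2) gen_fixed[OF d] ..
  also have "\<dots> = S.omega y \<star> gen last_letter"
    by (rule S.omega_mult[OF y(1) S.word_closed[OF letter_W[OF last_letter_props(1)]]])
  finally show ?thesis by (rule bexI[OF _ S.omega_closed[OF y(1)]])
qed

lemma gen_contains:
  assumes d: "d \<in> A" and c: "c \<in> A"
  shows "\<exists>x\<in>S.Pro. \<exists>y\<in>S.Pro. gen d = x \<star> gen c \<star> y"
proof -
  obtain x y where xy: "x \<in> S.Pro" "y \<in> S.Pro" "x \<star> S.word [c] \<star> y = gen d"
    using omega_letter_contains[OF d c] by blast
  note cc = S.word_closed[OF letter_W[OF c]]
  have "gen d = S.omega (x \<star> S.word [c] \<star> y)" unfolding xy(3) gen_fixed[OF d] ..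
  also have "\<dots> = S.omega x \<star> gen c \<star> S.omega y"
    by (simp only: S.omega_mult[OF S.mult_closed[OF xy(1) cc] xy(2)] S.omega_mult[OF xy(1) cc])
  finally show ?thesis
    by (intro bexI[OF _ S.omega_closed[OF xy(1)]] bexI[OF _ S.omega_closed[OF xy(2)]])
qed

text \<open>\<open>gen d\<close> is a right multiple of \<open>gen first_letter\<close>, and
  \<open>gen first_letter\<close> has \<open>gen d\<close> as a factor. By stability the first
  relation can be reversed, so all generators generate the same right ideal.\<close>

lemma gen_right_divides:
  assumes c: "c \<in> A" and d: "d \<in> A"
  shows "\<exists>z\<in>S.Pro. gen d \<star> z = gen c"
proof -
  let ?a = "first_letter"
  note a = first_letter_props(1)
  obtain y where y: "y \<in> S.Pro" "gen d = gen ?a \<star> y" using gen_starts[OF d] by blast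
  obtain u v where uv: "u \<in> S.Pro" "v \<in> S.Pro" "gen ?a = u \<star> gen d \<star> v"
    using gen_contains[OF a d] by blast
  note ga = gen_closed[OF a] and cl = S.mult_closed
  have "gen ?a = u \<star> gen ?a \<star> (y \<star> v)"
    using uv(3) unfolding y(2)
    by (simp only: S.mult_assoc[OF uv(1) ga y(1), symmetric] S.mult_assoc[OF cl[OF uv(1) ga] y(1) uv(2)])
  then obtain z where z: "z \<in> S.Pro" "gen ?a \<star> (y \<star> v) \<star> z = gen ?a"
    using S.stable_right[OF uv(1) ga cl[OF y(1) uv(2)]] by blast
  obtain y' where y': "y' \<in> S.Pro" "gen c = gen ?a \<star> y'" using gen_starts[OF c] by blast
  have "gen d \<star> (v \<star> z \<star> y') = gen ?a \<star> (y \<star> v) \<star> z \<star> y'"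
    unfolding y(2) using ga y(1) uv(2) z(1) y'(1) by (simp add: S.mult_assoc cl)
  then have "gen d \<star> (v \<star> z \<star> y') = gen c" by (simp only: z(2) y'(2))
  then show ?thesis by (rule bexI[OF _ cl[OF cl[OF uv(2) z(1)] y'(1)]])
qed

text \<open>The mirror image, with \<open>last_letter\<close> in place of
  \<open>first_letter\<close>.\<close>

lemma gen_left_divides:
  assumes c: "c \<in> A" and d: "d \<in> A"
  shows "\<exists>z\<in>S.Pro. z \<star> gen d = gen c"
proof -
  let ?a = "last_letter"
  note a = last_letter_props(1)
  obtain y where y: "y \<in> S.Pro" "gen d = y \<star> gen ?a" using gen_ends[OF d] by blast
  obtain u v where uv: "u \<in> S.Pro" "v \<in> S.Pro" "gen ?a = u \<star> gen d \<star> v"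
    using gen_contains[OF a d] by blast
  note ga = gen_closed[OF a] and cl = S.mult_closed
  have "gen ?a = (u \<star> y) \<star> gen ?a \<star> v"
    using uv(3) unfolding y(2) by (simp only: S.mult_assoc[OF uv(1) y(1) ga])
  then obtain z where z: "z \<in> S.Pro" "z \<star> ((u \<star> y) \<star> gen ?a) = gen ?a"
    using S.stable_left[OF cl[OF uv(1) y(1)] ga uv(2)] by blast
  obtain y' where y': "y' \<in> S.Pro" "gen c = y' \<star> gen ?a" using gen_ends[OF c] by blast
  have "(y' \<star> z \<star> u) \<star> gen d = y' \<star> (z \<star> ((u \<star> y) \<star> gen ?a))"
    unfolding y(2) using ga y(1) uv(1) z(1) y'(1) by (simp add: S.mult_assoc cl)
  then have "(y' \<star> z \<star> u) \<star> gen d = gen c" by (simp only: z(2) y'(2))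
  then show ?thesis by (rule bexI[OF _ cl[OF cl[OF y'(1) z(1)] uv(1)]])
qed

lemma omega_approx: "x \<in> S.Pro \<Longrightarrow> \<theta> \<in> S.C \<Longrightarrow> \<exists>w\<in>S.W. S.omega (S.word w) \<theta> = S.omega x \<theta>"
proof -
  assume x: "x \<in> S.Pro" and t: "\<theta> \<in> S.C"
  let ?\<rho> = "pullback A (\<phi> ^^ fact (S.index \<theta>)) \<theta>"
  have "?\<rho> \<in> S.C" by (rule S.pullback[OF t S.power_hom])
  then obtain w where "w \<in> S.W" "S.word w ?\<rho> = x ?\<rho>" using S.words_approximate[OF x] by blast
  then show ?thesis by (intro bexI[of _ w]) (simp_all only: S.omega_def S.lift_coord[OF t])
qed

lemma word_split: "w \<in> S.W \<Longrightarrow> \<exists>c\<in>A. w = [c] \<or> (\<exists>t\<in>S.W. w = [c] @ t)"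
  by (cases w) auto

text \<open>Modulo \<theta> the right side is the image of a word, and \<open>gen d\<close> divides
  the image of its first letter by \<open>gen_right_divides\<close>.\<close>

lemma gen_divides_omega:
  assumes d: "d \<in> A" and x: "x \<in> S.Pro"
  shows "\<exists>z\<in>S.Pro. gen d \<star> z = S.omega x"
proof (rule S.solve_right[OF gen_closed[OF d] S.omega_closed[OF x]])
  fix \<theta> assume t: "\<theta> \<in> S.C"
  obtain w where w: "w \<in> S.W" "S.omega (S.word w) \<theta> = S.omega x \<theta>" using omega_approx[OF x t] by blast
  obtain c where c: "c \<in> A" "w = [c] \<or> (\<exists>t\<in>S.W. w = [c] @ t)" using word_split[OF w(1)] by blast
  obtain z where z: "z \<in> S.Pro" "gen d \<star> z = gen c" using gen_right_divides[OF c(1) d] by blast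
  show "\<exists>z\<in>S.Pro. (gen d \<star> z) \<theta> = S.omega x \<theta>"
    using c(2)
  proof
    assume "w = [c]"
    then show ?thesis using z w(2) by (intro bexI[of _ z]) simp_all
  next
    assume "\<exists>t\<in>S.W. w = [c] @ t"
    then obtain s where s: "s \<in> S.W" "w = [c] @ s" by blast
    have os: "S.omega (S.word s) \<in> S.Pro" by (rule S.omega_closed[OF S.word_closed[OF s(1)]])
    have "S.omega (S.word w) = gen c \<star> S.omega (S.word s)"
      unfolding s(2) S.word_mult[OF letter_W[OF c(1)] s(1), symmetric]
      by (rule S.omega_mult[OF S.word_closed[OF letter_W[OF c(1)]] S.word_closed[OF s(1)]])
    also have "\<dots> = gen d \<star> (z \<star> S.omega (S.word s))"
      unfolding z(2)[symmetric] by (rule S.mult_assoc[OF gen_closed[OF d] z(1) os])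
    finally have "(gen d \<star> (z \<star> S.omega (S.word s))) \<theta> = S.omega x \<theta>" using w(2) by (simp only:)
    then show ?thesis by (rule bexI[OF _ S.mult_closed[OF z(1) os]])
  qed
qed

lemma word_split_end: "w \<in> S.W \<Longrightarrow> \<exists>c\<in>A. w = [c] \<or> (\<exists>t\<in>S.W. w = t @ [c])"
  by (cases w rule: rev_cases) auto

lemma gen_divides_omega_left:
  assumes d: "d \<in> A" and x: "x \<in> S.Pro"
  shows "\<exists>z\<in>S.Pro. z \<star> gen d = S.omega x"
proof (rule S.solve_left[OF gen_closed[OF d] S.omega_closed[OF x]])
  fix \<theta> assume t: "\<theta> \<in> S.C"
  obtain w where w: "w \<in> S.W" "S.omega (S.word w) \<theta> = S.omega x \<theta>" using omega_approx[OF x t] by blast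
  obtain c where c: "c \<in> A" "w = [c] \<or> (\<exists>t\<in>S.W. w = t @ [c])" using word_split_end[OF w(1)] by blast
  obtain z where z: "z \<in> S.Pro" "z \<star> gen d = gen c" using gen_left_divides[OF c(1) d] by blast
  show "\<exists>z\<in>S.Pro. (z \<star> gen d) \<theta> = S.omega x \<theta>"
    using c(2)
  proof
    assume "w = [c]"
    then show ?thesis using z w(2) by (intro bexI[of _ z]) simp_all
  next
    assume "\<exists>t\<in>S.W. w = t @ [c]"
    then obtain s where s: "s \<in> S.W" "w = s @ [c]" by blast
    have os: "S.omega (S.word s) \<in> S.Pro" by (rule S.omega_closed[OF S.word_closed[OF s(1)]])
    have "S.omega (S.word w) = S.omega (S.word s) \<star> gen c"
      unfolding s(2) S.word_mult[OF s(1) letter_W[OF c(1)], symmetric]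
      by (rule S.omega_mult[OF S.word_closed[OF s(1)] S.word_closed[OF letter_W[OF c(1)]]])
    also have "\<dots> = (S.omega (S.word s) \<star> z) \<star> gen d"
      unfolding z(2)[symmetric] by (rule S.mult_assoc[OF os z(1) gen_closed[OF d], symmetric])
    finally have "((S.omega (S.word s) \<star> z) \<star> gen d) \<theta> = S.omega x \<theta>" using w(2) by (simp only:)
    then show ?thesis by (rule bexI[OF _ S.mult_closed[OF os z(1)]])
  qed
qed

text \<open>Letters are divided off one at a time. The quotient \<open>z\<close> need not lie in
  \<open>M\<close>, so the induction hypothesis is used for \<open>S.omega z\<close>; since
  \<open>gen c\<close> is fixed, applying \<open>S.omega\<close> to \<open>gen c \<star> z\<close>
  restores the equation.\<close>

lemma omega_word_divides:
  assumes w: "w \<in> S.W" and x: "x \<in> S.Pro"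
  shows "\<exists>z\<in>S.Pro. S.omega (S.word w) \<star> z = S.omega x"
proof -
  have "w \<noteq> []" "set w \<subseteq> A" using w by auto
  then show ?thesis using x
  proof (induction w arbitrary: x rule: list_nonempty_induct)
    case (single c)
    then show ?case using gen_divides_omega[of c x] by simp
  next
    case (cons c w)
    then have cw: "c \<in> A" "w \<in> S.W" "set w \<subseteq> A" by auto
    note ow = S.omega_closed[OF S.word_closed[OF cw(2)]]
    obtain z where z: "z \<in> S.Pro" "gen c \<star> z = S.omega x" using gen_divides_omega[OF cw(1) cons.prems(2)] by blast
    obtain y where y: "y \<in> S.Pro" "S.omega (S.word w) \<star> y = S.omega z" using cons.IH[OF cw(3) z(1)] by blast
    have "S.omega (S.word ([c] @ w)) \<star> y = gen c \<star> S.omega (S.word w) \<star> y"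
      by (simp only: S.word_mult[OF letter_W[OF cw(1)] cw(2), symmetric]
          S.omega_mult[OF S.word_closed[OF letter_W[OF cw(1)]] S.word_closed[OF cw(2)]])
    also have "\<dots> = gen c \<star> S.omega z"
      unfolding y(2)[symmetric] by (rule S.mult_assoc[OF gen_closed[OF cw(1)] ow y(1)])
    also have "\<dots> = S.omega (gen c \<star> z)"
      by (simp only: S.omega_mult[OF gen_closed[OF cw(1)] z(1)] gen_fixed[OF cw(1)])
    also have "\<dots> = S.omega x" unfolding z(2) by (rule S.omega_omega[OF cons.prems(2)])
    finally show ?case using y(1) by (intro bexI[of _ y]) simp_all
  qed
qed

lemma omega_word_divides_left:
  assumes w: "w \<in> S.W" and x: "x \<in> S.Pro"
  shows "\<exists>z\<in>S.Pro. z \<star> S.omega (S.word w) = S.omega x"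
proof -
  have "w \<noteq> []" "set w \<subseteq> A" using w by auto
  then show ?thesis using x
  proof (induction w arbitrary: x rule: list_nonempty_induct)
    case (single c)
    then show ?case using gen_divides_omega_left[of c x] by simp
  next
    case (cons c w)
    then have cw: "c \<in> A" "w \<in> S.W" "set w \<subseteq> A" by auto
    note ow = S.omega_closed[OF S.word_closed[OF cw(2)]]
    obtain z where z: "z \<in> S.Pro" "z \<star> S.omega (S.word w) = S.omega x" using cons.IH[OF cw(3) cons.prems(2)] by blast
    obtain y where y: "y \<in> S.Pro" "y \<star> gen c = S.omega z" using gen_divides_omega_left[OF cw(1) z(1)] by blast
    have "y \<star> S.omega (S.word ([c] @ w)) = y \<star> (gen c \<star> S.omega (S.word w))"
      by (simp only: S.word_mult[OF letter_W[OF cw(1)] cw(2), symmetric]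
          S.omega_mult[OF S.word_closed[OF letter_W[OF cw(1)]] S.word_closed[OF cw(2)]])
    also have "\<dots> = S.omega z \<star> S.omega (S.word w)"
      unfolding y(2)[symmetric] by (rule S.mult_assoc[OF y(1) gen_closed[OF cw(1)] ow, symmetric])
    also have "\<dots> = S.omega (z \<star> S.omega (S.word w))"
      by (simp only: S.omega_mult[OF z(1) ow] S.omega_omega[OF S.word_closed[OF cw(2)]])
    also have "\<dots> = S.omega x" unfolding z(2) by (rule S.omega_omega[OF cons.prems(2)])
    finally show ?case using y(1) by (intro bexI[of _ y]) simp_all
  qed
qed

lemma M_group: "is_group (S.\<Omega>\<lparr>carrier := M\<rparr>)"
proof (rule is_groupI)
  have closed: "x \<star> y \<in> M" if M: "x \<in> M" "y \<in> M" for x y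
  proof -
    obtain x' y' where xy: "x' \<in> S.Pro" "y' \<in> S.Pro" "x = S.omega x'" "y = S.omega y'"
      using M by blast
    show ?thesis unfolding xy(3,4) S.omega_mult[OF xy(1,2), symmetric] by (intro imageI S.mult_closed xy)
  qed
  have sub: "x \<in> S.Pro" if "x \<in> M" for x using that S.omega_closed by (elim imageE) simp
  show "is_semigroup (S.\<Omega>\<lparr>carrier := M\<rparr>)"
    unfolding is_semigroup_def using closed S.mult_assoc[OF sub sub sub] by simp
  show "carrier (S.\<Omega>\<lparr>carrier := M\<rparr>) \<noteq> {}"
    using S.word_closed[OF letter_W[OF first_letter_props(1)]] by auto
  fix a b assume "a \<in> carrier (S.\<Omega>\<lparr>carrier := M\<rparr>)" "b \<in> carrier (S.\<Omega>\<lparr>carrier := M\<rparr>)"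
  then have "a \<in> M" "b \<in> M" by simp_all
  then obtain s x where sx: "s \<in> S.Pro" "x \<in> S.Pro" "a = S.omega s" "b = S.omega x"
    by blast
  note os = S.omega_closed[OF sx(1)] and ox = S.omega_closed[OF sx(2)]
  have "\<exists>z\<in>S.Pro. S.omega s \<star> z = S.omega x"
  proof (rule S.solve_right[OF os ox])
    fix \<theta> assume t: "\<theta> \<in> S.C"
    obtain w where w: "w \<in> S.W" "S.omega (S.word w) \<theta> = S.omega s \<theta>" using omega_approx[OF sx(1) t] by blast
    obtain z where z: "z \<in> S.Pro" "S.omega (S.word w) \<star> z = S.omega x"
      using omega_word_divides[OF w(1) sx(2)] by blast
    have "(S.omega s \<star> z) \<theta> = (S.omega (S.word w) \<star> z) \<theta>"
      by (rule S.mult_coord_cong[OF os z(1) S.omega_closed[OF S.word_closed[OF w(1)]] z(1) t w(2)[symmetric] refl])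
    then show "\<exists>z\<in>S.Pro. (S.omega s \<star> z) \<theta> = S.omega x \<theta>" unfolding z(2) by (rule bexI[OF _ z(1)])
  qed
  then obtain z where z: "z \<in> S.Pro" "S.omega s \<star> z = S.omega x" by blast
  \<comment> \<open>Applying \<open>S.omega\<close> to the equation moves the solution into
    \<open>M\<close>.\<close>
  have "S.omega s \<star> S.omega z = S.omega x"
    using S.omega_mult[OF os z(1)] unfolding z(2) S.omega_omega[OF sx(1)] S.omega_omega[OF sx(2)] by simp
  then show "\<exists>z\<in>carrier (S.\<Omega>\<lparr>carrier := M\<rparr>). a \<otimes>\<^bsub>S.\<Omega>\<lparr>carrier := M\<rparr>\<^esub> z = b"
    using z(1) by (intro bexI[of _ "S.omega z"]) (simp_all add: sx)
  have "\<exists>z\<in>S.Pro. z \<star> S.omega s = S.omega x"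
  proof (rule S.solve_left[OF os ox])
    fix \<theta> assume t: "\<theta> \<in> S.C"
    obtain w where w: "w \<in> S.W" "S.omega (S.word w) \<theta> = S.omega s \<theta>" using omega_approx[OF sx(1) t] by blast
    obtain z where z: "z \<in> S.Pro" "z \<star> S.omega (S.word w) = S.omega x"
      using omega_word_divides_left[OF w(1) sx(2)] by blast
    have "(z \<star> S.omega s) \<theta> = (z \<star> S.omega (S.word w)) \<theta>"
      by (rule S.mult_coord_cong[OF z(1) os z(1) S.omega_closed[OF S.word_closed[OF w(1)]] t refl w(2)[symmetric]])
    then show "\<exists>z\<in>S.Pro. (z \<star> S.omega s) \<theta> = S.omega x \<theta>" unfolding z(2) by (rule bexI[OF _ z(1)])
  qed
  then obtain z where z: "z \<in> S.Pro" "z \<star> S.omega s = S.omega x" by blast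
  have "S.omega z \<star> S.omega s = S.omega x"
    using S.omega_mult[OF z(1) os] unfolding z(2) S.omega_omega[OF sx(1)] S.omega_omega[OF sx(2)] by simp
  then show "\<exists>z\<in>carrier (S.\<Omega>\<lparr>carrier := M\<rparr>). z \<otimes>\<^bsub>S.\<Omega>\<lparr>carrier := M\<rparr>\<^esub> a = b"
    using z(1) by (intro bexI[of _ "S.omega z"]) (simp_all add: sx)
qed

end

section \<open>Maximality of the image\<close>

lemma subgroup_unfold:
  assumes "is_group (S\<lparr>carrier := H\<rparr>)"
  shows "\<exists>e. e \<in> H \<and> (\<forall>x\<in>H. e \<otimes>\<^bsub>S\<^esub> x = x \<and> x \<otimes>\<^bsub>S\<^esub> e = x) \<and>
    (\<forall>x\<in>H. \<exists>y\<in>H. x \<otimes>\<^bsub>S\<^esub> y = e \<and> y \<otimes>\<^bsub>S\<^esub> x = e) \<and> (\<forall>x\<in>H. \<forall>y\<in>H. x \<otimes>\<^bsub>S\<^esub> y \<in> H)"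
proof -
  obtain e where e: "group (S\<lparr>carrier := H, one := e\<rparr>)" using assms by (auto simp: is_group_def)
  interpret grp: group "S\<lparr>carrier := H, one := e\<rparr>" by (rule e)
  have e: "e \<in> H" using grp.one_closed by simp
  have one: "\<forall>x\<in>H. e \<otimes>\<^bsub>S\<^esub> x = x \<and> x \<otimes>\<^bsub>S\<^esub> e = x" using grp.l_one grp.r_one by simp
  have inv: "\<forall>x\<in>H. \<exists>y\<in>H. x \<otimes>\<^bsub>S\<^esub> y = e \<and> y \<otimes>\<^bsub>S\<^esub> x = e"
  proof
    fix x assume "x \<in> H"
    then have "x \<in> Units (S\<lparr>carrier := H, one := e\<rparr>)" by (simp add: grp.Units_eq)
    then have "\<exists>y\<in>H. y \<otimes>\<^bsub>S\<^esub> x = e \<and> x \<otimes>\<^bsub>S\<^esub> y = e" by (simp add: Units_def)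
    then show "\<exists>y\<in>H. x \<otimes>\<^bsub>S\<^esub> y = e \<and> y \<otimes>\<^bsub>S\<^esub> x = e" by (simp only: conj_commute)
  qed
  have closed: "\<forall>x\<in>H. \<forall>y\<in>H. x \<otimes>\<^bsub>S\<^esub> y \<in> H"
  proof (intro ballI)
    fix x y assume "x \<in> H" "y \<in> H"
    then show "x \<otimes>\<^bsub>S\<^esub> y \<in> H" using grp.m_closed[of x y] by simp
  qed
  show ?thesis by (intro exI[of _ e] conjI e one inv closed)
qed

section \<open>Special congruences of finite index\<close>

lemma in_pro_congruences_fin_semigroupI:
  assumes c: "is_congruence (free_semigroup A) \<theta>" and fin: "finite (g ` (lists A - {[]}))"
    and k: "\<And>u v. u \<in> lists A - {[]} \<Longrightarrow> v \<in> lists A - {[]} \<Longrightarrow> g u = g v \<Longrightarrow> (u, v) \<in> \<theta>"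
  shows "\<theta> \<in> pro_congruences fin_semigroup A"
proof -
  have "equiv (lists A - {[]}) \<theta>" using c by (simp add: is_congruence_def)
  with fin k have "finite ((lists A - {[]}) // \<theta>)" by (rule finite_quotient_if_kernel)
  then show ?thesis using c by (simp add: pro_congruences_fin_semigroup)
qed

definition length_congruence :: "'a set \<Rightarrow> nat \<Rightarrow> ('a list \<times> 'a list) set" where
  "length_congruence A k = {(u, v). u \<in> lists A - {[]} \<and> v \<in> lists A - {[]} \<and> min (length u) k = min (length v) k}"

lemma length_congruence: "length_congruence A k \<in> pro_congruences fin_semigroup A"
proof (rule in_pro_congruences_fin_semigroupI)
  show "is_congruence (free_semigroup A) (length_congruence A k)"
    by (rule congruence_free_semigroupI) (auto simp: length_congruence_def min_def split: if_splits)
  have "(\<lambda>u. min (length u) k) ` (lists A - {[]}) \<subseteq> {..k}" by (rule image_subsetI) simp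
  then show "finite ((\<lambda>u. min (length u) k) ` (lists A - {[]}))" by (rule finite_subset) simp
qed (simp add: length_congruence_def)

text \<open>Gives a meaning to the first \<open>k\<close> letters of an element of the limit; it
  serves to recognize long prefixes of the fixed point there.\<close>

definition prefix_congruence :: "'a set \<Rightarrow> nat \<Rightarrow> ('a list \<times> 'a list) set" where
  "prefix_congruence A k = {(u, v). u \<in> lists A - {[]} \<and> v \<in> lists A - {[]} \<and> take k u = take k v}"

lemma prefix_congruence:
  assumes "finite A"
  shows "prefix_congruence A k \<in> pro_congruences fin_semigroup A"
proof (rule in_pro_congruences_fin_semigroupI)
  show "is_congruence (free_semigroup A) (prefix_congruence A k)"
  proof (rule congruence_free_semigroupI)
    fix u u' v v' assume a: "(u, u') \<in> prefix_congruence A k" "(v, v') \<in> prefix_congruence A k"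
    then have t: "take k u = take k u'" "take k v = take k v'" by (simp_all add: prefix_congruence_def)
    have len: "min (length u) k = min (length u') k" using arg_cong[OF t(1), of length] by (simp add: min.commute)
    have sub: "k - length u = k - length u'" using len by (simp add: min_def split: if_splits)
    have "take (k - length u) v = take (k - length u) (take k v)" by simp
    also have "\<dots> = take (k - length u) (take k v')" by (simp only: t(2))
    finally have "take (k - length u) v = take (k - length u') v'" by (simp add: sub)
    then show "(u @ v, u' @ v') \<in> prefix_congruence A k" using a t(1) by (simp add: prefix_congruence_def)
  qed (auto simp: prefix_congruence_def)
  have "take k ` (lists A - {[]}) \<subseteq> {w. set w \<subseteq> A \<and> length w \<le> k}"
    using set_take_subset by fastforce
  then show "finite (take k ` (lists A - {[]}))"
    using finite_lists_length_le[OF assms] by (rule finite_subset)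
qed (simp add: prefix_congruence_def)

text \<open>Finite-index congruence for which the concatenation of two \<open>\<theta>\<close>-classes is saturated; it shows that
  the multiplication of the free profinite semigroup is open.\<close>

definition splits :: "'a set \<Rightarrow> ('a list \<times> 'a list) set \<Rightarrow> 'a list \<Rightarrow> ('a list set \<times> 'a list set) set" where
  "splits A \<theta> w = {(\<theta> `` {p}, \<theta> `` {q}) | p q. p \<in> lists A - {[]} \<and> q \<in> lists A - {[]} \<and> w = p @ q}"

definition split_congruence :: "'a set \<Rightarrow> ('a list \<times> 'a list) set \<Rightarrow> ('a list \<times> 'a list) set" where
  "split_congruence A \<theta> = {(u, v). (u, v) \<in> \<theta> \<and> splits A \<theta> u = splits A \<theta> v}"

lemma splits_iff:
  "(c, d) \<in> splits A \<theta> w \<longleftrightarrow> (\<exists>p q. c = \<theta> `` {p} \<and> d = \<theta> `` {q} \<and>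
    p \<in> lists A - {[]} \<and> q \<in> lists A - {[]} \<and> w = p @ q)"
  unfolding splits_def by blast

text \<open>A factorization of \<open>u @ u'\<close> cuts inside \<open>u\<close>, inside
  \<open>u'\<close> or between them, and each case is copied to \<open>v @ v'\<close> from the
  classes and splits of the two parts. The reverse inclusion follows by exchanging the
  roles.\<close>

lemma splits_append_subset:
  assumes c: "is_congruence (free_semigroup A) \<theta>" and u: "(u, v) \<in> \<theta>" "splits A \<theta> u \<subseteq> splits A \<theta> v"
    and u': "(u', v') \<in> \<theta>" "splits A \<theta> u' \<subseteq> splits A \<theta> v'"
  shows "splits A \<theta> (u @ u') \<subseteq> splits A \<theta> (v @ v')"
proof
  let ?W = "lists A - {[]}"
  have W: "u \<in> ?W" "v \<in> ?W" "u' \<in> ?W" "v' \<in> ?W"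
    using congruence_in[OF c u(1)] congruence_in[OF c u'(1)] by simp_all
  have ceq: "\<theta> `` {x} = \<theta> `` {y}" if "(x, y) \<in> \<theta>" for x y
    using equiv_class_eq[OF _ that] c by (auto simp: is_congruence_def)
  have ceqD: "(x, y) \<in> \<theta>" if "\<theta> `` {x} = \<theta> `` {y}" "x \<in> ?W" "y \<in> ?W" for x y
    using congruence_class_eq[OF c, of x y] that by simp
  have mu: "(p @ q, p' @ q') \<in> \<theta>" if "(p, p') \<in> \<theta>" "(q, q') \<in> \<theta>" for p q p' q'
    using congruence_mult[OF c that] by simp
  have app: "x @ y \<in> ?W" if "x \<in> ?W" "y \<in> ?W" for x y using that by auto
  fix z assume "z \<in> splits A \<theta> (u @ u')"
  then obtain p q where pq: "z = (\<theta> `` {p}, \<theta> `` {q})" "p \<in> ?W" "q \<in> ?W" "u @ u' = p @ q"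
    by (auto simp: splits_def)
  have "\<exists>p' q'. p' \<in> ?W \<and> q' \<in> ?W \<and> v @ v' = p' @ q' \<and> \<theta> `` {p} = \<theta> `` {p'} \<and> \<theta> `` {q} = \<theta> `` {q'}"
  proof -
    obtain s where s: "u = p @ s \<and> s @ u' = q \<or> u @ s = p \<and> u' = s @ q"
      using pq(4) unfolding append_eq_append_conv2 by blast
    have sA: "s \<in> lists A" using s W(1,3) by (elim disjE) auto
    have "u = p \<and> u' = q \<or> s \<in> ?W \<and> u = p @ s \<and> q = s @ u' \<or> s \<in> ?W \<and> p = u @ s \<and> u' = s @ q"
    proof (cases "s = []")
      case True
      then show ?thesis using s by simp
    next
      case False
      then have "s \<in> ?W" using sA by simp
      then show ?thesis using s by (elim disjE conjE) simp_all
    qed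
    then consider (eq) "u = p" "u' = q" | (left) "s \<in> ?W" "u = p @ s" "q = s @ u'" | (right) "s \<in> ?W" "p = u @ s" "u' = s @ q"
      by (elim disjE conjE)
    then show ?thesis
    proof cases
      case eq
      then show ?thesis using W u(1) u'(1) ceq by (intro exI[of _ v] exI[of _ v']) auto
    next
      case left
      then have "(\<theta> `` {p}, \<theta> `` {s}) \<in> splits A \<theta> u" unfolding splits_def using pq(2) by blast
      then have "(\<theta> `` {p}, \<theta> `` {s}) \<in> splits A \<theta> v" by (rule subsetD[OF u(2)])
      then obtain p' s' where ps: "\<theta> `` {p} = \<theta> `` {p'}" "\<theta> `` {s} = \<theta> `` {s'}" "p' \<in> ?W" "s' \<in> ?W" "v = p' @ s'"
        unfolding splits_iff by (elim exE conjE)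
      have "(s @ u', s' @ v') \<in> \<theta>" by (rule mu[OF ceqD[OF ps(2) left(1) ps(4)] u'(1)])
      then have "\<theta> `` {q} = \<theta> `` {s' @ v'}" unfolding left(3) by (rule ceq)
      then show ?thesis using ps(1,3) app[OF ps(4) W(4)]
        by (intro exI[of _ p'] exI[of _ "s' @ v'"] conjI) (simp_all only: ps(5) append_assoc)
    next
      case right
      then have "(\<theta> `` {s}, \<theta> `` {q}) \<in> splits A \<theta> u'" unfolding splits_def using pq(3) by blast
      then have "(\<theta> `` {s}, \<theta> `` {q}) \<in> splits A \<theta> v'" by (rule subsetD[OF u'(2)])
      then obtain s' q' where sq: "\<theta> `` {s} = \<theta> `` {s'}" "\<theta> `` {q} = \<theta> `` {q'}" "s' \<in> ?W" "q' \<in> ?W" "v' = s' @ q'"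
        unfolding splits_iff by (elim exE conjE)
      have "(u @ s, v @ s') \<in> \<theta>" by (rule mu[OF u(1) ceqD[OF sq(1) right(1) sq(3)]])
      then have "\<theta> `` {p} = \<theta> `` {v @ s'}" unfolding right(2) by (rule ceq)
      then show ?thesis using sq(2,4) app[OF W(2) sq(3)]
        by (intro exI[of _ "v @ s'"] exI[of _ q'] conjI) (simp_all only: sq(5) append_assoc)
    qed
  qed
  then show "z \<in> splits A \<theta> (v @ v')" unfolding splits_def pq(1) by blast
qed

lemma split_congruence:
  assumes t: "\<theta> \<in> pro_congruences fin_semigroup A"
  shows "split_congruence A \<theta> \<in> pro_congruences fin_semigroup A"
proof (rule in_pro_congruences_fin_semigroupI)
  let ?W = "lists A - {[]}"
  have c: "is_congruence (free_semigroup A) \<theta>" and fin: "finite (?W // \<theta>)"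
    using t by (simp_all add: pro_congruences_fin_semigroup)
  show "is_congruence (free_semigroup A) (split_congruence A \<theta>)"
  proof (rule congruence_free_semigroupI)
    fix u v assume "(u, v) \<in> split_congruence A \<theta>"
    then show "u \<in> ?W \<and> v \<in> ?W" using congruence_in[OF c, of u v] by (simp add: split_congruence_def)
  next
    fix u assume "u \<in> ?W"
    then show "(u, u) \<in> split_congruence A \<theta>" using congruence_refl[OF c, of u] by (simp add: split_congruence_def)
  next
    fix u v assume "(u, v) \<in> split_congruence A \<theta>"
    then show "(v, u) \<in> split_congruence A \<theta>" using congruence_sym[OF c, of u v] by (simp add: split_congruence_def)
  next
    fix u v w assume "(u, v) \<in> split_congruence A \<theta>" "(v, w) \<in> split_congruence A \<theta>"
    then show "(u, w) \<in> split_congruence A \<theta>" using congruence_trans[OF c, of u v w] by (simp add: split_congruence_def)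
  next
    fix u v u' v' assume "(u, v) \<in> split_congruence A \<theta>" "(u', v') \<in> split_congruence A \<theta>"
    then have a: "(u, v) \<in> \<theta>" "(u', v') \<in> \<theta>" "splits A \<theta> u = splits A \<theta> v" "splits A \<theta> u' = splits A \<theta> v'"
      by (simp_all add: split_congruence_def)
    have "splits A \<theta> (u @ u') \<subseteq> splits A \<theta> (v @ v')"
      by (rule splits_append_subset[OF c a(1) _ a(2)]) (simp_all only: a(3,4) subset_refl)
    moreover have "splits A \<theta> (v @ v') \<subseteq> splits A \<theta> (u @ u')"
      by (rule splits_append_subset[OF c congruence_sym[OF c a(1)] _ congruence_sym[OF c a(2)]])
        (simp_all only: a(3,4) subset_refl)
    moreover have "(u @ u', v @ v') \<in> \<theta>" using congruence_mult[OF c a(1,2)] by simp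
    ultimately show "(u @ u', v @ v') \<in> split_congruence A \<theta>"
      by (simp add: split_congruence_def)
  qed
  have "splits A \<theta> u \<subseteq> (?W // \<theta>) \<times> (?W // \<theta>)" for u
  proof
    fix z assume "z \<in> splits A \<theta> u"
    then obtain p q where pq: "z = (\<theta> `` {p}, \<theta> `` {q})" "p \<in> ?W" "q \<in> ?W"
      unfolding splits_def by blast
    show "z \<in> (?W // \<theta>) \<times> (?W // \<theta>)" unfolding pq(1) by (intro SigmaI quotientI pq(2,3))
  qed
  then have "(\<lambda>u. (\<theta> `` {u}, splits A \<theta> u)) ` ?W \<subseteq> (?W // \<theta>) \<times> Pow ((?W // \<theta>) \<times> (?W // \<theta>))"
    by (intro image_subsetI SigmaI quotientI PowI)
  then show "finite ((\<lambda>u. (\<theta> `` {u}, splits A \<theta> u)) ` ?W)"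
    by (rule finite_subset) (simp add: fin)
  show "(u, v) \<in> split_congruence A \<theta>"
    if "u \<in> ?W" "v \<in> ?W" "(\<theta> `` {u}, splits A \<theta> u) = (\<theta> `` {v}, splits A \<theta> v)" for u v
    using that congruence_class_eq[OF c, of u v] by (simp add: split_congruence_def)
qed

section \<open>The closure of the language and its J-class\<close>

context proper_substitution
begin

abbreviation clL :: "'a pro set" where "clL \<equiv> S.T closure_of (S.word ` L)"
abbreviation J :: "'a pro set" where "J \<equiv> J_class A X"

lemma L_W: "w \<in> L \<Longrightarrow> w \<in> S.W"
  using language_in[of w] language_nonempty[of w] by simp

lemma J_eq: "J = clL - S.word ` L"
  by (simp add: J_class_def blocks_eq)

lemma clL_iff: "x \<in> clL \<longleftrightarrow> x \<in> S.Pro \<and> (\<forall>\<theta>\<in>S.C. \<exists>w\<in>L. S.word w \<theta> = x \<theta>)"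
proof -
  have "S.word ` L \<subseteq> S.Pro" by (intro image_subsetI S.word_closed L_W)
  then show ?thesis by (simp only: S.in_closure_iff bex_simps)
qed

text \<open>The split congruence remembers a factorization into the classes of \<open>x\<close> and
  \<open>y\<close>, so the word of \<open>L\<close> that approximates the product factors
  accordingly. Approximating \<open>x\<close> and \<open>y\<close> separately would give words whose
  product need not belong to \<open>L\<close>.\<close>

lemma clL_split:
  assumes x: "x \<in> S.Pro" and y: "y \<in> S.Pro" and xy: "x \<star> y \<in> clL" and t: "\<theta> \<in> S.C"
  shows "\<exists>u v. u \<in> x \<theta> \<and> v \<in> y \<theta> \<and> u @ v \<in> L"
proof -
  let ?k = "split_congruence A \<theta>"
  have k: "?k \<in> S.C" by (rule split_congruence[OF t])
  have sub: "?k \<subseteq> \<theta>" by (auto simp: split_congruence_def)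
  obtain w where w: "w \<in> L" "S.word w ?k = (x \<star> y) ?k" using xy k unfolding clL_iff by blast
  obtain p q where pq: "p \<in> x ?k" "q \<in> y ?k" using S.rep[OF x k] S.rep[OF y k] by blast
  have W: "p \<in> S.W" "q \<in> S.W" by (rule S.in_class(1)[OF x k pq(1)], rule S.in_class(1)[OF y k pq(2)])
  have "w \<in> (x \<star> y) ?k" using S.word_rep[OF k L_W[OF w(1)]] w(2) by simp
  then have "(p @ q, w) \<in> ?k"
    using S.mem_class_iff[OF S.mult_closed[OF x y] k S.mult_rep[OF x y k pq]] by simp
  then have "splits A \<theta> (p @ q) = splits A \<theta> w" by (simp add: split_congruence_def)
  moreover have "(\<theta> `` {p}, \<theta> `` {q}) \<in> splits A \<theta> (p @ q)"
    unfolding splits_iff by (intro exI[of _ p] exI[of _ q] conjI refl W)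
  ultimately have "(\<theta> `` {p}, \<theta> `` {q}) \<in> splits A \<theta> w" by (simp only:)
  then obtain u v where uv: "u \<in> S.W" "v \<in> S.W" "w = u @ v" "\<theta> `` {p} = \<theta> `` {u}" "\<theta> `` {q} = \<theta> `` {v}"
    unfolding splits_iff by (elim exE conjE)
  have pq': "p \<in> x \<theta>" "q \<in> y \<theta>" using S.mono[OF x k t sub] S.mono[OF y k t sub] pq by auto
  have "x \<theta> = \<theta> `` {u}" "y \<theta> = \<theta> `` {v}"
    by (rule trans[OF S.in_class(2)[OF x t pq'(1)] uv(4)], rule trans[OF S.in_class(2)[OF y t pq'(2)] uv(5)])
  then have "u \<in> x \<theta>" "v \<in> y \<theta>"
    using S.word_rep[OF t uv(1)] S.word_rep[OF t uv(2)] by (simp_all only: S.word_coord[OF t])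
  then show ?thesis using w(1) unfolding uv(3) by (intro exI conjI)
qed

text \<open>\<open>L\<close> is closed under factors, and \<open>clL_split\<close> carries this over
  to the closure.\<close>

lemma clL_factors:
  assumes x: "x \<in> S.Pro" and y: "y \<in> S.Pro" and xy: "x \<star> y \<in> clL"
  shows "x \<in> clL" "y \<in> clL"
proof -
  have "\<exists>w\<in>L. S.word w \<theta> = x \<theta>" "\<exists>w\<in>L. S.word w \<theta> = y \<theta>" if t: "\<theta> \<in> S.C" for \<theta>
  proof -
    obtain u v where uv: "u \<in> x \<theta>" "v \<in> y \<theta>" "u @ v \<in> L" using clL_split[OF x y xy t] by blast
    have W: "u \<in> S.W" "v \<in> S.W" by (rule S.in_class(1)[OF x t uv(1)], rule S.in_class(1)[OF y t uv(2)])
    have "sublist u (u @ v)" "sublist v (u @ v)" by (simp_all add: prefix_imp_sublist suffix_imp_sublist)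
    then have "u \<in> L" "v \<in> L" using uv(3) W language_factor by auto
    moreover have "S.word u \<theta> = x \<theta>" "S.word v \<theta> = y \<theta>"
      using S.in_class(2)[OF x t uv(1)] S.in_class(2)[OF y t uv(2)] by (simp_all only: S.word_coord[OF t])
    ultimately show "\<exists>w\<in>L. S.word w \<theta> = x \<theta>" "\<exists>w\<in>L. S.word w \<theta> = y \<theta>" by blast+
  qed
  then show "x \<in> clL" "y \<in> clL" unfolding clL_iff using x y by blast+
qed

text \<open>Lengths capped at \<open>length w + 1\<close> still separate \<open>w\<close> from every
  longer word.\<close>

lemma word_not_absorbing:
  assumes w: "w \<in> S.W" and y: "y \<in> S.Pro"
  shows "S.word w \<star> y \<noteq> S.word w"
proof
  assume eq: "S.word w \<star> y = S.word w"
  let ?k = "length_congruence A (length w + 1)"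
  have k: "?k \<in> S.C" by (rule length_congruence)
  obtain q where q: "q \<in> y ?k" using S.rep[OF y k] by blast
  have "q \<in> S.W" by (rule S.in_class(1)[OF y k q])
  have "w @ q \<in> S.word w ?k"
    using S.mult_rep[OF S.word_closed[OF w] y k S.word_rep[OF k w] q] unfolding eq .
  then have "(w, w @ q) \<in> ?k" unfolding S.word_coord[OF k] by simp
  then show False using \<open>q \<in> S.W\<close> by (cases q) (auto simp: length_congruence_def min_def split: if_splits)
qed

lemma M_in: "x \<in> M \<Longrightarrow> x \<in> S.Pro"
  using S.omega_closed by blast

lemma M_fixed: "x \<in> M \<Longrightarrow> S.omega x = x"
  using S.omega_omega by blast

lemma M_unit: "\<exists>e. e \<in> M \<and> (\<forall>x\<in>M. e \<star> x = x \<and> x \<star> e = x) \<and>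
    (\<forall>x\<in>M. \<exists>y\<in>M. x \<star> y = e \<and> y \<star> x = e) \<and> (\<forall>x\<in>M. \<forall>y\<in>M. x \<star> y \<in> M)"
  by (rule subgroup_unfold[OF M_group])

definition unit :: "'a pro" where
  "unit = (SOME e. e \<in> M \<and> (\<forall>x\<in>M. e \<star> x = x \<and> x \<star> e = x) \<and>
    (\<forall>x\<in>M. \<exists>y\<in>M. x \<star> y = e \<and> y \<star> x = e) \<and> (\<forall>x\<in>M. \<forall>y\<in>M. x \<star> y \<in> M))"

lemma unit: "unit \<in> M" "x \<in> M \<Longrightarrow> unit \<star> x = x" "x \<in> M \<Longrightarrow> x \<star> unit = x"
    "x \<in> M \<Longrightarrow> \<exists>y\<in>M. x \<star> y = unit \<and> y \<star> x = unit" "x \<in> M \<Longrightarrow> y \<in> M \<Longrightarrow> x \<star> y \<in> M"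
proof -
  have "unit \<in> M \<and> (\<forall>x\<in>M. unit \<star> x = x \<and> x \<star> unit = x) \<and>
    (\<forall>x\<in>M. \<exists>y\<in>M. x \<star> y = unit \<and> y \<star> x = unit) \<and> (\<forall>x\<in>M. \<forall>y\<in>M. x \<star> y \<in> M)"
    unfolding unit_def by (rule someI_ex[OF M_unit])
  then show "unit \<in> M" "x \<in> M \<Longrightarrow> unit \<star> x = x" "x \<in> M \<Longrightarrow> x \<star> unit = x"
    "x \<in> M \<Longrightarrow> \<exists>y\<in>M. x \<star> y = unit \<and> y \<star> x = unit" "x \<in> M \<Longrightarrow> y \<in> M \<Longrightarrow> x \<star> y \<in> M"
    by (simp_all only: simp_thms)
qed

lemma gen_clL: "d \<in> A \<Longrightarrow> gen d \<in> clL"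
  unfolding clL_iff
proof (intro conjI ballI)
  assume d: "d \<in> A"
  show "gen d \<in> S.Pro" by (rule gen_closed[OF d])
  fix \<theta> assume t: "\<theta> \<in> S.C"
  have "gen d \<theta> = S.word (\<Phi> (fact (S.index \<theta>)) [d]) \<theta>"
    by (rule omega_word_coord[OF letter_W[OF d] t order_refl])
  then show "\<exists>w\<in>L. S.word w \<theta> = gen d \<theta>"
    by (intro bexI[of _ "\<Phi> (fact (S.index \<theta>)) [d]"] iter_in_language letter_in_language d) simp
qed

text \<open>The unit is a factor of a generator, which is a limit of words of \<open>L\<close>, and
  every element of \<open>M\<close> is a factor of the unit; so all lie in the closure. None is a
  word, since each absorbs the unit.\<close>

lemma M_J: "M \<subseteq> J"
proof
  fix x assume x: "x \<in> M"
  have g: "gen first_letter \<in> M" using S.word_closed[OF letter_W[OF first_letter_props(1)]] by blast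
  have "unit \<in> clL"
    by (rule clL_factors(2)[OF M_in[OF g] M_in[OF unit(1)]])
      (simp only: unit(3)[OF g] gen_clL[OF first_letter_props(1)])
  moreover obtain y where y: "y \<in> M" "x \<star> y = unit" using unit(4)[OF x] by blast
  ultimately have "x \<in> clL" using clL_factors(1)[OF M_in[OF x] M_in[OF y(1)]] by simp
  moreover have "x \<notin> S.word ` L"
  proof
    assume "x \<in> S.word ` L"
    then obtain w where w: "w \<in> L" "x = S.word w" by blast
    show False using word_not_absorbing[OF L_W[OF w(1)] M_in[OF unit(1)]] unit(3)[OF x] unfolding w(2) by simp
  qed
  ultimately show "x \<in> J" by (simp add: J_eq)
qed

text \<open>If all words of \<open>L\<close> in the \<theta>-class of \<open>e\<close> were short,
  \<open>e\<close> would lie in the closure of a finite set of words, hence be a word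
  itself.\<close>

lemma J_long:
  assumes e: "e \<in> J" and t: "\<theta> \<in> S.C"
  shows "\<exists>w\<in>L. N \<le> length w \<and> S.word w \<theta> = e \<theta>"
proof (rule ccontr)
  assume no: "\<not> ?thesis"
  have ec: "e \<in> S.Pro" and eL: "e \<notin> S.word ` L" and ecl: "\<forall>\<theta>\<in>S.C. \<exists>w\<in>L. S.word w \<theta> = e \<theta>"
    using e unfolding J_eq clL_iff Diff_iff by simp_all
  let ?F = "S.word ` {w \<in> L. length w < N}"
  have FW: "?F \<subseteq> S.Pro" using L_W S.word_closed by (intro image_subsetI) simp
  have "{w \<in> L. length w < N} \<subseteq> {w. set w \<subseteq> A \<and> length w \<le> N}" using language_in by auto
  then have "finite {w \<in> L. length w < N}" using finite_lists_length_le[OF finite_alphabet] by (rule finite_subset)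
  then have "closedin S.T ?F" using FW
    by (simp add: closedin_Hausdorff_finite_eq[OF S.Hausdorff] S.topspace)
  then have "S.T closure_of ?F = ?F" by (rule closure_of_closedin)
  moreover have "e \<in> S.T closure_of ?F"
    unfolding S.in_closure_iff[OF FW]
  proof (intro conjI ballI)
    fix \<rho> assume r: "\<rho> \<in> S.C"
    have i: "\<theta> \<inter> \<rho> \<in> S.C" by (rule S.inter[OF t r])
    obtain w where w: "w \<in> L" "S.word w (\<theta> \<inter> \<rho>) = e (\<theta> \<inter> \<rho>)" using ecl i by blast
    have eqs: "S.word w \<theta> = e \<theta>" "S.word w \<rho> = e \<rho>"
      by (rule S.coord_eq_mono[OF S.word_closed[OF L_W[OF w(1)]] ec i _ _ w(2)]; use t r in simp)+
    then have "length w < N" using no w(1) by (meson not_le)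
    then show "\<exists>b\<in>?F. b \<rho> = e \<rho>" using w(1) eqs(2) by blast
  qed (rule ec)
  ultimately show False using eL by auto
qed

text \<open>A word of \<open>L\<close> close to \<open>s\<close> occurs, by uniform recurrence,
  inside every long word of \<open>L\<close> close to \<open>e\<close>; the nonempty contexts supply
  the two cofactors.\<close>

lemma J_equivalent:
  assumes e: "e \<in> J" and s: "s \<in> J"
  shows "\<exists>x\<in>S.Pro. \<exists>y\<in>S.Pro. x \<star> s \<star> y = e"
proof -
  have ec: "e \<in> S.Pro" and sc: "s \<in> S.Pro" and scl: "\<forall>\<theta>\<in>S.C. \<exists>w\<in>L. S.word w \<theta> = s \<theta>"
    using e s unfolding J_eq clL_iff Diff_iff by simp_all
  show ?thesis
  proof (rule S.solve_two_sided[OF sc ec])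
    fix \<theta> assume t: "\<theta> \<in> S.C"
    obtain w where w: "w \<in> L" "S.word w \<theta> = s \<theta>" using scl t by blast
    obtain N where N: "\<forall>v\<in>L. N \<le> length v \<longrightarrow> (\<exists>x y. x \<noteq> [] \<and> y \<noteq> [] \<and> v = x @ w @ y)"
      using recurrence[OF w(1)] by blast
    obtain v where v: "v \<in> L" "N \<le> length v" "S.word v \<theta> = e \<theta>" using J_long[OF e t] by blast
    obtain x y where xy: "x \<noteq> []" "y \<noteq> []" "v = x @ w @ y" using N v(1,2) by blast
    have W: "x \<in> S.W" "y \<in> S.W" using language_in[OF v(1)] xy by auto
    note xc = S.word_closed[OF W(1)] and yc = S.word_closed[OF W(2)] and wc = S.word_closed[OF L_W[OF w(1)]]
    have "(S.word x \<star> s) \<theta> = (S.word x \<star> S.word w) \<theta>"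
      by (rule S.mult_coord_cong[OF xc sc xc wc t refl w(2)[symmetric]])
    then have "(S.word x \<star> s \<star> S.word y) \<theta> = (S.word x \<star> S.word w \<star> S.word y) \<theta>"
      by (rule S.mult_coord_cong[OF S.mult_closed[OF xc sc] yc S.mult_closed[OF xc wc] yc t _ refl])
    also have "\<dots> = e \<theta>"
      using v(3) unfolding xy(3) S.word_mult[OF W(1) L_W[OF w(1)]]
        S.word_mult[OF S.append_W[OF W(1) L_W[OF w(1)]] W(2)] append_assoc .
    finally show "\<exists>x\<in>S.Pro. \<exists>y\<in>S.Pro. (x \<star> s \<star> y) \<theta> = e \<theta>"
      by (intro bexI[OF _ xc] bexI[OF _ yc])
  qed
qed

text \<open>The unit is fixed by \<open>S.omega\<close>, so modulo a prefix congruence it is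
  represented by some \<open>\<Phi> (fact n) v\<close> with \<open>fact n\<close> above
  \<open>p\<close>, and \<open>x\<close> inherits the prefix from
  \<open>unit \<star> x\<close>.\<close>

lemma unit_starts:
  assumes x: "x \<in> S.Pro" and ux: "unit \<star> x = x"
    and w: "w \<in> x (prefix_congruence A (length (\<Phi> p [first_letter])))"
  shows "prefix (\<Phi> p [first_letter]) w"
proof -
  let ?p = "\<Phi> p [first_letter]"
  let ?k = "prefix_congruence A (length ?p)"
  have k: "?k \<in> S.C" by (rule prefix_congruence[OF finite_alphabet])
  have u: "unit \<in> S.Pro" by (rule M_in[OF unit(1)])
  obtain v where v: "v \<in> S.W" "S.omega (S.word v) ?k = S.omega unit ?k" using omega_approx[OF u k] by blast
  obtain n where n: "n \<ge> S.index ?k" "p + 1 \<le> fact n" using large_fact by blast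
  let ?v = "\<Phi> (fact n) v"
  have vW: "?v \<in> S.W" by (rule iter_W[OF v(1)])
  have "?v \<in> unit ?k"
    using S.word_rep[OF k vW] v(2) unfolding M_fixed[OF unit(1)] omega_word_coord[OF v(1) k n(1)] by simp
  then have "?v @ w \<in> x ?k" using S.mult_rep[OF u x k _ w] unfolding ux by blast
  then have "(w, ?v @ w) \<in> ?k" using S.mem_class_iff[OF x k w] by simp
  then have "take (length ?p) w = take (length ?p) (?v @ w)" by (simp add: prefix_congruence_def)
  moreover have "prefix ?p ?v" using v(1) n(2) by (intro iter_starts) auto
  then have "take (length ?p) (?v @ w) = ?p" by (auto simp: prefix_def)
  ultimately show ?thesis by (metis take_is_prefix)
qed

text \<open>A factorization \<open>x \<star> y\<close> of the unit is approximated by words \<open>u @ v\<close> of the language in which both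
  factors start with a long prefix of the fixed point, so that \<open>u\<close> can be desubstituted.\<close>

lemma right_unit_in_M:
  assumes nonper: "\<not> periodic_substitution A \<phi>"
    and x: "x \<in> S.Pro" and y: "y \<in> S.Pro" and xy: "x \<star> y = unit"
    and ux: "unit \<star> x = x" and uy: "unit \<star> y = y"
  shows "x \<in> M"
proof -
  obtain K where K: "K \<ge> 1" "\<forall>r. r \<noteq> [] \<longrightarrow> concat (replicate K r) \<notin> L"
    using nonperiodic_bounded_powers[OF nonper] by blast
  have "unit \<in> clL" using M_J unit(1) unfolding J_eq by blast
  then have cl: "x \<star> y \<in> clL" unfolding xy .
  have approx: "\<exists>v\<in>S.W. S.omega (S.word v) \<theta> = x \<theta>" if t: "\<theta> \<in> S.C" for \<theta>
  proof -
    \<comment> \<open>The exponent that computes \<open>S.omega\<close> modulo \<theta>, so that a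
      preimage of \<open>u\<close> under \<open>\<Phi> ?k\<close> exhibits the class of
      \<open>u\<close> as that of an element of \<open>M\<close>.\<close>
    let ?k = "fact (S.index \<theta>) :: nat"
    obtain p where p: "\<forall>v\<in>L. \<forall>\<alpha> \<beta>. \<Phi> ?k v = \<alpha> @ \<Phi> p [first_letter] @ \<beta> \<longrightarrow> (\<exists>v1. prefix v1 v \<and> \<alpha> = \<Phi> ?k v1)"
      using recognizable[OF K(1) _ first_letter_props(1), of ?k] K(2) by auto
    let ?c = "prefix_congruence A (length (\<Phi> p [first_letter]))"
    have c: "?c \<in> S.C" by (rule prefix_congruence[OF finite_alphabet])
    have i: "\<theta> \<inter> ?c \<in> S.C" by (rule S.inter[OF t c])
    obtain u v where uv: "u \<in> x (\<theta> \<inter> ?c)" "v \<in> y (\<theta> \<inter> ?c)" "u @ v \<in> L" using clL_split[OF x y cl i] by blast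
    have "u \<in> x ?c" "v \<in> y ?c" and ux': "u \<in> x \<theta>"
      using S.mono[OF x i c] S.mono[OF y i c] S.mono[OF x i t] uv(1,2) by auto
    then have "prefix (\<Phi> p [first_letter]) u" "prefix (\<Phi> p [first_letter]) v"
      by (auto intro: unit_starts[OF x ux] unit_starts[OF y uy])
    then obtain u' v' where u': "u = \<Phi> p [first_letter] @ u'" and v': "v = \<Phi> p [first_letter] @ v'"
      by (auto simp: prefix_def)
    obtain z where z: "z \<in> L" "sublist (u @ v) (\<Phi> ?k z)" using language_desubst[OF uv(3)] by blast
    then obtain \<alpha> \<beta> where ab: "\<Phi> ?k z = \<alpha> @ (u @ v) @ \<beta>" by (auto simp: sublist_def)
    \<comment> \<open>Recognizability is applied at the start of \<open>u\<close> and again at the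
      start of \<open>v\<close>, which marks the right end of \<open>u\<close>; so both ends of
      \<open>u\<close> are boundaries of letter images.\<close>
    have "\<Phi> ?k z = \<alpha> @ \<Phi> p [first_letter] @ (u' @ v @ \<beta>)" using ab u' by simp
    then obtain z1 where z1: "prefix z1 z" "\<alpha> = \<Phi> ?k z1" using p z(1) by blast
    have "\<Phi> ?k z = (\<alpha> @ u) @ \<Phi> p [first_letter] @ (v' @ \<beta>)" using ab v' by simp
    then obtain z2 where z2: "prefix z2 z" "\<alpha> @ u = \<Phi> ?k z2" using p z(1) by blast
    have zA: "z \<in> lists A" by (rule language_in[OF z(1)])
    have "length (\<Phi> ?k z1) \<le> length (\<Phi> ?k z2)" unfolding z1(2)[symmetric] z2(2)[symmetric] by simp
    then have "prefix z1 z2" by (rule iter_prefix_reflect[OF z1(1) z2(1) zA])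
    then obtain z3 where z3: "z2 = z1 @ z3" by (elim prefixE)
    have u_eq: "u = \<Phi> ?k z3" using z2(2) unfolding z3 z1(2) iter_append by simp
    have uW: "u \<in> S.W" by (rule S.in_class(1)[OF x t ux'])
    have "z3 \<in> lists A" using zA z2(1) unfolding z3 by (auto simp: prefix_def)
    moreover have "z3 \<noteq> []" using uW u_eq by auto
    ultimately have z3W: "z3 \<in> S.W" by simp
    have "S.omega (S.word z3) \<theta> = S.word u \<theta>" unfolding u_eq by (rule omega_word_coord[OF z3W t order_refl])
    also have "\<dots> = x \<theta>" unfolding S.word_coord[OF t] by (rule S.in_class(2)[OF x t ux', symmetric])
    finally show ?thesis by (rule bexI[OF _ z3W])
  qed
  \<comment> \<open>So far \<open>x\<close> is a limit of elements of \<open>M\<close>.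
    Approximating also modulo the inverse image of \<theta> allows \<open>S.omega\<close> to be
    applied to the approximation, which it fixes.\<close>
  have "S.omega x = x"
  proof (rule S.eqI[OF S.omega_closed[OF x] x])
    fix \<theta> assume t: "\<theta> \<in> S.C"
    let ?n = "S.index \<theta>"
    let ?\<rho> = "pullback A (\<phi> ^^ fact ?n) \<theta>"
    have r: "?\<rho> \<in> S.C" by (rule S.pullback[OF t S.power_hom])
    have i: "\<theta> \<inter> ?\<rho> \<in> S.C" by (rule S.inter[OF t r])
    obtain v where v: "v \<in> S.W" "S.omega (S.word v) (\<theta> \<inter> ?\<rho>) = x (\<theta> \<inter> ?\<rho>)" using approx[OF i] by blast
    note vc = S.word_closed[OF v(1)]
    note ov = S.omega_closed[OF vc]
    have eqs: "S.omega (S.word v) \<theta> = x \<theta>" "S.omega (S.word v) ?\<rho> = x ?\<rho>"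
      by (rule S.coord_eq_mono[OF ov x i t _ v(2)], simp, rule S.coord_eq_mono[OF ov x i r _ v(2)], simp)
    have "S.omega x \<theta> = S.E (fact ?n) x \<theta>" by (rule S.omega_coord[OF x t order_refl])
    also have "\<dots> = S.E (fact ?n) (S.omega (S.word v)) \<theta>" by (rule S.E_coord_cong[OF x ov t eqs(2)[symmetric]])
    also have "\<dots> = S.omega (S.omega (S.word v)) \<theta>" by (rule S.omega_coord[OF ov t order_refl, symmetric])
    also have "\<dots> = x \<theta>" unfolding S.omega_omega[OF vc] by (rule eqs(1))
    finally show "S.omega x \<theta> = x \<theta>" .
  qed
  then show ?thesis using x by (intro image_eqI[of x S.omega x]) simp_all
qed

end

section \<open>The presentation\<close>

lemma topspace_quotient_topology: "topspace (quotient_topology T \<theta>) = topspace T // \<theta>"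
proof
  show "topspace (quotient_topology T \<theta>) \<subseteq> topspace T // \<theta>"
    using openin_quotient_topology[of T \<theta> "topspace (quotient_topology T \<theta>)"] by simp
  have "{x \<in> topspace T. \<theta> `` {x} \<in> topspace T // \<theta>} = topspace T" by (auto intro: quotientI)
  then have "openin (quotient_topology T \<theta>) (topspace T // \<theta>)" by (simp add: openin_quotient_topology)
  then show "topspace T // \<theta> \<subseteq> topspace (quotient_topology T \<theta>)" by (rule openin_subset)
qed

lemma continuous_map_quotient_topology: "continuous_map T (quotient_topology T \<theta>) (\<lambda>x. \<theta> `` {x})"
  unfolding continuous_map_def topspace_quotient_topology
  by (auto simp: openin_quotient_topology intro: quotientI)

section \<open>Conjugacy of J-equivalent idempotents\<close>

context pro
begin

lemma translation_continuous:
  assumes s: "s \<in> Pro" and t: "t \<in> Pro"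
  shows "continuous_map T T (\<lambda>x. s \<cdot> x \<cdot> t)"
proof (rule continuous_map_proI[OF pro_axioms pro_axioms])
  show "s \<cdot> x \<cdot> t \<in> Pro" if "x \<in> Pro" for x by (rule mult_closed[OF mult_closed[OF s that] t])
  fix \<theta> assume th: "\<theta> \<in> C"
  have "(s \<cdot> x \<cdot> t) \<theta> = (s \<cdot> y \<cdot> t) \<theta>" if "x \<in> Pro" "y \<in> Pro" "x \<theta> = y \<theta>" for x y
    by (rule mult_coord_cong[OF mult_closed[OF s that(1)] t mult_closed[OF s that(2)] t th
        mult_coord_cong[OF s that(1) s that(2) th refl that(3)] refl])
  then show "\<exists>\<rho>\<in>C. \<forall>x\<in>Pro. \<forall>y\<in>Pro. x \<rho> = y \<rho> \<longrightarrow> (s \<cdot> x \<cdot> t) \<theta> = (s \<cdot> y \<cdot> t) \<theta>"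
    by (intro bexI[OF _ th] ballI impI)
qed

text \<open>That \<open>s\<close> and \<open>t\<close> multiply to \<open>e\<close> is a
  computation. In the other order they give an idempotent \<open>g\<close> below \<open>f\<close>,
  and stability is needed to exclude that it lies strictly below.\<close>

lemma conjugate_idempotents:
  assumes e: "e \<in> Pro" "e \<cdot> e = e" and f: "f \<in> Pro" "f \<cdot> f = f"
    and x: "x \<in> Pro" and y: "y \<in> Pro" and u: "u \<in> Pro" and v: "v \<in> Pro"
    and xy: "x \<cdot> f \<cdot> y = e" and uv: "u \<cdot> e \<cdot> v = f"
  shows "\<exists>s\<in>Pro. \<exists>t\<in>Pro. s \<cdot> t = e \<and> t \<cdot> s = f \<and> e \<cdot> s = s \<and> s \<cdot> f = s \<and> f \<cdot> t = t \<and> t \<cdot> e = t"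
proof -
  define s where "s = e \<cdot> x \<cdot> f"
  define t where "t = f \<cdot> y \<cdot> e"
  note cl = mult_closed
  have sc: "s \<in> Pro" unfolding s_def by (intro cl e f x)
  have tc: "t \<in> Pro" unfolding t_def by (intro cl e f y)
  have idem: "e \<cdot> (e \<cdot> z) = e \<cdot> z" "f \<cdot> (f \<cdot> z) = f \<cdot> z" if "z \<in> Pro" for z
    using mult_assoc[OF e(1) e(1) that] mult_assoc[OF f(1) f(1) that] e(2) f(2) by simp_all
  have xfy: "x \<cdot> (f \<cdot> y) = e" using xy mult_assoc[OF x f(1) y] by simp
  have xfyz: "x \<cdot> (f \<cdot> (y \<cdot> z)) = e \<cdot> z" if "z \<in> Pro" for z
    using mult_assoc[OF f(1) y that] mult_assoc[OF x cl[OF f(1) y] that] xfy by simp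
  have es: "e \<cdot> s = s" and sf: "s \<cdot> f = s" unfolding s_def using e f x by (simp_all add: mult_assoc cl idem)
  have ft: "f \<cdot> t = t" and te: "t \<cdot> e = t" unfolding t_def using e f y by (simp_all add: mult_assoc cl idem)
  have st: "s \<cdot> t = e" unfolding s_def t_def using e f x y by (simp add: mult_assoc cl idem xfyz)
  define g where "g = t \<cdot> s"
  have gc: "g \<in> Pro" unfolding g_def by (rule cl[OF tc sc])
  have "g \<cdot> g = t \<cdot> (s \<cdot> t) \<cdot> s" unfolding g_def using sc tc by (simp add: mult_assoc cl)
  then have gg: "g \<cdot> g = g" unfolding st te by (simp add: g_def)
  have fg: "f \<cdot> g = g" unfolding g_def using mult_assoc[OF f(1) tc sc] ft by simp
  have gf: "g \<cdot> f = g" unfolding g_def using mult_assoc[OF tc sc f(1)] sf by simp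
  have us: "u \<cdot> s \<in> Pro" and tv: "t \<cdot> v \<in> Pro" and usg: "u \<cdot> s \<cdot> g \<in> Pro"
    by (intro cl u sc tc v gc)+
  \<comment> \<open>Inserting \<open>g\<close> by \<open>e = s g t\<close> brings \<open>f\<close>
    into the form \<open>p f q\<close> with \<open>p\<close> ending in \<open>g\<close>. Stability
    then makes \<open>f\<close> a left multiple of \<open>g\<close>, whence
    \<open>f g = f\<close>.\<close>
  have "f = u \<cdot> (s \<cdot> t) \<cdot> v" unfolding st by (rule uv[symmetric])
  also have "s \<cdot> t = s \<cdot> g \<cdot> t"
  proof -
    have "s \<cdot> g \<cdot> t = (s \<cdot> t) \<cdot> (s \<cdot> t)" unfolding g_def using sc tc by (simp add: mult_assoc cl)
    then show ?thesis unfolding st e(2) by simp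
  qed
  also have "u \<cdot> (s \<cdot> g \<cdot> t) \<cdot> v = (u \<cdot> s \<cdot> g) \<cdot> (t \<cdot> v)"
    using u sc gc tc v by (simp add: mult_assoc cl)
  also have "u \<cdot> s \<cdot> g = u \<cdot> s \<cdot> g \<cdot> f" using mult_assoc[OF us gc f(1)] gf by simp
  finally have "f = u \<cdot> s \<cdot> g \<cdot> f \<cdot> (t \<cdot> v)" .
  then obtain z where z: "z \<in> Pro" "z \<cdot> (u \<cdot> s \<cdot> g \<cdot> f) = f"
    using stable_left[OF usg f(1) tv] by blast
  have "z \<cdot> (u \<cdot> s) \<cdot> g = f" using z(2) mult_assoc[OF us gc f(1)] gf mult_assoc[OF z(1) us gc] by simp
  then have "f \<cdot> g = z \<cdot> (u \<cdot> s) \<cdot> g \<cdot> g" by simp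
  also have "\<dots> = z \<cdot> (u \<cdot> s) \<cdot> (g \<cdot> g)" by (rule mult_assoc[OF cl[OF z(1) us] gc gc])
  also have "\<dots> = f" unfolding gg by fact
  finally have "t \<cdot> s = f" using fg by (simp add: g_def)
  then show ?thesis using sc tc st es sf ft te by blast
qed

end

section \<open>The kernel of the idempotent endomorphism\<close>

context pro_endo
begin

definition ker_omega :: "('a pro \<times> 'a pro) set" where
  "ker_omega = {(x, y). x \<in> Pro \<and> y \<in> Pro \<and> omega x = omega y}"

lemma ker_omega_congruence: "is_congruence \<Omega> ker_omega"
proof -
  have "equiv (Pro) ker_omega"
    by (rule equivI) (auto simp: ker_omega_def refl_on_def sym_def trans_def)
  moreover have "\<forall>(x, x')\<in>ker_omega. \<forall>(y, y')\<in>ker_omega. (x \<cdot> y, x' \<cdot> y') \<in> ker_omega"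
    by (auto simp: ker_omega_def mult_closed omega_mult)
  ultimately show ?thesis by (simp only: is_congruence_def)
qed

lemma ker_omega_closed: "closedin (prod_topology T T) ker_omega"
proof -
  have "ker_omega = {z \<in> topspace (prod_topology T T). (omega \<circ> fst) z = (omega \<circ> snd) z}"
    by (auto simp: ker_omega_def topspace)
  then show ?thesis
    by (simp only:) (rule closedin_continuous_maps_eq[OF Hausdorff
        continuous_map_compose[OF continuous_map_fst omega_continuous]
        continuous_map_compose[OF continuous_map_snd omega_continuous]])
qed

text \<open>For a closed congruence with the given relations, the set of all \<open>x\<close>
  related to \<open>omega x\<close> is closed and, by multiplicativity, contains the words, so it is
  everything. Elements with the same image are then related through that image.\<close>

lemma ker_omega_generated:
  "closed_congruence_generated \<Omega> T {(omega (word [a]), word [a]) | a. a \<in> A} = ker_omega"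
proof
  let ?R = "{(omega (word [a]), word [a]) | a. a \<in> A}"
  have W: "[a] \<in> W" if "a \<in> A" for a using that by simp
  have "?R \<subseteq> ker_omega"
    using word_closed[OF W] omega_closed[OF word_closed[OF W]] omega_omega[OF word_closed[OF W]]
    unfolding ker_omega_def by blast
  then show "closed_congruence_generated \<Omega> T ?R \<subseteq> ker_omega"
    unfolding closed_congruence_generated_def using ker_omega_congruence ker_omega_closed by blast
  have "ker_omega \<subseteq> \<theta>"
    if c: "is_congruence \<Omega> \<theta>" and cl: "closedin (prod_topology T T) \<theta>" and R: "?R \<subseteq> \<theta>" for \<theta>
  proof -
    have word: "(omega (word w), word w) \<in> \<theta>" if w: "w \<in> W" for w
    proof -
      have "w \<noteq> []" "set w \<subseteq> A" using w by auto
      then show ?thesis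
      proof (induction w rule: list_nonempty_induct)
        case (single a)
        then show ?case using R by auto
      next
        case (cons a w)
        then have aw: "[a] \<in> W" "w \<in> W" "a \<in> A" "set w \<subseteq> A" by auto
        have "(omega (word [a]) \<cdot> omega (word w), word [a] \<cdot> word w) \<in> \<theta>"
          by (rule congruence_mult[OF c _ cons.IH[OF aw(4)]]) (use R aw(3) in blast)
        then have "(omega (word ([a] @ w)), word ([a] @ w)) \<in> \<theta>"
          by (simp only: omega_mult[OF word_closed[OF aw(1)] word_closed[OF aw(2)], symmetric] word_mult[OF aw(1,2)])
        then show ?case by simp
      qed
    qed
    let ?D = "{x \<in> topspace T. (omega x, x) \<in> \<theta>}"
    have "continuous_map T (prod_topology T T) (\<lambda>x. (omega x, x))"
      using omega_continuous by (simp add: continuous_map_pairedI)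
    then have "closedin T ?D" using cl by (rule closedin_continuous_map_preimage)
    moreover have "word ` W \<subseteq> ?D"
      using word word_closed by (intro image_subsetI) (simp only: topspace mem_Collect_eq simp_thms)
    ultimately have "T closure_of (word ` W) \<subseteq> ?D" by (intro closure_of_minimal)
    then have all: "(omega x, x) \<in> \<theta>" if "x \<in> Pro" for x using that unfolding words_dense by blast
    show ?thesis
    proof
      fix z assume "z \<in> ker_omega"
      then obtain x y where z: "z = (x, y)" "x \<in> Pro" "y \<in> Pro" "omega x = omega y"
        unfolding ker_omega_def by blast
      have "(x, omega y) \<in> \<theta>" using congruence_sym[OF c all[OF z(2)]] unfolding z(4) .
      then show "z \<in> \<theta>" unfolding z(1) using all[OF z(3)] by (rule congruence_trans[OF c])
    qed
  qed
  then show "ker_omega \<subseteq> closed_congruence_generated \<Omega> T ?R"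
    unfolding closed_congruence_generated_def by blast
qed

lemma ker_omega_class_eq:
  "x \<in> Pro \<Longrightarrow> y \<in> Pro \<Longrightarrow> ker_omega `` {x} = ker_omega `` {y} \<longleftrightarrow> omega x = omega y"
  using congruence_class_eq[OF ker_omega_congruence, of x y] by (simp add: ker_omega_def)

text \<open>Distinct classes have distinct images under \<open>omega\<close>, and preimages of open
  sets under \<open>omega\<close> are saturated. This is what later makes a continuous bijection
  from a compact space a homeomorphism.\<close>

lemma quotient_Hausdorff: "Hausdorff_space (quotient_topology T ker_omega)"
proof -
  let ?Q = "quotient_topology T ker_omega"
  let ?q = "\<lambda>x. ker_omega `` {x}"
  let ?N = "\<lambda>U. ?q ` {x \<in> Pro. omega x \<in> U}"
  have in_N: "?q x \<in> ?N U \<longleftrightarrow> omega x \<in> U" if x: "x \<in> Pro" for x U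
  proof
    assume "?q x \<in> ?N U"
    then obtain y where y: "y \<in> Pro" "omega y \<in> U" "?q x = ?q y" by auto
    then show "omega x \<in> U" using ker_omega_class_eq[OF x y(1)] by simp
  next
    assume "omega x \<in> U"
    then show "?q x \<in> ?N U" using x by (intro imageI) simp
  qed
  have open_N: "openin ?Q (?N U)" if U: "openin T U" for U
  proof -
    have "{x \<in> topspace T. ?q x \<in> ?N U} = {x \<in> topspace T. omega x \<in> U}"
      unfolding topspace using in_N by (intro Collect_cong conj_cong refl)
    moreover have "openin T {x \<in> topspace T. omega x \<in> U}"
      by (rule openin_continuous_map_preimage[OF omega_continuous U])
    moreover have "?N U \<subseteq> topspace T // ker_omega"
      unfolding topspace by (intro image_subsetI quotientI) simp
    ultimately show ?thesis unfolding openin_quotient_topology by (simp only:)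
  qed
  show ?thesis unfolding Hausdorff_space_def topspace_quotient_topology topspace
  proof (intro allI impI)
    fix c d assume cd: "c \<in> Pro // ker_omega \<and> d \<in> Pro // ker_omega \<and> c \<noteq> d"
    then obtain x y where xy: "x \<in> Pro" "c = ?q x" "y \<in> Pro" "d = ?q y"
      by (metis quotientE)
    have "omega x \<noteq> omega y" using cd xy ker_omega_class_eq[OF xy(1,3)] by blast
    then obtain U V where UV: "openin T U" "openin T V" "omega x \<in> U" "omega y \<in> V" "disjnt U V"
      using Hausdorff omega_closed[OF xy(1)] omega_closed[OF xy(3)] unfolding Hausdorff_space_def topspace by metis
    have "disjnt (?N U) (?N V)"
      unfolding disjnt_iff
    proof (intro allI notI)
      fix z assume z: "z \<in> ?N U \<and> z \<in> ?N V"
      then obtain w where w: "w \<in> Pro" "z = ?q w" by blast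
      then have "omega w \<in> U" "omega w \<in> V" using z in_N[OF w(1)] by simp_all
      then show False using UV(5) unfolding disjnt_iff by blast
    qed
    then show "\<exists>U V. openin ?Q U \<and> openin ?Q V \<and> c \<in> U \<and> d \<in> V \<and> disjnt U V"
      using open_N[OF UV(1)] open_N[OF UV(2)] in_N[OF xy(1)] in_N[OF xy(3)] UV(3,4) xy(2,4)
      by (intro exI[of _ "?N U"] exI[of _ "?N V"]) simp
  qed
qed

end

section \<open>Projection to the free profinite group\<close>

context proper_substitution
begin

text \<open>The canonical projection onto the free profinite group: congruences with group quotient
  are among those of finite index, so it merely forgets coordinates.\<close>

abbreviation proj :: "'a pro \<Rightarrow> 'a pro" where "proj x \<equiv> restrict x G.C"

lemma G_C: "\<theta> \<in> G.C \<longleftrightarrow> \<theta> \<in> S.C \<and> cancellative A \<theta>"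
  using pro_congruences_fin_group[OF nonempty_alphabet] by blast

lemma proj_closed: "x \<in> S.Pro \<Longrightarrow> proj x \<in> G.Pro"
  unfolding S.carrier_iff G.carrier_iff using G_C by simp

lemma proj_mult: "x \<in> S.Pro \<Longrightarrow> y \<in> S.Pro \<Longrightarrow> proj (x \<star> y) = proj x \<otimes>\<^bsub>G.\<Omega>\<^esub> proj y"
  using G_C by (intro ext) (simp add: free_pro_def)

lemma proj_word: "proj (S.word w) = G.word w"
  using G_C by (intro ext) (simp add: pro_word_def)

lemma proj_omega: "x \<in> S.Pro \<Longrightarrow> proj (S.omega x) = G.omega (proj x)"
proof (rule G.eqI)
  assume x: "x \<in> S.Pro"
  show "proj (S.omega x) \<in> G.Pro" by (rule proj_closed[OF S.omega_closed[OF x]])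
  show "G.omega (proj x) \<in> G.Pro" by (rule G.omega_closed[OF proj_closed[OF x]])
  fix \<theta> assume t: "\<theta> \<in> G.C"
  have ts: "\<theta> \<in> S.C" using t G_C by blast
  have r: "pullback A (\<phi> ^^ fact (G.index \<theta>)) \<theta> \<in> G.C" by (rule G.pullback[OF t G.power_hom])
  \<comment> \<open>\<open>index\<close> depends on the alphabet, \<phi> and \<theta> but not on the
    pseudovariety, so \<open>S.omega\<close> and \<open>G.omega\<close> use the same power at
    \<theta>.\<close>
  let ?f = "\<phi> ^^ fact (G.index \<theta>)"
  have 0: "S.omega x \<theta> = \<theta> `` (?f ` x (pullback A ?f \<theta>))"
    unfolding S.omega_def by (rule S.lift_coord[OF ts])
  have 1: "proj (S.omega x) \<theta> = S.omega x \<theta>" by (rule restrict_apply'[OF t])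
  have 2: "G.omega (proj x) \<theta> = \<theta> `` (?f ` proj x (pullback A ?f \<theta>))"
    unfolding G.omega_def by (rule G.lift_coord[OF t])
  have 3: "proj x (pullback A ?f \<theta>) = x (pullback A ?f \<theta>)" by (rule restrict_apply'[OF r])
  show "proj (S.omega x) \<theta> = G.omega (proj x) \<theta>" unfolding 0 1 2 3 ..
qed

lemma proj_continuous: "continuous_map S.T G.T proj"
proof (rule continuous_map_proI[OF S.pro_axioms G.pro_axioms])
  show "proj x \<in> G.Pro" if "x \<in> S.Pro" for x by (rule proj_closed[OF that])
  fix \<theta> assume t: "\<theta> \<in> G.C"
  then have "\<theta> \<in> S.C" using G_C by blast
  then show "\<exists>\<rho>\<in>S.C. \<forall>x\<in>S.Pro. \<forall>y\<in>S.Pro. x \<rho> = y \<rho> \<longrightarrow> proj x \<theta> = proj y \<theta>"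
    by (rule bexI[rotated]) (simp add: t)
qed

text \<open>The image is compact, hence closed, and contains the dense set of words.\<close>

lemma proj_surj: "g \<in> G.Pro \<Longrightarrow> \<exists>x\<in>S.Pro. proj x = g"
proof -
  assume g: "g \<in> G.Pro"
  have "compactin G.T (proj ` topspace S.T)"
    using S.compact proj_continuous unfolding compact_space_def by (rule image_compactin)
  then have "closedin G.T (proj ` S.Pro)"
    unfolding S.topspace by (rule compactin_imp_closedin[OF G.Hausdorff])
  moreover have "G.word ` S.W \<subseteq> proj ` S.Pro"
  proof (rule image_subsetI)
    fix w assume "w \<in> S.W"
    then show "G.word w \<in> proj ` S.Pro"
      unfolding proj_word[symmetric] by (intro imageI S.word_closed)
  qed
  ultimately have "G.T closure_of (G.word ` S.W) \<subseteq> proj ` S.Pro" by (intro closure_of_minimal)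
  then show ?thesis using g unfolding G.words_dense by blast
qed

text \<open>Since \<open>M\<close> is a group, the finite quotients through which \<open>omega\<close> factors are groups.\<close>

lemma omega_pullback_cancellative:
  assumes t: "\<theta> \<in> S.C"
  shows "pullback A (\<phi> ^^ fact (S.index \<theta>)) \<theta> \<in> G.C"
proof -
  let ?\<rho> = "pullback A (\<phi> ^^ fact (S.index \<theta>)) \<theta>"
  let ?o = "\<lambda>u. S.omega (S.word u)"
  have r: "?\<rho> \<in> S.C" by (rule S.pullback[OF t S.power_hom])
  have coord: "?o u \<theta> = \<theta> `` {(\<phi> ^^ fact (S.index \<theta>)) u}" if "u \<in> S.W" for u
    unfolding S.omega_def by (rule S.lift_word[OF S.omega_compatible that t])
  have iff: "(u, v) \<in> ?\<rho> \<longleftrightarrow> ?o u \<theta> = ?o v \<theta>" if W: "u \<in> S.W" "v \<in> S.W" for u v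
    unfolding coord[OF W(1)] coord[OF W(2)] S.class_eq[OF t S.power_in[OF W(1)] S.power_in[OF W(2)]]
    using W by (simp add: pullback_def)
  have oM: "?o u \<in> M" if "u \<in> S.W" for u by (intro imageI S.word_closed that)
  have app: "?o (u @ v) = ?o u \<star> ?o v" if "u \<in> S.W" "v \<in> S.W" for u v
    by (simp only: S.omega_mult[OF S.word_closed[OF that(1)] S.word_closed[OF that(2)], symmetric] S.word_mult[OF that])
  have "cancellative A ?\<rho>"
    unfolding cancellative_def
  proof (intro ballI conjI impI)
    fix u v w assume W: "u \<in> S.W" "v \<in> S.W" "w \<in> S.W"
    note uM = oM[OF W(1)] and vM = oM[OF W(2)] and wM = oM[OF W(3)]
    \<comment> \<open>Cancelling \<open>w\<close> amounts to multiplying by the inverse of its image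
      in \<open>M\<close>, which respects equality of \<theta>-coordinates.\<close>
    obtain i where i: "i \<in> M" "?o w \<star> i = unit" "i \<star> ?o w = unit" using unit(4)[OF wM] by blast
    { assume "(u @ w, v @ w) \<in> ?\<rho>"
      then have eq: "(?o u \<star> ?o w) \<theta> = (?o v \<star> ?o w) \<theta>"
        unfolding iff[OF S.append_W[OF W(1,3)] S.append_W[OF W(2,3)]] app[OF W(1,3)] app[OF W(2,3)] .
      have "(?o u \<star> ?o w \<star> i) \<theta> = (?o v \<star> ?o w \<star> i) \<theta>"
        by (rule S.mult_coord_cong[OF S.mult_closed[OF M_in[OF uM] M_in[OF wM]] M_in[OF i(1)]
            S.mult_closed[OF M_in[OF vM] M_in[OF wM]] M_in[OF i(1)] t eq refl])
      then have "?o u \<theta> = ?o v \<theta>"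
        unfolding S.mult_assoc[OF M_in[OF uM] M_in[OF wM] M_in[OF i(1)]]
          S.mult_assoc[OF M_in[OF vM] M_in[OF wM] M_in[OF i(1)]] i(2) unit(3)[OF uM] unit(3)[OF vM] .
      then show "(u, v) \<in> ?\<rho>" unfolding iff[OF W(1,2)] . }
    { assume "(w @ u, w @ v) \<in> ?\<rho>"
      then have eq: "(?o w \<star> ?o u) \<theta> = (?o w \<star> ?o v) \<theta>"
        unfolding iff[OF S.append_W[OF W(3,1)] S.append_W[OF W(3,2)]] app[OF W(3,1)] app[OF W(3,2)] .
      have "(i \<star> (?o w \<star> ?o u)) \<theta> = (i \<star> (?o w \<star> ?o v)) \<theta>"
        by (rule S.mult_coord_cong[OF M_in[OF i(1)] S.mult_closed[OF M_in[OF wM] M_in[OF uM]]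
            M_in[OF i(1)] S.mult_closed[OF M_in[OF wM] M_in[OF vM]] t refl eq])
      then have "?o u \<theta> = ?o v \<theta>"
        unfolding S.mult_assoc[OF M_in[OF i(1)] M_in[OF wM] M_in[OF uM], symmetric]
          S.mult_assoc[OF M_in[OF i(1)] M_in[OF wM] M_in[OF vM], symmetric] i(3) unit(2)[OF uM] unit(2)[OF vM] .
      then show "(u, v) \<in> ?\<rho>" unfolding iff[OF W(1,2)] . }
  qed
  then show ?thesis using r G_C by blast
qed

text \<open>An element of \<open>M\<close> is its own image under \<open>S.omega\<close>, whose
  coordinate at \<theta> is computed from a coordinate with group quotient, and \<open>proj\<close>
  keeps the latter.\<close>

lemma proj_inj_on_M: "x \<in> M \<Longrightarrow> y \<in> M \<Longrightarrow> proj x = proj y \<Longrightarrow> x = y"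
proof (rule S.eqI)
  assume x: "x \<in> M" and y: "y \<in> M" and eq: "proj x = proj y"
  show xc: "x \<in> S.Pro" and yc: "y \<in> S.Pro" using x y M_in by blast+
  fix \<theta> assume t: "\<theta> \<in> S.C"
  let ?\<rho> = "pullback A (\<phi> ^^ fact (S.index \<theta>)) \<theta>"
  have "x ?\<rho> = y ?\<rho>"
    using fun_cong[OF eq, of ?\<rho>] unfolding restrict_apply'[OF omega_pullback_cancellative[OF t]] .
  then have "S.omega x \<theta> = S.omega y \<theta>" by (simp only: S.omega_def S.lift_coord[OF t])
  then show "x \<theta> = y \<theta>" unfolding M_fixed[OF x] M_fixed[OF y] .
qed

lemma M_subgroup: "semigroup_subgroup S.\<Omega> M"
  unfolding semigroup_subgroup_def using M_group M_in by blast

text \<open>A group \<open>K\<close> above \<open>M\<close> has the same identity, and for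
  \<open>x\<close> in \<open>K\<close> its inverse in \<open>K\<close> is the second factor that
  \<open>right_unit_in_M\<close> asks for.\<close>

lemma M_maximal:
  assumes "\<not> periodic_substitution A \<phi>"
  shows "maximal_subgroup S.\<Omega> M"
  unfolding maximal_subgroup_def
proof (intro conjI allI impI M_subgroup)
  fix K assume K: "semigroup_subgroup S.\<Omega> K \<and> M \<subseteq> K"
  then have Kc: "K \<subseteq> S.Pro" and Kg: "is_group (S.\<Omega>\<lparr>carrier := K\<rparr>)"
    by (simp_all add: semigroup_subgroup_def)
  obtain e where e: "e \<in> K" "\<forall>x\<in>K. e \<star> x = x \<and> x \<star> e = x" "\<forall>x\<in>K. \<exists>y\<in>K. x \<star> y = e \<and> y \<star> x = e"
    using subgroup_unfold[OF Kg] by blast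
  have uK: "unit \<in> K" using K unit(1) by blast
  then obtain y where y: "y \<in> K" "unit \<star> y = e" using e(3) by blast
  have "e = unit \<star> unit \<star> y" unfolding unit(2)[OF unit(1)] by (rule y(2)[symmetric])
  also have "\<dots> = unit \<star> e"
    using S.mult_assoc[OF M_in[OF unit(1)] M_in[OF unit(1)], of y] y Kc by auto
  also have "\<dots> = unit" using e(2) uK by blast
  finally have eu: "e = unit" .
  have "x \<in> M" if x: "x \<in> K" for x
  proof -
    obtain z where z: "z \<in> K" "x \<star> z = e" using e(3) x by blast
    show ?thesis
    proof (rule right_unit_in_M[OF assms])
      show "x \<in> S.Pro" "z \<in> S.Pro" using x z(1) Kc by blast+
      show "x \<star> z = unit" using z(2) eu by simp
      show "unit \<star> x = x" "unit \<star> z = z" using e(2) x z(1) unfolding eu by blast+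
    qed
  qed
  then show "K = M" using K by blast
qed

lemma schutzenberger_group_presentation:
  assumes nonper: "\<not> periodic_substitution A \<phi>"
  shows "admits_group_presentation (schutzenberger_group A \<phi>) (schutzenberger_topology A \<phi>) A
           {(omega_power (\<Omega>G A) (\<Omega>G_topology A) (group_extension A \<phi>) (pro_word fin_group A [a]),
             pro_word fin_group A [a]) | a. a \<in> A}"
proof -
  \<comment> \<open>\<open>H\<close> is an unspecified maximal subgroup in \<open>J\<close>. The
    group \<open>M\<close> witnesses that one exists and still has to be related to
    \<open>H\<close>.\<close>
  define H where "H = schutzenberger_carrier A \<phi>"
  have "maximal_subgroup S.\<Omega> H \<and> H \<subseteq> J"
    unfolding H_def schutzenberger_carrier_def
    by (rule someI_ex, rule exI[of _ M]) (intro conjI M_maximal[OF nonper] M_J)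
  then have Hmax: "maximal_subgroup S.\<Omega> H" and HJ: "H \<subseteq> J" by blast+
  then have Hc: "H \<subseteq> S.Pro" and Hg: "is_group (S.\<Omega>\<lparr>carrier := H\<rparr>)"
    by (simp_all add: maximal_subgroup_def semigroup_subgroup_def)
  obtain e where e: "e \<in> H" "\<forall>x\<in>H. e \<star> x = x \<and> x \<star> e = x" "\<forall>x\<in>H. \<exists>y\<in>H. x \<star> y = e \<and> y \<star> x = e"
      "\<forall>x\<in>H. \<forall>y\<in>H. x \<star> y \<in> H"
    using subgroup_unfold[OF Hg] by blast
  note cl = S.mult_closed and as = S.mult_assoc
  have ec: "e \<in> S.Pro" using e(1) Hc by blast
  have uc: "unit \<in> S.Pro" by (rule M_in[OF unit(1)])
  have eJ: "e \<in> J" and uJ: "unit \<in> J" using e(1) HJ unit(1) M_J by blast+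
  obtain x y where xy: "x \<in> S.Pro" "y \<in> S.Pro" "x \<star> unit \<star> y = e"
    using J_equivalent[OF eJ uJ] by blast
  obtain u v where uv: "u \<in> S.Pro" "v \<in> S.Pro" "u \<star> e \<star> v = unit"
    using J_equivalent[OF uJ eJ] by blast
  have ee: "e \<star> e = e" using e(1,2) by blast
  obtain s t where st: "s \<in> S.Pro" "t \<in> S.Pro" "s \<star> t = e" "t \<star> s = unit" "e \<star> s = s"
      "s \<star> unit = s" "unit \<star> t = t" "t \<star> e = t"
    using S.conjugate_idempotents[OF ec ee uc unit(2)[OF unit(1)] xy(1,2) uv(1,2) xy(3) uv(3)] by blast
  \<comment> \<open>Conjugations that will be mutually inverse between \<open>H\<close> and
    \<open>M\<close>. That \<kappa> takes its values in \<open>M\<close> is not formal: it rests on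
    \<open>right_unit_in_M\<close> and thus on recognizability.\<close>
  define \<kappa> where "\<kappa> k = t \<star> k \<star> s" for k
  define \<mu> where "\<mu> m = s \<star> m \<star> t" for m
  have \<kappa>_mult: "\<kappa> k \<star> \<kappa> l = \<kappa> (k \<star> l)" if "k \<in> H" "l \<in> H" for k l
  proof -
    have c: "k \<in> S.Pro" "l \<in> S.Pro" using that Hc by blast+
    have "\<kappa> k \<star> \<kappa> l = t \<star> (k \<star> (s \<star> t)) \<star> l \<star> s" unfolding \<kappa>_def using c st(1,2) by (simp add: as cl)
    also have "\<dots> = \<kappa> (k \<star> l)" unfolding st(3) \<kappa>_def using c st(1,2) e(2) that by (simp add: as cl)
    finally show ?thesis .
  qed
  have \<kappa>_e: "\<kappa> e = unit" unfolding \<kappa>_def st(8) by (rule st(4))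
  have \<kappa>_c: "\<kappa> k \<in> S.Pro" if "k \<in> H" for k unfolding \<kappa>_def using that Hc by (intro cl st(1,2)) blast
  have \<kappa>_u: "unit \<star> \<kappa> k = \<kappa> k" if "k \<in> H" for k
  proof -
    have c: "k \<in> S.Pro" using that Hc by blast
    have "unit \<star> \<kappa> k = (unit \<star> t) \<star> k \<star> s" unfolding \<kappa>_def using c st(1,2) uc by (simp add: as cl)
    then show ?thesis unfolding st(7) \<kappa>_def .
  qed
  have \<kappa>_M: "\<kappa> k \<in> M" if k: "k \<in> H" for k
  proof -
    obtain l where l: "l \<in> H" "k \<star> l = e" using e(3) k by blast
    show ?thesis
      by (rule right_unit_in_M[OF nonper \<kappa>_c[OF k] \<kappa>_c[OF l(1)] _ \<kappa>_u[OF k] \<kappa>_u[OF l(1)]])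
        (simp only: \<kappa>_mult[OF k l(1)] l(2) \<kappa>_e)
  qed
  have \<mu>\<kappa>: "\<mu> (\<kappa> k) = k" if k: "k \<in> H" for k
  proof -
    have c: "k \<in> S.Pro" using k Hc by blast
    have "\<mu> (\<kappa> k) = (s \<star> t) \<star> k \<star> (s \<star> t)" unfolding \<kappa>_def \<mu>_def using c st(1,2) by (simp add: as cl)
    then show ?thesis unfolding st(3) using e(2) k by simp
  qed
  have \<kappa>\<mu>: "\<kappa> (\<mu> m) = m" if m: "m \<in> M" for m
  proof -
    have "\<kappa> (\<mu> m) = (t \<star> s) \<star> m \<star> (t \<star> s)" unfolding \<kappa>_def \<mu>_def using M_in[OF m] st(1,2) by (simp add: as cl)
    then show ?thesis unfolding st(4) using unit(2)[OF m] unit(3)[OF m] by simp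
  qed
  have \<mu>_mult: "\<mu> m \<star> \<mu> l = \<mu> (m \<star> l)" if "m \<in> M" "l \<in> M" for m l
  proof -
    have c: "m \<in> S.Pro" "l \<in> S.Pro" using that M_in by blast+
    have "\<mu> m \<star> \<mu> l = s \<star> (m \<star> (t \<star> s)) \<star> l \<star> t" unfolding \<mu>_def using c st(1,2) by (simp add: as cl)
    also have "\<dots> = \<mu> (m \<star> l)" unfolding st(4) unit(3)[OF that(1)] \<mu>_def using c st(1,2) by (simp add: as cl)
    finally show ?thesis .
  qed
  have \<mu>_u: "\<mu> unit = e" unfolding \<mu>_def st(6) by (rule st(3))
  \<comment> \<open>The conjugate of \<open>M\<close> under \<mu> is a group that includes
    \<open>H\<close>, so the maximality of \<open>H\<close> forces equality.\<close>
  have "is_group (S.\<Omega>\<lparr>carrier := \<mu> ` M\<rparr>)"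
  proof (rule is_groupI)
    have c: "\<mu> m \<in> S.Pro" if "m \<in> M" for m unfolding \<mu>_def by (intro cl st(1,2) M_in[OF that])
    have clo: "p \<star> q \<in> \<mu> ` M" if "p \<in> \<mu> ` M" "q \<in> \<mu> ` M" for p q
      using that \<mu>_mult unit(5) by auto
    show "is_semigroup (S.\<Omega>\<lparr>carrier := \<mu> ` M\<rparr>)"
      unfolding is_semigroup_def using clo as c by auto
    show "carrier (S.\<Omega>\<lparr>carrier := \<mu> ` M\<rparr>) \<noteq> {}" using unit(1) by auto
    fix p q assume "p \<in> carrier (S.\<Omega>\<lparr>carrier := \<mu> ` M\<rparr>)" "q \<in> carrier (S.\<Omega>\<lparr>carrier := \<mu> ` M\<rparr>)"
    then have pq: "p \<in> \<mu> ` M" "q \<in> \<mu> ` M" by simp_all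
    obtain a where a: "p = \<mu> a" "a \<in> M" using pq(1) by (rule imageE)
    obtain b where b: "q = \<mu> b" "b \<in> M" using pq(2) by (rule imageE)
    note ab = a(2,1) b(2,1)
    obtain i where i: "i \<in> M" "a \<star> i = unit" "i \<star> a = unit" using unit(4)[OF ab(1)] by blast
    have "p \<star> \<mu> (i \<star> b) = q"
      unfolding ab(2,4) \<mu>_mult[OF ab(1) unit(5)[OF i(1) ab(3)]]
        as[OF M_in[OF ab(1)] M_in[OF i(1)] M_in[OF ab(3)], symmetric] i(2) unit(2)[OF ab(3)] ..
    then show "\<exists>x\<in>carrier (S.\<Omega>\<lparr>carrier := \<mu> ` M\<rparr>). p \<otimes>\<^bsub>S.\<Omega>\<lparr>carrier := \<mu> ` M\<rparr>\<^esub> x = q"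
      using unit(5)[OF i(1) ab(3)] by (intro bexI[of _ "\<mu> (i \<star> b)"]) simp_all
    have "\<mu> (b \<star> i) \<star> p = q"
      unfolding ab(2,4) \<mu>_mult[OF unit(5)[OF ab(3) i(1)] ab(1)]
        as[OF M_in[OF ab(3)] M_in[OF i(1)] M_in[OF ab(1)]] i(3) unit(3)[OF ab(3)] ..
    then show "\<exists>x\<in>carrier (S.\<Omega>\<lparr>carrier := \<mu> ` M\<rparr>). x \<otimes>\<^bsub>S.\<Omega>\<lparr>carrier := \<mu> ` M\<rparr>\<^esub> p = q"
      using unit(5)[OF ab(3) i(1)] by (intro bexI[of _ "\<mu> (b \<star> i)"]) simp_all
  qed
  moreover have "\<mu> ` M \<subseteq> S.Pro" unfolding \<mu>_def by (intro image_subsetI cl st(1,2) M_in)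
  moreover have H_sub: "H \<subseteq> \<mu> ` M"
  proof
    fix k assume k: "k \<in> H"
    have "\<mu> (\<kappa> k) \<in> \<mu> ` M" by (rule imageI[OF \<kappa>_M[OF k]])
    then show "k \<in> \<mu> ` M" unfolding \<mu>\<kappa>[OF k] .
  qed
  ultimately have H_eq: "H = \<mu> ` M" using Hmax unfolding maximal_subgroup_def semigroup_subgroup_def by blast
  have \<mu>_H: "\<mu> m \<in> H" if "m \<in> M" for m unfolding H_eq by (rule imageI[OF that])
  let ?TH = "subtopology S.T H"
  have topH: "topspace ?TH = H" using Hc by (auto simp: S.topspace)
  have compactM: "compactin S.T M"
    using image_compactin[OF S.compact[unfolded compact_space_def] S.omega_continuous] unfolding S.topspace .
  have "compactin S.T H"
    unfolding H_eq \<mu>_def by (rule image_compactin[OF compactM S.translation_continuous[OF st(1,2)]])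
  then have compH: "compact_space ?TH" by (simp add: compact_space_subtopology)
  let ?K = "G.ker_omega"
  let ?Q = "quotient_topology G.T ?K"
  \<comment> \<open>Conjugation into \<open>M\<close>, projection, then the quotient map.
    Injectivity holds because \<open>proj\<close> is injective on \<open>M\<close> with values fixed
    by \<open>G.omega\<close>; surjectivity holds because the class of \<open>g\<close> contains
    \<open>G.omega g\<close>, the projection of an element of \<open>M\<close>.\<close>
  define h where "h k = ?K `` {proj (\<kappa> k)}" for k
  have pc: "proj (\<kappa> k) \<in> G.Pro" if "k \<in> H" for k by (rule proj_closed[OF \<kappa>_c[OF that]])
  have "continuous_map S.T ?Q ((\<lambda>g. ?K `` {g}) \<circ> (proj \<circ> (\<lambda>k. t \<star> k \<star> s)))"
    by (rule continuous_map_compose[OF continuous_map_compose[OF S.translation_continuous[OF st(2,1)] proj_continuous]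
        continuous_map_quotient_topology])
  moreover have "h = (\<lambda>g. ?K `` {g}) \<circ> (proj \<circ> (\<lambda>k. t \<star> k \<star> s))"
    by (rule ext) (simp only: h_def \<kappa>_def comp_apply)
  ultimately have "continuous_map S.T ?Q h" by (simp only:)
  then have h_cont: "continuous_map ?TH ?Q h" by (rule continuous_map_from_subtopology)
  have h_inj: "inj_on h H"
  proof (rule inj_onI)
    fix k l assume kl: "k \<in> H" "l \<in> H" "h k = h l"
    have "G.omega (proj (\<kappa> k)) = G.omega (proj (\<kappa> l))"
      using kl(3) unfolding h_def G.ker_omega_class_eq[OF pc[OF kl(1)] pc[OF kl(2)]] .
    moreover have "G.omega (proj (\<kappa> j)) = proj (\<kappa> j)" if j: "j \<in> H" for j
      using proj_omega[OF \<kappa>_c[OF j]] unfolding M_fixed[OF \<kappa>_M[OF j]] by (rule sym)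
    ultimately have "proj (\<kappa> k) = proj (\<kappa> l)" using kl(1,2) by metis
    then have "\<kappa> k = \<kappa> l" by (rule proj_inj_on_M[OF \<kappa>_M[OF kl(1)] \<kappa>_M[OF kl(2)]])
    then show "k = l" using \<mu>\<kappa>[OF kl(1)] \<mu>\<kappa>[OF kl(2)] by metis
  qed
  have h_surj: "h ` H = G.Pro // ?K"
  proof
    show "h ` H \<subseteq> G.Pro // ?K" unfolding h_def by (intro image_subsetI quotientI pc)
    show "G.Pro // ?K \<subseteq> h ` H"
    proof
      fix c assume "c \<in> G.Pro // ?K"
      then obtain g where g: "g \<in> G.Pro" "c = ?K `` {g}" by (rule quotientE)
      obtain z where z: "z \<in> S.Pro" "proj z = g" using proj_surj[OF g(1)] by blast
      let ?m = "S.omega z"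
      have m: "?m \<in> M" by (rule imageI[OF z(1)])
      have pm: "proj ?m = G.omega g" unfolding proj_omega[OF z(1)] z(2) ..
      have "?K `` {g} = ?K `` {G.omega g}"
        unfolding G.ker_omega_class_eq[OF g(1) G.omega_closed[OF g(1)]] G.omega_omega[OF g(1)] ..
      then have "c = h (\<mu> ?m)" unfolding h_def \<kappa>\<mu>[OF m] pm g(2) .
      then show "c \<in> h ` H" using imageI[OF \<mu>_H[OF m], of h] by simp
    qed
  qed
  have homeo: "homeomorphic_map ?TH ?Q h"
    by (rule continuous_imp_homeomorphic_map[OF h_cont compH G.quotient_Hausdorff])
      (simp_all only: topH topspace_quotient_topology G.topspace h_surj h_inj)
  have "h \<in> hom (S.\<Omega>\<lparr>carrier := H\<rparr>) (quotient_semigroup G.\<Omega> ?K)"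
  proof -
    have "h (k \<star> l) = h k \<otimes>\<^bsub>quotient_semigroup G.\<Omega> ?K\<^esub> h l" if "k \<in> H" "l \<in> H" for k l
      unfolding h_def quotient_mult[OF G.ker_omega_congruence pc[OF that(1)] pc[OF that(2)]]
        \<kappa>_mult[OF that, symmetric] proj_mult[OF \<kappa>_c[OF that(1)] \<kappa>_c[OF that(2)]] ..
    moreover have "h k \<in> G.Pro // ?K" if "k \<in> H" for k
      unfolding h_surj[symmetric] by (rule imageI[OF that])
    ultimately show ?thesis by (simp add: hom_def quotient_semigroup_def)
  qed
  moreover have "bij_betw h H (G.Pro // ?K)" using h_inj h_surj by (simp add: bij_betw_def)
  ultimately have iso: "h \<in> iso (S.\<Omega>\<lparr>carrier := H\<rparr>) (quotient_semigroup G.\<Omega> ?K)"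
    by (simp add: iso_def quotient_semigroup_def)
  have ge: "group_extension A \<phi> = restrict (G.E 1) (G.Pro)"
    unfolding group_extension_def by (rule G.endomorphism_extension)
  have "omega_power G.\<Omega> G.T (group_extension A \<phi>) (G.word [a]) = G.omega (G.word [a])" if "a \<in> A" for a
    by (rule G.omega_power_eq[OF _ G.word_closed[OF letter_W[OF that]]]) (simp add: ge)
  then have R: "{(omega_power G.\<Omega> G.T (group_extension A \<phi>) (G.word [a]), G.word [a]) | a. a \<in> A} =
      {(G.omega (G.word [a]), G.word [a]) | a. a \<in> A}" by (intro Collect_cong) metis
  show ?thesis
    unfolding admits_group_presentation_def Let_def R G.ker_omega_generated topologically_isomorphic_def
      schutzenberger_group_def schutzenberger_topology_def H_def[symmetric]
    using iso homeo by blast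
qed

end

theorem theorem6p4:
  fixes A :: "'a set" and \<phi> :: "'a list \<Rightarrow> 'a list"
  assumes "finite A"
    and "substitution A \<phi>"
    and "primitive A \<phi>"
    and "proper A \<phi>"
    and "\<not> periodic_substitution A \<phi>"
  shows "admits_group_presentation (schutzenberger_group A \<phi>) (schutzenberger_topology A \<phi>) A
           {(omega_power (\<Omega>G A) (\<Omega>G_topology A) (group_extension A \<phi>) (pro_word fin_group A [a]),
             pro_word fin_group A [a]) | a. a \<in> A}"
proof -
  interpret proper_substitution A \<phi> by unfold_locales fact+
  show ?thesis by (rule schutzenberger_group_presentation) fact
qed

end
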